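(* For irreducible $4\times 4$ 0-1 matrices which are not permutation matrices, primitive equivalence is not a necessary condition for isomorphism of the Cuntz-Krieger algebras. Specifically, the irreducible matrices $$A=\begin{pmatrix}1&1&1&1\\1&0&1&1\\1&1&0&1\\1&1&1&0\end{pmatrix},\qquad B=\begin{pmatrix}0&1&1&1\\1&0&1&1\\1&1&0&1\\1&1&0&0\end{pmatrix}$$ satisfy $\mathcal{O}_A\cong\mathcal{O}_B$, but $A$ and $B$ are not primitively equivalent.
   Context: A square matrix $B$ with nonnegative entries is irreducible if for all $i,j$ there is $N\in\mathbf{N}$ with $B^N(i,j)>0$. Cuntz-Krieger algebra. For a finite $n\times n$ 0-1 matrix $B$ with no zero rows or columns (irreducible and not a permutation matrix), $\mathcal{O}_B$ is the Cuntz-Krieger algebra; it coincides with the graph $C^*$-algebra of the directed graph with vertices $1,\dots,n$ and $B_{ij}$ edges from $i$ to $j$, i.e. with the universal $C^*$-algebra generated by mutually orthogonal projections $P_v$ (one per vertex) and partial isometries $S_e$ (one per edge) with $S_e^*S_e=P_{r(e)}$ and $P_v=\sum_{s(e)=v}S_eS_e^*$, where $s(e),r(e)$ are the source and range of $e$. Primitive transfer. Let $B$ be a square 0-1 matrix; write $B_p$ for its $p$-th row and $E_i$ for the row with a $1$ in position $i$ and $0$ elsewhere. Suppose $B_p$ is a nonzero row and $B_p=E_{k_1}+\cdots+E_{k_r}+B_{m_1}+\cdots+B_{m_s}$ for some distinct indices $k_1,\dots,k_r,m_1,\dots,m_s$ (all $r+s$ of them pairwise distinct) with $p\notin\{m_1,\dots,m_s\}$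 and no $B_{m_i}$ a zero row. Let $C$ be the matrix which agrees with $B$ outside row $p$, and with $C_{pj}=1$ if $j\in\{k_1,\dots,k_r,m_1,\dots,m_s\}$ and $C_{pj}=0$ otherwise. Then $C$ is called a primitive transfer of $B$ (at $p$). Primitive equivalence. Two square 0-1 matrices $B,C$ of the same size are primitively equivalent if there are matrices $D_1=B,D_2,\dots,D_q=C$ such that for each $1\le i\le q-1$: $D_i$ is a primitive transfer of $D_{i+1}$, or $D_{i+1}$ is a primitive transfer of $D_i$, or $D_i=PD_{i+1}P^{-1}$ for a permutation matrix $P$. *)

theory Defs
  imports
    Complex_Main
    "HOL-Library.Poly_Mapping"
    "HOL-Algebra.Module"
    "HOL-Algebra.QuotRing"
    "Jordan_Normal_Form.Matrix"
    "Graph_Theory.Digraph"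
begin

hide_const (open) Poly_Mapping.map Poly_Mapping.range

section \<open>Matrices\<close>

text \<open>Indices run through \<open>0, \<dots>, n - 1\<close> instead of \<open>1, \<dots>, n\<close>.\<close>

definition zero_one_mat :: "nat \<Rightarrow> int mat \<Rightarrow> bool" where
  "zero_one_mat n B \<longleftrightarrow>
     B \<in> carrier_mat n n \<and> (\<forall>i<n. \<forall>j<n. B $$ (i, j) \<in> {0, 1})"

text \<open>The exponent is taken to be positive, which matters only for the \<open>1 \<times> 1\<close> zero matrix.\<close>

definition irreducible_mat :: "nat \<Rightarrow> int mat \<Rightarrow> bool" where
  "irreducible_mat n B \<longleftrightarrow>
     B \<in> carrier_mat n n \<and> (\<forall>i<n. \<forall>j<n. B $$ (i, j) \<ge> 0) \<and>
     (\<forall>i<n. \<forall>j<n. \<exists>N\<ge>1. (B ^\<^sub>m N) $$ (i, j) > 0)"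

definition permutation_mat :: "nat \<Rightarrow> int mat \<Rightarrow> bool" where
  "permutation_mat n P \<longleftrightarrow>
     zero_one_mat n P \<and>
     (\<forall>i<n. \<exists>!j. j < n \<and> P $$ (i, j) = 1) \<and>
     (\<forall>j<n. \<exists>!i. i < n \<and> P $$ (i, j) = 1)"


section \<open>Primitive equivalence\<close>

text \<open>
  The sets \<open>K\<close> and \<open>M\<close> consist of the indices \<open>k\<^sub>1, \<dots>, k\<^sub>r\<close> and \<open>m\<^sub>1, \<dots>, m\<^sub>s\<close>;
  \<open>unit_vec n k\<close> is the row written \<open>E\<^sub>k\<close>.
\<close>

definition primitive_transfer_at :: "nat \<Rightarrow> nat \<Rightarrow> int mat \<Rightarrow> int mat \<Rightarrow> bool" where
  "primitive_transfer_at n p B C \<longleftrightarrow>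
     zero_one_mat n B \<and> p < n \<and> row B p \<noteq> 0\<^sub>v n \<and>
     (\<exists>K M. K \<subseteq> {..<n} \<and> M \<subseteq> {..<n} \<and> K \<inter> M = {} \<and> p \<notin> M \<and>
        (\<forall>m\<in>M. row B m \<noteq> 0\<^sub>v n) \<and>
        (\<forall>j<n. row B p $ j = (\<Sum>k\<in>K. unit_vec n k $ j) + (\<Sum>m\<in>M. row B m $ j)) \<and>
        C = mat n n (\<lambda>(i, j). if i = p then (if j \<in> K \<union> M then 1 else 0) else B $$ (i, j)))"

definition primitive_transfer :: "nat \<Rightarrow> int mat \<Rightarrow> int mat \<Rightarrow> bool" where
  "primitive_transfer n B C \<longleftrightarrow> (\<exists>p. primitive_transfer_at n p B C)"

definition permutation_conjugate :: "nat \<Rightarrow> int mat \<Rightarrow> int mat \<Rightarrow> bool" where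
  "permutation_conjugate n B C \<longleftrightarrow>
     (\<exists>P Q. permutation_mat n P \<and> Q \<in> carrier_mat n n \<and> inverts_mat P Q \<and> inverts_mat Q P \<and>
        B = P * C * Q)"

definition primitive_step :: "nat \<Rightarrow> int mat \<Rightarrow> int mat \<Rightarrow> bool" where
  "primitive_step n B C \<longleftrightarrow>
     zero_one_mat n B \<and> zero_one_mat n C \<and>
     (primitive_transfer n C B \<or> primitive_transfer n B C \<or> permutation_conjugate n B C)"

definition primitively_equivalent :: "nat \<Rightarrow> int mat \<Rightarrow> int mat \<Rightarrow> bool" where
  "primitively_equivalent n B C \<longleftrightarrow>
     zero_one_mat n B \<and> zero_one_mat n C \<and> (primitive_step n)\<^sup>*\<^sup>* B C"


section \<open>The free *-algebra on the vertices and edges of a digraph\<close>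

datatype ('v, 'e) gen = Vert 'v | Edge 'e

datatype 'x letter = Plain 'x | Adj 'x

fun adj_letter :: "'x letter \<Rightarrow> 'x letter" where
  "adj_letter (Plain x) = Adj x"
| "adj_letter (Adj x) = Plain x"

fun letter_gen :: "'x letter \<Rightarrow> 'x" where
  "letter_gen (Plain x) = x"
| "letter_gen (Adj x) = x"

datatype 'x gen_word = Word (letters: "'x letter list")

instantiation gen_word :: (type) monoid_add
begin

definition zero_gen_word :: "'a gen_word" where
  "0 = Word []"

definition plus_gen_word :: "'a gen_word \<Rightarrow> 'a gen_word \<Rightarrow> 'a gen_word" where
  "u + v = Word (letters u @ letters v)"

instance
  by standard (simp_all add: zero_gen_word_def plus_gen_word_def)

end

text \<open>
  By the previous instance, \<open>'x gen_word \<Rightarrow>\<^sub>0 complex\<close> is the monoid algebra of the words over the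
  letters \<open>x\<close>, \<open>x\<^sup>*\<close>, with concatenation extended bilinearly as its multiplication.
\<close>

type_synonym 'x star_poly = "'x gen_word \<Rightarrow>\<^sub>0 complex"

definition sp_gen :: "'x \<Rightarrow> 'x star_poly" where
  "sp_gen x = Poly_Mapping.single (Word [Plain x]) 1"

definition sp_scale :: "complex \<Rightarrow> 'x star_poly \<Rightarrow> 'x star_poly" where
  "sp_scale c f = Poly_Mapping.single 0 c * f"

definition star_word :: "'x gen_word \<Rightarrow> 'x gen_word" where
  "star_word w = Word (rev (map adj_letter (letters w)))"

definition sp_star :: "'x star_poly \<Rightarrow> 'x star_poly" where
  "sp_star f = (\<Sum>w\<in>Poly_Mapping.keys f.
      Poly_Mapping.single (star_word w) (cnj (Poly_Mapping.lookup f w)))"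

definition graph_gens :: "('v, 'e) pre_digraph \<Rightarrow> ('v, 'e) gen set" where
  "graph_gens G = Vert ` verts G \<union> Edge ` arcs G"

text \<open>
  Polynomials without constant term: as usual for universal \<open>C\<^sup>*\<close>-algebras, no unit is
  adjoined.
\<close>

definition free_star_alg :: "('v, 'e) pre_digraph \<Rightarrow> ('v, 'e) gen star_poly set" where
  "free_star_alg G = {f. \<forall>w\<in>Poly_Mapping.keys f.
      w \<noteq> 0 \<and> letter_gen ` set (letters w) \<subseteq> graph_gens G}"


section \<open>The graph \<open>C\<^sup>*\<close>-algebra\<close>

abbreviation sp_P :: "'v \<Rightarrow> ('v, 'e) gen star_poly" where
  "sp_P v \<equiv> sp_gen (Vert v)"

abbreviation sp_S :: "'e \<Rightarrow> ('v, 'e) gen star_poly" where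
  "sp_S e \<equiv> sp_gen (Edge e)"

text \<open>
  \<open>tail G e\<close> and \<open>head G e\<close> are the source and range of \<open>e\<close>. The elements listed are the
  differences of the two sides of the defining relations.
\<close>

definition graph_relators :: "('v, 'e) pre_digraph \<Rightarrow> ('v, 'e) gen star_poly set" where
  "graph_relators G =
     {sp_star (sp_P v) - sp_P v | v. v \<in> verts G} \<union>
     {sp_P v * sp_P v - sp_P v | v. v \<in> verts G} \<union>
     {sp_P v * sp_P w | v w. v \<in> verts G \<and> w \<in> verts G \<and> v \<noteq> w} \<union>
     {sp_S e * sp_star (sp_S e) * sp_S e - sp_S e | e. e \<in> arcs G} \<union>
     {sp_star (sp_S e) * sp_S e - sp_P (head G e) | e. e \<in> arcs G} \<union>
     {sp_P v - (\<Sum>e\<in>out_arcs G v. sp_S e * sp_star (sp_S e)) | v. v \<in> verts G}"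

definition cstar_seminorm_on :: "'x star_poly set \<Rightarrow> ('x star_poly \<Rightarrow> real) \<Rightarrow> bool" where
  "cstar_seminorm_on F q \<longleftrightarrow>
     (\<forall>f\<in>F. 0 \<le> q f) \<and>
     (\<forall>f\<in>F. \<forall>g\<in>F. q (f + g) \<le> q f + q g) \<and>
     (\<forall>c. \<forall>f\<in>F. q (sp_scale c f) = cmod c * q f) \<and>
     (\<forall>f\<in>F. \<forall>g\<in>F. q (f * g) \<le> q f * q g) \<and>
     (\<forall>f\<in>F. q (sp_star f * f) = (q f)\<^sup>2)"

text \<open>
  \<open>C\<^sup>*\<close>-seminorms vanishing on the relators are the same as seminorms \<open>f \<mapsto> \<parallel>\<pi> f\<parallel>\<close>, where
  \<open>\<pi>\<close> evaluates the polynomials at generators in some \<open>C\<^sup>*\<close>-algebra satisfying the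
  relations. Hence the universal \<open>C\<^sup>*\<close>-algebra is the completion of the free *-algebra
  with respect to the largest such seminorm. The supremum is finite, because projections and
  partial isometries have norm at most 1.
\<close>

definition univ_seminorm :: "('v, 'e) pre_digraph \<Rightarrow> ('v, 'e) gen star_poly \<Rightarrow> real" where
  "univ_seminorm G f =
     (SUP q \<in> {q. cstar_seminorm_on (free_star_alg G) q \<and> (\<forall>r\<in>graph_relators G. q r = 0)}. q f)"

definition cauchy_seqs :: "('v, 'e) pre_digraph \<Rightarrow> (nat \<Rightarrow> ('v, 'e) gen star_poly) set" where
  "cauchy_seqs G = {x. (\<forall>n. x n \<in> free_star_alg G) \<and>
     (\<forall>\<epsilon>>0. \<exists>N. \<forall>m\<ge>N. \<forall>n\<ge>N. univ_seminorm G (x m - x n) < \<epsilon>)}"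

definition null_rel ::
  "('v, 'e) pre_digraph \<Rightarrow>
     ((nat \<Rightarrow> ('v, 'e) gen star_poly) \<times> (nat \<Rightarrow> ('v, 'e) gen star_poly)) set" where
  "null_rel G = {(x, y). x \<in> cauchy_seqs G \<and> y \<in> cauchy_seqs G \<and>
     (\<lambda>n. univ_seminorm G (x n - y n)) \<longlonglongrightarrow> 0}"

record 'a star_algebra = "(complex, 'a) module" +
  star :: "'a \<Rightarrow> 'a"
  cnorm :: "'a \<Rightarrow> real"

text \<open>
  The unit is the sum of all vertex projections; \<open>G\<close> is meant to be finite and without sinks.
\<close>

definition graph_cstar_algebra ::
  "('v, 'e) pre_digraph \<Rightarrow> (nat \<Rightarrow> ('v, 'e) gen star_poly) set star_algebra" where
  "graph_cstar_algebra G =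
     \<lparr> carrier = cauchy_seqs G // null_rel G,
       monoid.mult = (\<lambda>X Y. \<Union>x\<in>X. \<Union>y\<in>Y. null_rel G `` {\<lambda>n. x n * y n}),
       one = null_rel G `` {\<lambda>n. \<Sum>v\<in>verts G. sp_P v},
       zero = null_rel G `` {\<lambda>n. 0},
       add = (\<lambda>X Y. \<Union>x\<in>X. \<Union>y\<in>Y. null_rel G `` {\<lambda>n. x n + y n}),
       smult = (\<lambda>c X. \<Union>x\<in>X. null_rel G `` {\<lambda>n. sp_scale c (x n)}),
       star = (\<lambda>X. \<Union>x\<in>X. null_rel G `` {\<lambda>n. sp_star (x n)}),
       cnorm = (\<lambda>X. THE r. \<forall>x\<in>X. (\<lambda>n. univ_seminorm G (x n)) \<longlonglongrightarrow> r) \<rparr>"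

text \<open>A *-isomorphism between \<open>C\<^sup>*\<close>-algebras is automatically isometric.\<close>

definition star_isomorphic ::
  "('a, 'c) star_algebra_scheme \<Rightarrow> ('b, 'd) star_algebra_scheme \<Rightarrow> bool" where
  "star_isomorphic X Y \<longleftrightarrow>
     (\<exists>\<phi>\<in>ring_iso X Y.
        (\<forall>c. \<forall>x\<in>carrier X. \<phi> (c \<odot>\<^bsub>X\<^esub> x) = c \<odot>\<^bsub>Y\<^esub> \<phi> x) \<and>
        (\<forall>x\<in>carrier X. \<phi> (star X x) = star Y (\<phi> x)))"


section \<open>Cuntz-Krieger algebras\<close>

text \<open>The entries of a 0-1 matrix are edge multiplicities, so edges may be taken to be pairs.\<close>

definition mat_digraph :: "nat \<Rightarrow> int mat \<Rightarrow> (nat, nat \<times> nat) pre_digraph" where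
  "mat_digraph n B =
     \<lparr> verts = {..<n}, arcs = {(i, j). i < n \<and> j < n \<and> B $$ (i, j) = 1},
       tail = fst, head = snd \<rparr>"

definition cuntz_krieger_algebra ::
  "nat \<Rightarrow> int mat \<Rightarrow> (nat \<Rightarrow> (nat, nat \<times> nat) gen star_poly) set star_algebra" where
  "cuntz_krieger_algebra n B = graph_cstar_algebra (mat_digraph n B)"


section \<open>The two matrices\<close>

definition mat_A :: "int mat" where
  "mat_A = mat_of_rows_list 4
     [[1, 1, 1, 1],
      [1, 0, 1, 1],
      [1, 1, 0, 1],
      [1, 1, 1, 0]]"

definition mat_B :: "int mat" where
  "mat_B = mat_of_rows_list 4
     [[0, 1, 1, 1],
      [1, 0, 1, 1],
      [1, 1, 0, 1],
      [1, 1, 0, 0]]"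

end

(*
  Every matrix primitively equivalent to A is a simultaneous permutation of rows and columns of A:
  apart from trivial transfers, a transfer needs a sum of rows with entries at most 1, but each row
  of A has at least three ones.

  The algebras are isomorphic because each of them contains a Cuntz-Krieger family for the other
  matrix that is given by *-polynomials in the generators, and the two substitutions are mutually
  inverse modulo the relations. The polynomials come from a chain of moves on graphs (primitive
  transfers allowing multiple edges, out-splittings and their inverses) that leads from A to B.
  Substitution is then isometric for the universal seminorms and extends to the completions.
*)

theory Submission
  imports Defs
begin

section \<open>Primitive equivalence\<close>

text \<open>The relations fix only the sum of the range projections \<open>S e * st (S e)\<close> at
  a vertex; that \<open>st (S e) * S f = 0\<close> for distinct edges has to come from the
  C*-identity. For a seminorm on polynomials there is neither completeness nor an order at hand, so
  the usual positivity argument is replaced by extremality of the unit of a corner, which uses only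
  ring identities and norm estimates. Accordingly, identities are computed modulo the common kernel
  of all admissible seminorms and not modulo the ideal of the relators. There, products of
  generators have normal forms, and each identity between the explicit formulas becomes a finite
  rewriting. The formulas rest on one count. In A, cut \<open>P 1\<close> into a part equivalent to
  \<open>P 0\<close> and a rest Q equivalent to \<open>P 2 + P 3\<close>. Two copies of
  \<open>P 0\<close> amount to two copies of \<open>P 0 + P 1 + P 2 + P 3\<close>, which regroup as
  \<open>P 0 + P 1 + P 2\<close>, \<open>P 0 + P 1 + P 3\<close> and \<open>P 2 + P 3\<close>, that
  is, as \<open>P 3\<close>, \<open>P 2\<close> and Q. With \<open>P 3\<close>, \<open>P 2\<close>,
  the doubled \<open>P 0\<close> and Q as vertices 0, 1, 2, 3, this is the row 1, 1, 0, 1 of B at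
  vertex 2.\<close>

lemma less_4_cases: "(i::nat) < 4 \<longleftrightarrow> i = 0 \<or> i = 1 \<or> i = 2 \<or> i = 3"
  by auto

lemma lessThan_4: "{..<4::nat} = {0, 1, 2, 3}"
  by auto

section \<open>Elementary properties of the two matrices\<close>

lemma mat_A_carrier: "mat_A \<in> carrier_mat 4 4"
  and mat_B_carrier: "mat_B \<in> carrier_mat 4 4"
  by (intro carrier_matI; simp add: mat_A_def mat_B_def mat_of_rows_list_def)+

lemma mat_A_index:
  "i < 4 \<Longrightarrow> j < 4 \<Longrightarrow> mat_A $$ (i, j) = (if i = j \<and> i \<noteq> 0 then 0 else 1)"
  by (auto simp: mat_A_def mat_of_rows_list_def less_4_cases)

lemma mat_B_index:
  "i < 4 \<Longrightarrow> j < 4 \<Longrightarrow> mat_B $$ (i, j) = (if i = j \<or> i = 3 \<and> j = 2 then 0 else 1)"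
  by (auto simp: mat_B_def mat_of_rows_list_def less_4_cases)

lemma zero_one_mat_A: "zero_one_mat 4 mat_A"
  and zero_one_mat_B: "zero_one_mat 4 mat_B"
  by (auto simp: zero_one_mat_def mat_A_carrier mat_B_carrier mat_A_index mat_B_index)

lemma square_mat_index:
  assumes "A \<in> carrier_mat 4 4" "i < 4" "j < 4"
  shows "(A ^\<^sub>m 2) $$ (i, j) = (\<Sum>k<4. A $$ (i, k) * (A $$ (k, j) :: int))"
  using assms by (simp add: numeral_2_eq_2 scalar_prod_def lessThan_atLeast0)

text \<open>Exponent 2 works for all pairs of indices at once: in both graphs any two vertices are
  joined by a path of length 2.\<close>

lemma irreducible_mat_squareI:
  assumes "A \<in> carrier_mat 4 4" "\<And>i j. i < 4 \<Longrightarrow> j < 4 \<Longrightarrow> A $$ (i, j) \<ge> 0"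
    and "\<And>i j. i < 4 \<Longrightarrow> j < 4 \<Longrightarrow> (\<Sum>k<4. A $$ (i, k) * A $$ (k, j)) > 0"
  shows "irreducible_mat 4 A"
  unfolding irreducible_mat_def
  using assms square_mat_index[OF assms(1)] by (auto intro!: exI[of _ 2])

lemma irreducible_mat_A: "irreducible_mat 4 mat_A"
  by (rule irreducible_mat_squareI)
    (auto simp: mat_A_carrier mat_A_index lessThan_4 less_4_cases)

lemma irreducible_mat_B: "irreducible_mat 4 mat_B"
  by (rule irreducible_mat_squareI)
    (auto simp: mat_B_carrier mat_B_index lessThan_4 less_4_cases)

lemma not_permutation_mat_A: "\<not> permutation_mat 4 mat_A"
proof
  assume "permutation_mat 4 mat_A"
  then have "\<exists>!j. j < 4 \<and> mat_A $$ (0, j) = 1"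
    by (simp add: permutation_mat_def)
  then obtain j where "\<And>j'. j' < 4 \<Longrightarrow> mat_A $$ (0, j') = 1 \<Longrightarrow> j' = j"
    by blast
  from this[of 1] this[of 2] show False
    by (simp add: mat_A_index)
qed

lemma not_permutation_mat_B: "\<not> permutation_mat 4 mat_B"
proof
  assume "permutation_mat 4 mat_B"
  then have "\<exists>!j. j < 4 \<and> mat_B $$ (0, j) = 1"
    by (simp add: permutation_mat_def)
  then obtain j where "\<And>j'. j' < 4 \<Longrightarrow> mat_B $$ (0, j') = 1 \<Longrightarrow> j' = j"
    by blast
  from this[of 1] this[of 2] show False
    by (simp add: mat_B_index)
qed

text \<open>The simultaneous permutations of \<open>mat_A\<close>: off the diagonal every entry is
  1, so a permutation can only move the single nonzero diagonal entry, here at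
  \<open>k\<close>.\<close>

definition orbit_A :: "int mat set" where
  "orbit_A = {X \<in> carrier_mat 4 4. \<exists>k<4. \<forall>i<4. \<forall>j<4.
     X $$ (i, j) = (if i = j \<and> i \<noteq> k then 0 else 1)}"

lemma sum_row_orbit_A:
  assumes "m < 4" "k < 4" "\<forall>i<4. \<forall>j<4. X $$ (i, j) = (if i = j \<and> i \<noteq> k then 0 else (1::int))"
  shows "(\<Sum>j<4. X $$ (m, j)) = (if m = k then 4 else 3)"
proof -
  have "(\<Sum>j<4. X $$ (m, j)) = (\<Sum>j<4. if m = j \<and> m \<noteq> k then 0 else 1)"
    using assms by (intro sum.cong) auto
  also have "\<dots> = (if m = k then 4 else 3)"
    using assms(1) by (auto simp: lessThan_4 less_4_cases)
  finally show ?thesis .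
qed

text \<open>
  A transfer at \<open>p\<close> with \<open>M \<noteq> {}\<close> cannot start or end in the orbit, as a row with index in \<open>M\<close>
  has at least three ones.
\<close>

lemma transfer_from_orbit_A:
  assumes X: "X \<in> orbit_A" and t: "primitive_transfer_at 4 p X Y"
  shows "Y \<in> orbit_A"
proof -
  from t obtain K M where p: "p < 4" and K: "K \<subseteq> {..<4}" and M: "M \<subseteq> {..<4}" and d: "K \<inter> M = {}"
    and pM: "p \<notin> M"
    and e: "\<forall>j<4. row X p $ j = (\<Sum>k\<in>K. unit_vec 4 k $ j) + (\<Sum>m\<in>M. row X m $ j)"
    and Y: "Y = mat 4 4 (\<lambda>(i, j). if i = p then (if j \<in> K \<union> M then 1 else 0) else X $$ (i, j))"
    unfolding primitive_transfer_at_def by blast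
  from X obtain k where k: "k < 4" and c: "X \<in> carrier_mat 4 4"
    and x: "\<And>i j. i < 4 \<Longrightarrow> j < 4 \<Longrightarrow> X $$ (i, j) = (if i = j \<and> i \<noteq> k then 0 else 1)"
    unfolding orbit_A_def by blast
  have fin: "finite K" "finite M"
    using K M finite_subset by blast+
  have unit: "(\<Sum>k\<in>K. unit_vec 4 k $ j) = (if j \<in> K then 1 else (0::int))" if "j < 4" for j
    using that K fin by (simp add: unit_vec_def sum.If_cases if_distrib cong: if_cong)
  have rw: "X $$ (p, j) = (if j \<in> K then 1 else 0) + (\<Sum>m\<in>M. X $$ (m, j))" if "j < 4" for j
  proof -
    have "(\<Sum>m\<in>M. row X m $ j) = (\<Sum>m\<in>M. X $$ (m, j))"
      using M c that by (intro sum.cong) auto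
    then show ?thesis
      using e[rule_format, OF that] unit[OF that] c p that by simp
  qed
  have "M = {}"
  proof (rule ccontr)
    assume "M \<noteq> {}"
    then obtain m where m: "m \<in> M" by auto
    have m4: "m < 4" using m M by auto
    have ge: "(if j \<in> K then 1 else 0) + X $$ (m, j) \<le> X $$ (p, j)" if "j < 4" for j
    proof -
      have "X $$ (m, j) \<le> (\<Sum>m\<in>M. X $$ (m, j))"
        using m fin M that by (intro member_le_sum) (auto simp: x subset_iff)
      with rw[OF that] show ?thesis by simp
    qed
    have "m \<noteq> p" using m pM by auto
    \<comment> \<open>Column \<open>p\<close>: row \<open>m\<close> has a one there because
      \<open>m\<close> differs from \<open>p\<close>, so the diagonal entry of row \<open>p\<close>
      is 1. Hence \<open>p\<close> is the exceptional index \<open>k\<close>, and \<open>m\<close>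
      is not.\<close>
    have "m \<noteq> k"
      using ge[OF p] x[OF m4 p] x[OF p p] \<open>m \<noteq> p\<close> by (auto split: if_splits)
    then have pk: "p = k"
      using ge[OF p] x[OF m4 p] x[OF p p] \<open>m \<noteq> p\<close> by (auto split: if_splits)
    \<comment> \<open>Column \<open>m\<close>: row \<open>p\<close> has a one there, but it comes
      neither from a unit row with index in \<open>K\<close> nor from row \<open>m\<close>, whose
      diagonal entry is 0. A second row \<open>m'\<close> with index in \<open>M\<close> must supply
      it.\<close>
    have "m \<notin> K" using m d by auto
    then have "X $$ (p, m) = (\<Sum>m'\<in>M. X $$ (m', m))"
      using rw[OF m4] by simp
    then have "(\<Sum>m'\<in>M. X $$ (m', m)) = 1"
      using x[OF p m4] pk by simp
    moreover have "X $$ (m, m) = 0" using x[OF m4 m4] \<open>m \<noteq> k\<close> by simp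
    ultimately have "(\<Sum>m'\<in>M - {m}. X $$ (m', m)) = 1"
      using fin m by (simp add: sum.remove)
    then have "M - {m} \<noteq> {}" by (metis sum.empty zero_neq_one)
    then obtain m' where m': "m' \<in> M" "m' \<noteq> m" by auto
    then have m'4: "m' < 4" "m' \<noteq> p" using M pM by auto
    \<comment> \<open>In any column other than \<open>m\<close> and \<open>m'\<close> these two rows
      both have a one, so their sum exceeds the entry of row \<open>p\<close>.\<close>
    define l where "l = (SOME l. l < 4 \<and> l \<noteq> m \<and> l \<noteq> m')"
    have "\<exists>l. l < 4 \<and> l \<noteq> m \<and> l \<noteq> m'"
      by presburger
    then have l: "l < 4" "l \<noteq> m" "l \<noteq> m'"
      using someI_ex[of "\<lambda>l. l < 4 \<and> l \<noteq> m \<and> l \<noteq> m'"] unfolding l_def by auto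
    have "(\<Sum>i\<in>{m, m'}. X $$ (i, l)) \<le> (\<Sum>i\<in>M. X $$ (i, l))"
      using m m' fin M l by (intro sum_mono2) (auto simp: x subset_iff)
    moreover have "(\<Sum>i\<in>{m, m'}. X $$ (i, l)) = 2"
      using x[OF m4 l(1)] x[OF m'4(1) l(1)] l m' by simp
    moreover have "X $$ (p, l) \<le> 1" using x[OF p l(1)] by simp
    moreover have "(if l \<in> K then 1 else (0::int)) \<ge> 0" by simp
    ultimately show False using rw[OF l(1)] by linarith
  qed
  \<comment> \<open>With \<open>M\<close> empty the row equation says that \<open>K\<close> is the
    support of row \<open>p\<close>, so the transfer changes nothing.\<close>
  then have "X $$ (p, j) = (if j \<in> K then 1 else 0)" if "j < 4" for j
    using rw[OF that] by simp
  then have "Y = X"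
    using c \<open>M = {}\<close> by (intro eq_matI) (simp_all add: Y)
  then show ?thesis using X by simp
qed

lemma transfer_to_orbit_A:
  assumes X: "X \<in> orbit_A" and t: "primitive_transfer_at 4 p Y X"
  shows "Y \<in> orbit_A"
proof -
  from t obtain K M where z: "zero_one_mat 4 Y" and p: "p < 4" and K: "K \<subseteq> {..<4}" and M: "M \<subseteq> {..<4}"
    and d: "K \<inter> M = {}" and pM: "p \<notin> M"
    and e: "\<forall>j<4. row Y p $ j = (\<Sum>k\<in>K. unit_vec 4 k $ j) + (\<Sum>m\<in>M. row Y m $ j)"
    and Y: "X = mat 4 4 (\<lambda>(i, j). if i = p then (if j \<in> K \<union> M then 1 else 0) else Y $$ (i, j))"
    unfolding primitive_transfer_at_def by blast
  from X obtain k where k: "k < 4" and c: "X \<in> carrier_mat 4 4"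
    and x: "\<And>i j. i < 4 \<Longrightarrow> j < 4 \<Longrightarrow> X $$ (i, j) = (if i = j \<and> i \<noteq> k then 0 else 1)"
    unfolding orbit_A_def by blast
  have cY: "Y \<in> carrier_mat 4 4" and zY: "i < 4 \<Longrightarrow> j < 4 \<Longrightarrow> Y $$ (i, j) \<in> {0, 1}" for i j
    using z by (auto simp: zero_one_mat_def)
  have YX: "Y $$ (i, j) = X $$ (i, j)" if "i < 4" "j < 4" "i \<noteq> p" for i j
    using that by (simp add: Y)
  have fin: "finite K" "finite M"
    using K M finite_subset by blast+
  have unit: "(\<Sum>k\<in>K. unit_vec 4 k $ j) = (if j \<in> K then 1 else (0::int))" if "j < 4" for j
    using that K fin by (simp add: unit_vec_def sum.If_cases if_distrib cong: if_cong)
  \<comment> \<open>The row equation concerns \<open>Y\<close>, but it can be read with the rows of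
    \<open>X\<close>, which is the known matrix: the two differ only in row \<open>p\<close>, and
    \<open>p\<close> is not in \<open>M\<close>.\<close>
  have rw: "Y $$ (p, j) = (if j \<in> K then 1 else 0) + (\<Sum>m\<in>M. X $$ (m, j))" if "j < 4" for j
  proof -
    have "(\<Sum>m\<in>M. row Y m $ j) = (\<Sum>m\<in>M. X $$ (m, j))"
    proof (intro sum.cong refl)
      fix m assume "m \<in> M"
      then have "m < 4" "m \<noteq> p" using M pM by auto
      then show "row Y m $ j = X $$ (m, j)" using YX[of m j] cY that by simp
    qed
    then show ?thesis
      using e[rule_format, OF that] unit[OF that] cY p that by simp
  qed
  have "K \<union> M = {j. j < 4 \<and> X $$ (p, j) = 1}"
    using p K M by (auto simp: Y subset_iff split: if_splits)
  also have "\<dots> = {j. j < 4 \<and> (j = p \<longrightarrow> p = k)}"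
    by (rule Collect_cong) (use p in \<open>simp add: x conj_commute cong: conj_cong\<close>)
  finally have KM: "K \<union> M = {j. j < 4 \<and> (j = p \<longrightarrow> p = k)}" .
  \<comment> \<open>Counting ones: row \<open>p\<close> of \<open>Y\<close> has at most 4, and the
    row equation gives it at least \<open>card K + 3 * card M\<close>. Row \<open>p\<close> of
    \<open>X\<close> has support \<open>K \<union> M\<close>, so \<open>card K + card M\<close> is
    at least 3. A nonempty \<open>M\<close> would give at least 3 + 2 = 5 ones.\<close>
  have "M = {}"
  proof (rule ccontr)
    assume "M \<noteq> {}"
    have "3 \<le> (\<Sum>j<4. X $$ (m, j))" if "m \<in> M" for m
      using sum_row_orbit_A[of m k X] M that k by (auto simp: x subset_iff)
    then have "3 * int (card M) \<le> (\<Sum>m\<in>M. \<Sum>j<4. X $$ (m, j))"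
      using sum_mono[of M "\<lambda>_. 3" "\<lambda>m. \<Sum>j<4. X $$ (m, j)"] by simp
    also have "\<dots> = (\<Sum>j<4. \<Sum>m\<in>M. X $$ (m, j))"
      by (rule sum.swap)
    finally have 1: "3 * int (card M) \<le> (\<Sum>j<4. \<Sum>m\<in>M. X $$ (m, j))" .
    have "(\<Sum>j<4. if j \<in> K then 1 else (0::int)) = int (card K)"
      using K by (simp add: sum.If_cases Int_absorb1)
    then have "int (card K) + (\<Sum>j<4. \<Sum>m\<in>M. X $$ (m, j)) = (\<Sum>j<4. Y $$ (p, j))"
      by (simp add: rw sum.distrib)
    also have "\<dots> \<le> (\<Sum>j<(4::nat). 1)"
      using zY p by (intro sum_mono) force
    finally have 2: "int (card K) + 3 * int (card M) \<le> 4"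
      using 1 by simp
    have "card (K \<union> M) = card K + card M"
      using fin d by (rule card_Un_disjoint)
    moreover have "3 \<le> card (K \<union> M)"
    proof -
      have "{..<4} - {p} \<subseteq> K \<union> M" by (auto simp: KM)
      from card_mono[OF _ this] fin p show ?thesis by simp
    qed
    ultimately have "3 \<le> card K + card M" by simp
    moreover have "card M > 0" using fin \<open>M \<noteq> {}\<close> by (simp add: card_gt_0_iff)
    ultimately show False using 2 by linarith
  qed
  have "Y $$ (i, j) = X $$ (i, j)" if ij: "i < 4" "j < 4" for i j
  proof (cases "i = p")
    case True
    then show ?thesis using rw[OF ij(2)] ij \<open>M = {}\<close> by (simp add: Y)
  qed (simp add: YX ij)
  then have "Y = X"
    using cY c by (intro eq_matI) simp_all
  then show ?thesis using X by simp
qed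

text \<open>Multiplying by \<open>P\<close> on the right turns the conjugation into
  \<open>X * P = P * Y\<close>, so the entries of \<open>Q\<close> never have to be found. If row
  \<open>i\<close> of \<open>P\<close> has its one in column \<open>s i\<close>, comparing the
  entries at \<open>(i, s j)\<close> gives \<open>Y $$ (s i, s j) = X $$ (i, j)\<close>, and the
  exceptional index moves from \<open>k\<close> to \<open>s k\<close>.\<close>

lemma permutation_conjugate_orbit_A:
  assumes X: "X \<in> orbit_A" and Y: "Y \<in> carrier_mat 4 4" and t: "permutation_conjugate 4 X Y"
  shows "Y \<in> orbit_A"
proof -
  from t obtain P Q where P: "permutation_mat 4 P" and Q: "Q \<in> carrier_mat 4 4"
    and QP: "inverts_mat Q P" and XY: "X = P * Y * Q"
    unfolding permutation_conjugate_def by blast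
  from X obtain k where k: "k < 4" and c: "X \<in> carrier_mat 4 4"
    and x: "\<And>i j. i < 4 \<Longrightarrow> j < 4 \<Longrightarrow> X $$ (i, j) = (if i = j \<and> i \<noteq> k then 0 else 1)"
    unfolding orbit_A_def by blast
  have Pc: "P \<in> carrier_mat 4 4" and P01: "i < 4 \<Longrightarrow> j < 4 \<Longrightarrow> P $$ (i, j) \<in> {0, 1}" for i j
    using P by (auto simp: permutation_mat_def zero_one_mat_def)
  have "Q * P = 1\<^sub>m 4" using QP Q by (simp add: inverts_mat_def)
  then have XP: "X * P = P * Y"
    using assoc_mult_mat[of "P * Y" 4 4 Q 4 P 4] Pc Q Y by (simp add: XY)
  define s where "s i = (THE j. j < 4 \<and> P $$ (i, j) = 1)" for i
  have s: "s i < 4 \<and> P $$ (i, s i) = 1" if "i < 4" for i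
    unfolding s_def by (rule theI') (use P that in \<open>simp add: permutation_mat_def\<close>)
  have P1: "P $$ (i, j) = (if j = s i then 1 else 0)" if "i < 4" "j < 4" for i j
  proof -
    have "\<exists>!j. j < 4 \<and> P $$ (i, j) = 1" using P that unfolding permutation_mat_def by blast
    then obtain j' where "\<And>a. a < 4 \<Longrightarrow> P $$ (i, a) = 1 \<Longrightarrow> a = j'" by blast
    note u = this
    show ?thesis
    proof (cases "j = s i")
      case False
      then have "P $$ (i, j) \<noteq> 1" using u[of j] u[of "s i"] that s[OF that(1)] by blast
      then show ?thesis using False P01[OF that] by simp
    qed (use s[OF that(1)] in simp)
  qed
  have inj: "s i = s j \<longleftrightarrow> i = j" if "i < 4" "j < 4" for i j
  proof -
    have "\<exists>!i'. i' < 4 \<and> P $$ (i', s i) = 1"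
      using P s[OF that(1)] unfolding permutation_mat_def by blast
    then obtain i' where "\<And>a. a < 4 \<Longrightarrow> P $$ (a, s i) = 1 \<Longrightarrow> a = i'" by blast
    note u = this
    show ?thesis
    proof
      assume "s i = s j"
      then show "i = j" using u[of i] u[of j] that s[OF that(1)] s[OF that(2)] by simp
    qed simp
  qed
  have surj: "\<exists>i<4. s i = j" if j: "j < 4" for j
  proof -
    have "\<exists>!i. i < 4 \<and> P $$ (i, j) = 1" using P j unfolding permutation_mat_def by blast
    then obtain i where "i < 4" "P $$ (i, j) = 1" by blast
    then show ?thesis using P1[of i j] j by (auto split: if_splits)
  qed
  have YX: "Y $$ (s i, s j) = X $$ (i, j)" if ij: "i < 4" "j < 4" for i j
  proof -
    have "(X * P) $$ (i, s j) = (\<Sum>l<4. X $$ (i, l) * P $$ (l, s j))"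
      using ij c Pc s by (simp add: scalar_prod_def lessThan_atLeast0)
    also have "\<dots> = (\<Sum>l<4. if l = j then X $$ (i, l) else 0)"
      using ij s inj by (intro sum.cong) (auto simp: P1)
    also have "\<dots> = X $$ (i, j)" using ij by simp
    finally have 1: "(X * P) $$ (i, s j) = X $$ (i, j)" .
    have "(P * Y) $$ (i, s j) = (\<Sum>l<4. P $$ (i, l) * Y $$ (l, s j))"
      using ij Y Pc s by (simp add: scalar_prod_def lessThan_atLeast0)
    also have "\<dots> = (\<Sum>l<4. if l = s i then Y $$ (l, s j) else 0)"
      using ij by (intro sum.cong) (auto simp: P1)
    also have "\<dots> = Y $$ (s i, s j)" using ij s by simp
    finally show ?thesis using 1 XP by simp
  qed
  have "Y $$ (i, j) = (if i = j \<and> i \<noteq> s k then 0 else 1)" if ij: "i < 4" "j < 4" for i j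
  proof -
    obtain i' where i': "i' < 4" "i = s i'" using surj[OF ij(1)] by blast
    obtain j' where j': "j' < 4" "j = s j'" using surj[OF ij(2)] by blast
    show ?thesis using i' j' YX[of i' j'] x[of i' j'] inj[of i' j'] inj[of i' k] k by simp
  qed
  then show ?thesis using Y k s unfolding orbit_A_def by blast
qed

text \<open>The orbit is stable under all three kinds of steps. \<open>mat_B\<close> lies outside it
  because its diagonal vanishes, while each member of the orbit has a one at its exceptional
  diagonal position.\<close>

lemma not_primitively_equivalent_A_B: "\<not> primitively_equivalent 4 mat_A mat_B"
proof
  assume "primitively_equivalent 4 mat_A mat_B"
  then have "(primitive_step 4)\<^sup>*\<^sup>* mat_A mat_B" by (simp add: primitively_equivalent_def)
  then have "mat_B \<in> orbit_A"
  proof (induction rule: rtranclp_induct)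
    case base
    show ?case unfolding orbit_A_def by (auto simp: mat_A_carrier mat_A_index intro!: exI[of _ 0])
  next
    case (step X Y)
    then show ?case
      using transfer_from_orbit_A transfer_to_orbit_A permutation_conjugate_orbit_A
      unfolding primitive_step_def primitive_transfer_def zero_one_mat_def by blast
  qed
  then obtain k where "k < 4" "mat_B $$ (k, k) = 1"
    unfolding orbit_A_def by auto
  then show False by (simp add: mat_B_index)
qed

section \<open>The free *-algebra\<close>

lemma star_poly_eq_sum_single:
  "f = (\<Sum>w\<in>Poly_Mapping.keys f. Poly_Mapping.single w (Poly_Mapping.lookup f w))"
  by (rule poly_mapping_eqI) (auto simp: lookup_sum lookup_single when_def in_keys_iff)

lemma star_poly_induct [case_names zero single add]:
  fixes f :: "'x star_poly"
  assumes "P 0" "\<And>w c. P (Poly_Mapping.single w c)" "\<And>f g. P f \<Longrightarrow> P g \<Longrightarrow> P (f + g)"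
  shows "P f"
proof -
  have "P (\<Sum>w\<in>W. Poly_Mapping.single w (Poly_Mapping.lookup f w))" if "finite W" for W
    using that by (induction W) (auto intro: assms)
  then show ?thesis by (subst star_poly_eq_sum_single) simp
qed

lemma sp_scale_single [simp]:
  "sp_scale c (Poly_Mapping.single w a) = Poly_Mapping.single w (c * a)"
  by (simp add: sp_scale_def mult_single)

lemma sp_scale_zero [simp]: "sp_scale c 0 = 0"
  by (simp add: sp_scale_def)

lemma sp_scale_add_right: "sp_scale c (f + g) = sp_scale c f + sp_scale c g"
  by (simp add: sp_scale_def distrib_left)

lemma sp_scale_add_left: "sp_scale (c + d) f = sp_scale c f + sp_scale d f"
  by (simp add: sp_scale_def single_add distrib_right)

lemma sp_scale_scale [simp]: "sp_scale c (sp_scale d f) = sp_scale (c * d) f"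
  by (simp add: sp_scale_def mult_single flip: mult.assoc)

lemma sp_scale_one [simp]: "sp_scale 1 f = f"
  by (simp add: sp_scale_def)

lemma sp_scale_minus_one: "sp_scale (- 1) f = - f"
  by (simp add: sp_scale_def single_uminus)

lemma sp_scale_zero_left [simp]: "sp_scale 0 f = 0"
  by (simp add: sp_scale_def)

lemma sp_scale_diff_right: "sp_scale c (f - g) = sp_scale c f - sp_scale c g"
  by (simp add: sp_scale_def right_diff_distrib)

lemma sp_scale_mult_left: "sp_scale c f * g = sp_scale c (f * g)"
  by (simp add: sp_scale_def mult.assoc)

text \<open>The element \<open>Poly_Mapping.single 0 c\<close> is central, since \<open>0\<close> is
  the empty word and complex scalars commute.\<close>

lemma sp_scale_mult_right: "f * sp_scale c g = sp_scale c (f * g)"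
proof -
  have "f * Poly_Mapping.single 0 c = Poly_Mapping.single 0 c * f"
    by (induction f rule: star_poly_induct) (simp_all add: mult_single mult.commute distrib_left distrib_right)
  then show ?thesis by (simp add: sp_scale_def flip: mult.assoc)
qed

lemma adj_letter_adj_letter [simp]: "adj_letter (adj_letter l) = l"
  by (cases l) simp_all

lemma letter_gen_adj_letter [simp]: "letter_gen (adj_letter l) = letter_gen l"
  by (cases l) simp_all

lemma letters_add [simp]: "letters (u + v) = letters u @ letters v"
  by (simp add: plus_gen_word_def)

lemma letters_zero [simp]: "letters 0 = []"
  by (simp add: zero_gen_word_def)

lemma letters_eq_Nil_iff [simp]: "letters w = [] \<longleftrightarrow> w = 0"
  by (cases w) (simp add: zero_gen_word_def)

lemma star_word_zero [simp]: "star_word 0 = 0"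
  by (simp add: star_word_def zero_gen_word_def)

lemma star_word_add: "star_word (u + v) = star_word v + star_word u"
  by (simp add: star_word_def plus_gen_word_def)

lemma star_word_star_word [simp]: "star_word (star_word w) = w"
  by (simp add: star_word_def rev_map o_def)

lemma sp_star_zero [simp]: "sp_star 0 = 0"
  by (simp add: sp_star_def)

lemma sp_star_add: "sp_star (f + g) = sp_star f + sp_star g"
  unfolding sp_star_def
  by (rule setsum_keys_plus_distrib) (simp_all add: single_add)

lemma sp_star_single [simp]:
  "sp_star (Poly_Mapping.single w c) = Poly_Mapping.single (star_word w) (cnj c)"
  by (simp add: sp_star_def)

lemma sp_star_star [simp]: "sp_star (sp_star f) = f"
  by (induction f rule: star_poly_induct) (simp_all add: sp_star_add)

lemma sp_star_mult: "sp_star (f * g) = sp_star g * sp_star f"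
proof (induction f rule: star_poly_induct)
  case (single w c)
  show ?case
    by (induction g rule: star_poly_induct)
      (simp_all add: sp_star_add mult_single star_word_add mult.commute distrib_left distrib_right)
qed (simp_all add: sp_star_add distrib_left distrib_right)

lemma sp_star_scale: "sp_star (sp_scale c f) = sp_scale (cnj c) (sp_star f)"
  by (induction f rule: star_poly_induct) (simp_all add: sp_scale_add_right sp_star_add)

lemma sp_star_minus: "sp_star (- f) = - sp_star f"
  using sp_star_scale[of "- 1" f] by (simp add: sp_scale_minus_one)

lemma sp_star_diff: "sp_star (f - g) = sp_star f - sp_star g"
  using sp_star_add[of f "- g"] by (simp add: sp_star_minus)

section \<open>Substitution homomorphisms\<close>

fun eval_letter :: "('x \<Rightarrow> 'y star_poly) \<Rightarrow> 'x letter \<Rightarrow> 'y star_poly" where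
  "eval_letter \<sigma> (Plain x) = \<sigma> x"
| "eval_letter \<sigma> (Adj x) = sp_star (\<sigma> x)"

definition eval_word :: "('x \<Rightarrow> 'y star_poly) \<Rightarrow> 'x gen_word \<Rightarrow> 'y star_poly" where
  "eval_word \<sigma> w = prod_list (map (eval_letter \<sigma>) (letters w))"

text \<open>The universal property of the free *-algebra: the unital *-homomorphism that sends each
  generator \<open>x\<close> to \<open>\<sigma> x\<close>.\<close>

definition star_hom :: "('x \<Rightarrow> 'y star_poly) \<Rightarrow> 'x star_poly \<Rightarrow> 'y star_poly" where
  "star_hom \<sigma> f = (\<Sum>w\<in>Poly_Mapping.keys f. sp_scale (Poly_Mapping.lookup f w) (eval_word \<sigma> w))"

lemma eval_word_add: "eval_word \<sigma> (u + v) = eval_word \<sigma> u * eval_word \<sigma> v"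
  by (simp add: eval_word_def)

lemma eval_letter_adj: "eval_letter \<sigma> (adj_letter l) = sp_star (eval_letter \<sigma> l)"
  by (cases l) simp_all

lemma sp_star_one [simp]: "sp_star 1 = 1"
  by (simp flip: single_one)

lemma eval_word_star: "eval_word \<sigma> (star_word w) = sp_star (eval_word \<sigma> w)"
proof -
  have "prod_list (map (eval_letter \<sigma>) (rev (map adj_letter ls))) =
    sp_star (prod_list (map (eval_letter \<sigma>) ls))" for ls
    by (induction ls) (simp_all add: eval_letter_adj sp_star_mult)
  then show ?thesis by (simp add: eval_word_def star_word_def)
qed

lemma star_hom_zero [simp]: "star_hom \<sigma> 0 = 0"
  by (simp add: star_hom_def)

lemma star_hom_add: "star_hom \<sigma> (f + g) = star_hom \<sigma> f + star_hom \<sigma> g"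
  unfolding star_hom_def
  by (rule setsum_keys_plus_distrib) (simp_all add: sp_scale_add_left)

lemma star_hom_single: "star_hom \<sigma> (Poly_Mapping.single w c) = sp_scale c (eval_word \<sigma> w)"
  by (simp add: star_hom_def)

lemma star_hom_scale: "star_hom \<sigma> (sp_scale c f) = sp_scale c (star_hom \<sigma> f)"
  by (induction f rule: star_poly_induct)
    (simp_all add: star_hom_add star_hom_single sp_scale_add_right)

lemma star_hom_minus: "star_hom \<sigma> (- f) = - star_hom \<sigma> f"
  using star_hom_scale[of \<sigma> "- 1" f] by (simp add: sp_scale_minus_one)

lemma star_hom_diff: "star_hom \<sigma> (f - g) = star_hom \<sigma> f - star_hom \<sigma> g"
  using star_hom_add[of \<sigma> f "- g"] by (simp add: star_hom_minus)

lemma star_hom_sum: "star_hom \<sigma> (\<Sum>i\<in>I. f i) = (\<Sum>i\<in>I. star_hom \<sigma> (f i))"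
  by (induction I rule: infinite_finite_induct) (simp_all add: star_hom_add)

lemma star_hom_mult: "star_hom \<sigma> (f * g) = star_hom \<sigma> f * star_hom \<sigma> g"
proof (induction f rule: star_poly_induct)
  case (single w c)
  show ?case
    by (induction g rule: star_poly_induct)
      (simp_all add: star_hom_add star_hom_single mult_single eval_word_add
        sp_scale_mult_left sp_scale_mult_right mult.commute[of _ c] distrib_left)
qed (simp_all add: star_hom_add distrib_right)

lemma star_hom_star: "star_hom \<sigma> (sp_star f) = sp_star (star_hom \<sigma> f)"
  by (induction f rule: star_poly_induct)
    (simp_all add: star_hom_add star_hom_single sp_star_add eval_word_star sp_star_scale)

lemma star_hom_gen [simp]: "star_hom \<sigma> (sp_gen x) = \<sigma> x"
  by (simp add: sp_gen_def star_hom_single eval_word_def)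

section \<open>Polynomials without constant term\<close>

lemma zero_in_free_star_alg [simp]: "0 \<in> free_star_alg G"
  by (simp add: free_star_alg_def)

lemma free_star_alg_add: "f \<in> free_star_alg G \<Longrightarrow> g \<in> free_star_alg G \<Longrightarrow> f + g \<in> free_star_alg G"
  using keys_add[of f g] by (auto simp: free_star_alg_def)

lemma free_star_alg_scale: "f \<in> free_star_alg G \<Longrightarrow> sp_scale c f \<in> free_star_alg G"
  using keys_mult[of "Poly_Mapping.single 0 c" f]
  by (fastforce simp: free_star_alg_def sp_scale_def split: if_splits)

lemma free_star_alg_minus: "f \<in> free_star_alg G \<Longrightarrow> - f \<in> free_star_alg G"
  using free_star_alg_scale[of f G "- 1"] by (simp add: sp_scale_minus_one)

lemma free_star_alg_diff: "f \<in> free_star_alg G \<Longrightarrow> g \<in> free_star_alg G \<Longrightarrow> f - g \<in> free_star_alg G"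
  using free_star_alg_add[of f G "- g"] by (simp add: free_star_alg_minus)

lemma free_star_alg_mult:
  assumes "f \<in> free_star_alg G" "g \<in> free_star_alg G"
  shows "f * g \<in> free_star_alg G"
proof -
  have "w \<noteq> 0 \<and> letter_gen ` set (letters w) \<subseteq> graph_gens G" if w: "w \<in> Poly_Mapping.keys (f * g)" for w
  proof -
    obtain a b where ab: "w = a + b" "a \<in> Poly_Mapping.keys f" "b \<in> Poly_Mapping.keys g"
      using w keys_mult[of f g] by blast
    have "a \<noteq> 0" "letter_gen ` set (letters a) \<subseteq> graph_gens G" "letter_gen ` set (letters b) \<subseteq> graph_gens G"
      using assms ab by (auto simp: free_star_alg_def)
    moreover have "letters w = letters a @ letters b" using ab(1) by simp
    moreover have "w \<noteq> 0"
      using \<open>a \<noteq> 0\<close> \<open>letters w = letters a @ letters b\<close> by (metis append_is_Nil_conv letters_eq_Nil_iff)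
    ultimately show ?thesis by (simp only: set_append image_Un Un_subset_iff simp_thms)
  qed
  then show ?thesis unfolding free_star_alg_def by blast
qed

lemma free_star_alg_star:
  assumes "f \<in> free_star_alg G"
  shows "sp_star f \<in> free_star_alg G"
proof -
  have "w \<noteq> 0 \<and> letter_gen ` set (letters w) \<subseteq> graph_gens G"
    if "w \<in> Poly_Mapping.keys (sp_star f)" for w
  proof -
    have "w \<in> (\<Union>v\<in>Poly_Mapping.keys f.
        Poly_Mapping.keys (Poly_Mapping.single (star_word v) (cnj (Poly_Mapping.lookup f v))))"
      using that unfolding sp_star_def by (rule subsetD[OF keys_sum])
    then obtain v where v: "v \<in> Poly_Mapping.keys f" "w = star_word v"
      unfolding keys_single by (auto split: if_split_asm)
    have "v \<noteq> 0" "letter_gen ` set (letters v) \<subseteq> graph_gens G"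
      using assms v(1) by (auto simp: free_star_alg_def)
    moreover have "letter_gen ` set (letters w) = letter_gen ` set (letters v)"
      by (simp add: v(2) star_word_def image_image)
    moreover have "w \<noteq> 0"
    proof
      assume "w = 0"
      then have "star_word (star_word v) = 0" by (simp flip: v(2))
      with \<open>v \<noteq> 0\<close> show False by simp
    qed
    ultimately show ?thesis by (simp only: simp_thms)
  qed
  then show ?thesis unfolding free_star_alg_def by blast
qed

lemma sp_gen_in_free_star_alg: "x \<in> graph_gens G \<Longrightarrow> sp_gen x \<in> free_star_alg G"
  by (simp add: free_star_alg_def sp_gen_def zero_gen_word_def)

lemma sum_in_free_star_alg: "(\<And>i. i \<in> I \<Longrightarrow> f i \<in> free_star_alg G) \<Longrightarrow> sum f I \<in> free_star_alg G"
  by (induction I rule: infinite_finite_induct) (auto intro: free_star_alg_add)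

text \<open>Each such polynomial is a linear combination of nonempty words, and a nonempty word is a
  product of letters. The involution therefore enters only at the generators, and no case for the
  constant 1 arises.\<close>

lemma free_star_alg_induct [consumes 1, case_names zero gen star mult scale add]:
  assumes "f \<in> free_star_alg G"
    and zero: "P 0"
    and gen: "\<And>x. x \<in> graph_gens G \<Longrightarrow> P (sp_gen x)"
    and star: "\<And>x. x \<in> graph_gens G \<Longrightarrow> P (sp_gen x) \<Longrightarrow> P (sp_star (sp_gen x))"
    and mult: "\<And>f g. f \<in> free_star_alg G \<Longrightarrow> g \<in> free_star_alg G \<Longrightarrow> P f \<Longrightarrow> P g \<Longrightarrow> P (f * g)"
    and scale: "\<And>c f. f \<in> free_star_alg G \<Longrightarrow> P f \<Longrightarrow> P (sp_scale c f)"
    and add: "\<And>f g. f \<in> free_star_alg G \<Longrightarrow> g \<in> free_star_alg G \<Longrightarrow> P f \<Longrightarrow> P g \<Longrightarrow> P (f + g)"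
  shows "P f"
proof -
  let ?F = "free_star_alg G"
  have letter: "Poly_Mapping.single (Word [l]) 1 \<in> ?F \<and> P (Poly_Mapping.single (Word [l]) 1)"
    if l: "letter_gen l \<in> graph_gens G" for l
  proof (cases l)
    case (Plain x)
    then show ?thesis using gen[of x] sp_gen_in_free_star_alg[of x G] l by (simp add: sp_gen_def)
  next
    case (Adj x)
    then have "Poly_Mapping.single (Word [l]) 1 = sp_star (sp_gen x)"
      by (simp add: sp_gen_def star_word_def)
    then show ?thesis
      using Adj star[OF _ gen] free_star_alg_star[OF sp_gen_in_free_star_alg[of x G]] l by simp
  qed
  have word: "Poly_Mapping.single (Word ls) 1 \<in> ?F \<and> P (Poly_Mapping.single (Word ls) 1)"
    if "ls \<noteq> []" "letter_gen ` set ls \<subseteq> graph_gens G" for ls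
    using that
  proof (induction ls rule: list_nonempty_induct)
    case (single l)
    then show ?case using letter[of l] by simp
  next
    case (cons l ls)
    have "Poly_Mapping.single (Word (l # ls)) (1::complex) =
      Poly_Mapping.single (Word [l]) 1 * Poly_Mapping.single (Word ls) 1"
      by (simp add: mult_single plus_gen_word_def)
    then show ?case
      using letter[of l] cons free_star_alg_mult mult by auto
  qed
  have single: "Poly_Mapping.single w c \<in> ?F \<and> P (Poly_Mapping.single w c)"
    if w: "w \<in> Poly_Mapping.keys f" for w c
  proof -
    have *: "Poly_Mapping.single w 1 \<in> ?F \<and> P (Poly_Mapping.single w 1)"
    proof -
      have "w \<noteq> 0" "letter_gen ` set (letters w) \<subseteq> graph_gens G"
        using w assms(1) by (auto simp: free_star_alg_def)
      then show ?thesis using word[of "letters w"] by simp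
    qed
    then show ?thesis
      using scale[of "Poly_Mapping.single w 1" c] free_star_alg_scale[of "Poly_Mapping.single w 1" G c]
      by simp
  qed
  have "sum (\<lambda>w. Poly_Mapping.single w (Poly_Mapping.lookup f w)) W \<in> ?F \<and>
      P (sum (\<lambda>w. Poly_Mapping.single w (Poly_Mapping.lookup f w)) W)"
    if "W \<subseteq> Poly_Mapping.keys f" "finite W" for W
    using that(2,1)
  proof (induction W)
    case empty
    then show ?case by (simp add: zero)
  next
    case (insert w W)
    then show ?case
      using single[of w "Poly_Mapping.lookup f w"] by (simp add: add free_star_alg_add)
  qed
  from this[of "Poly_Mapping.keys f"] show ?thesis
    by (simp flip: star_poly_eq_sum_single)
qed

lemma star_hom_in_free_star_alg:
  assumes "f \<in> free_star_alg G" "\<And>x. x \<in> graph_gens G \<Longrightarrow> \<sigma> x \<in> free_star_alg H"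
  shows "star_hom \<sigma> f \<in> free_star_alg H"
  using assms(1)
  by (induction rule: free_star_alg_induct)
    (auto simp: star_hom_add star_hom_mult star_hom_star star_hom_scale intro: assms(2)
      free_star_alg_add free_star_alg_mult free_star_alg_star free_star_alg_scale)

section \<open>Projections and Cuntz-Krieger families in *-rings\<close>

locale star_ring =
  fixes st :: "'a::ring \<Rightarrow> 'a"
  assumes st_add: "st (x + y) = st x + st y"
    and st_mult: "st (x * y) = st y * st x"
    and st_st [simp]: "st (st x) = x"
begin

lemma st_zero [simp]: "st 0 = 0"
  using st_add[of 0 0] by simp

lemma st_minus: "st (- x) = - st x"
  using st_add[of x "- x"] by (simp add: eq_neg_iff_add_eq_0 add.commute)

lemma st_diff: "st (x - y) = st x - st y"
  using st_add[of x "- y"] by (simp add: st_minus)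

definition projection :: "'a \<Rightarrow> bool" where
  "projection p \<longleftrightarrow> st p = p \<and> p * p = p"

end

section \<open>C*-seminorms and sums of projections\<close>

lemma scaleR_numeral_sum:
  "2 *\<^sub>R x = x + x" "3 *\<^sub>R x = x + x + x" "4 *\<^sub>R x = x + x + x + x"
  for x :: "'a::real_vector"
proof -
  show 2: "2 *\<^sub>R x = x + x" by (rule scaleR_2)
  have "3 *\<^sub>R x = (2 + 1) *\<^sub>R x" by simp
  then show "3 *\<^sub>R x = x + x + x" by (simp only: scaleR_add_left 2 scaleR_one)
  have "4 *\<^sub>R x = (2 + 2) *\<^sub>R x" by simp
  then show "4 *\<^sub>R x = x + x + x + x" by (simp only: scaleR_add_left 2 add.assoc)
qed

text \<open>The intended model is a product over all graphs. Each seminorm sees one factor, and all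
  of them together separate points, so estimates are made in one seminorm at a time and
  \<open>separating\<close> turns them into identities.\<close>

locale cstar_seminormed = star_ring st for st :: "'a::real_algebra \<Rightarrow> 'a" +
  fixes N :: "('a \<Rightarrow> real) set"
  assumes seminorm_nonneg: "\<nu> \<in> N \<Longrightarrow> 0 \<le> \<nu> x"
    and seminorm_add: "\<nu> \<in> N \<Longrightarrow> \<nu> (x + y) \<le> \<nu> x + \<nu> y"
    and seminorm_scaleR: "\<nu> \<in> N \<Longrightarrow> \<nu> (c *\<^sub>R x) = \<bar>c\<bar> * \<nu> x"
    and seminorm_mult: "\<nu> \<in> N \<Longrightarrow> \<nu> (x * y) \<le> \<nu> x * \<nu> y"
    and seminorm_star_mult: "\<nu> \<in> N \<Longrightarrow> \<nu> (st x * x) = (\<nu> x)\<^sup>2"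
    and separating: "(\<And>\<nu>. \<nu> \<in> N \<Longrightarrow> \<nu> x = 0) \<Longrightarrow> x = 0"
begin

context
  fixes \<nu> assumes \<nu>: "\<nu> \<in> N"
begin

lemma seminorm_minus: "\<nu> (- x) = \<nu> x"
  using seminorm_scaleR[OF \<nu>, of "- 1" x] by simp

lemma seminorm_diff: "\<nu> (x - y) \<le> \<nu> x + \<nu> y"
  using seminorm_add[OF \<nu>, of x "- y"] by (simp add: seminorm_minus)

lemma seminorm_zero: "\<nu> 0 = 0"
  using seminorm_scaleR[OF \<nu>, of 0 0] by simp

lemma seminorm_sum_le:
  assumes "\<And>i. i \<in> I \<Longrightarrow> \<nu> (f i) \<le> 1"
  shows "\<nu> (sum f I) \<le> real (card I)"
  using assms
proof (induction I rule: infinite_finite_induct)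
  case (insert i I)
  then show ?case using seminorm_add[OF \<nu>, of "f i" "sum f I"] by force
qed (simp_all add: seminorm_zero)

lemma seminorm_star_le: "\<nu> x \<le> \<nu> (st x)"
proof (cases "\<nu> x = 0")
  case False
  have "\<nu> x * \<nu> x \<le> \<nu> (st x) * \<nu> x"
    using seminorm_star_mult[OF \<nu>, of x] seminorm_mult[OF \<nu>, of "st x" x] by (simp add: power2_eq_square)
  then show ?thesis using False seminorm_nonneg[OF \<nu>, of x] by simp
qed (simp add: seminorm_nonneg[OF \<nu>])

lemma seminorm_star: "\<nu> (st x) = \<nu> x"
  using seminorm_star_le[of x] seminorm_star_le[of "st x"] by simp

lemma seminorm_projection_le_1:
  assumes "projection p" shows "\<nu> p \<le> 1"
proof (cases "\<nu> p = 0")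
  case False
  have "\<nu> p * \<nu> p = \<nu> p"
    using seminorm_star_mult[OF \<nu>, of p] assms by (simp add: projection_def power2_eq_square)
  then show ?thesis using False by simp
qed simp

text \<open>Without a unit, \<open>z - p * z\<close> stands for (1 - p) z. For w =
  \<open>z - p * z\<close> one has \<open>st w * w = st z * w\<close>, and the C*-identity bounds
  the square of \<nu> w by the product of \<nu> z and \<nu> w.\<close>

lemma seminorm_projection_complement:
  assumes "projection p" shows "\<nu> (z - p * z) \<le> \<nu> z"
proof (cases "\<nu> (z - p * z) = 0")
  case False
  have "st (z - p * z) * (z - p * z) = st z * (z - p * z)"
    using assms by (simp add: projection_def st_diff st_mult algebra_simps) (simp flip: mult.assoc)
  then have "\<nu> (z - p * z) * \<nu> (z - p * z) \<le> \<nu> z * \<nu> (z - p * z)"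
    using seminorm_star_mult[OF \<nu>, of "z - p * z"] seminorm_mult[OF \<nu>, of "st z" "z - p * z"]
    by (simp add: power2_eq_square seminorm_star)
  then show ?thesis using False seminorm_nonneg[OF \<nu>, of "z - p * z"] by simp
qed (simp add: seminorm_nonneg[OF \<nu>])

text \<open>The compressions of 1 - r and of r to the corner of \<open>p\<close>, the former again
  written without a unit. These bounds are the replacement for positivity of the
  compressions.\<close>

lemma seminorm_compression:
  assumes p: "projection p" and r: "projection r"
  shows "\<nu> (p - p * r * p) \<le> 1" and "\<nu> (p * r * p) \<le> 1"
proof -
  have "p - p * r * p = p * (p - r * p)"
    using p by (simp add: projection_def algebra_simps)
  then have "\<nu> (p - p * r * p) \<le> \<nu> p * \<nu> (p - r * p)"
    using seminorm_mult[OF \<nu>] by simp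
  also have "\<dots> \<le> 1 * 1"
    using seminorm_projection_le_1[OF p] seminorm_projection_complement[OF r, of p]
      seminorm_nonneg[OF \<nu>] by (intro mult_mono) (auto intro: order_trans)
  finally show "\<nu> (p - p * r * p) \<le> 1" by simp
  have "\<nu> (p * r * p) \<le> \<nu> p * \<nu> r * \<nu> p"
    using seminorm_mult[OF \<nu>, of "p * r" p] seminorm_mult[OF \<nu>, of p r] seminorm_nonneg[OF \<nu>, of p]
    by (meson mult_right_mono order_trans)
  also have "\<dots> \<le> 1 * 1 * 1"
    using seminorm_projection_le_1[OF p] seminorm_projection_le_1[OF r] seminorm_nonneg[OF \<nu>]
    by (intro mult_mono) auto
  finally show "\<nu> (p * r * p) \<le> 1" by simp
qed

text \<open>
  The unit of a normed algebra is an extreme point of the unit ball: if \<open>1 + b\<close> and \<open>1 - b\<close>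
  are in the unit ball, then so are \<open>1 + h\<close> and \<open>1 - h\<close> for \<open>h = (3 b - b\<^sup>3) / 2\<close>, because
  \<open>1 + h = (1 + b)\<^sup>3 / 4 + 3 (1 + b)\<^sup>2 (1 - b) / 4\<close>. Since \<open>4 b = (1 + b)\<^sup>2 - (1 - b)\<^sup>2\<close>,
  the seminorm of \<open>b\<close> is at most \<open>1 / 2\<close>, so that it grows by the factor \<open>11 / 8\<close> when passing
  to \<open>h\<close>.
\<close>

lemma unit_extreme_half:
  assumes "p * p = p" "p * b = b" "b * p = b" "\<nu> (p + b) \<le> 1" "\<nu> (p - b) \<le> 1"
  shows "\<nu> b \<le> 1 / 2"
proof -
  have m: "\<nu> (x * y) \<le> 1" if "\<nu> x \<le> 1" "\<nu> y \<le> 1" for x y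
    using seminorm_mult[OF \<nu>, of x y] mult_mono[of "\<nu> x" 1 "\<nu> y" 1] that seminorm_nonneg[OF \<nu>]
    by simp
  have "4 *\<^sub>R b = (p + b) * (p + b) - (p - b) * (p - b)"
    using assms by (simp add: algebra_simps scaleR_numeral_sum)
  then have "4 * \<nu> b \<le> \<nu> ((p + b) * (p + b)) + \<nu> ((p - b) * (p - b))"
    using seminorm_diff seminorm_scaleR[OF \<nu>, of 4 b] by (metis abs_numeral)
  also have "\<dots> \<le> 1 + 1"
    using assms m by (intro add_mono) auto
  finally show ?thesis by simp
qed

lemma unit_extreme_aux:
  assumes "p * p = p" "p * b = b" "b * p = b" "\<nu> (p + b) \<le> 1" "\<nu> (p - b) \<le> 1"
  shows "\<nu> b \<le> (8 / 11) ^ n / 2"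
  using assms
proof (induction n arbitrary: b)
  case (0 b)
  then show ?case using unit_extreme_half by simp
next
  case (Suc n b)
  have m: "\<nu> (x * y * z) \<le> 1" if "\<nu> x \<le> 1" "\<nu> y \<le> 1" "\<nu> z \<le> 1" for x y z
  proof -
    have "\<nu> (x * y) \<le> 1"
      using seminorm_mult[OF \<nu>, of x y] mult_mono[of "\<nu> x" 1 "\<nu> y" 1] that seminorm_nonneg[OF \<nu>]
      by simp
    then show ?thesis
      using seminorm_mult[OF \<nu>, of "x * y" z] mult_mono[of "\<nu> (x * y)" 1 "\<nu> z" 1] that seminorm_nonneg[OF \<nu>]
      by simp
  qed
  define h where "h b = (3 / 2) *\<^sub>R b - (1 / 2) *\<^sub>R (b * b * b)" for b :: 'a
  have h: "\<nu> (p + h b) \<le> 1"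
    if b: "p * b = b" "b * p = b" "\<nu> (p + b) \<le> 1" "\<nu> (p - b) \<le> 1" for b
  proof -
    have "4 *\<^sub>R h b = 6 *\<^sub>R b - 2 *\<^sub>R (b * b * b)"
      by (simp add: h_def scaleR_right_diff_distrib)
    also have "6 *\<^sub>R b = 3 *\<^sub>R b + 3 *\<^sub>R b" by (simp flip: scaleR_add_left)
    finally have h4: "4 *\<^sub>R h b = 3 *\<^sub>R b + 3 *\<^sub>R b - 2 *\<^sub>R (b * b * b)" .
    have abs: "p * (p * x) = p * x" "p * (b * x) = b * x" "b * (p * x) = b * x" for x
      using Suc.prems(1) b by (simp_all flip: mult.assoc)
    have "4 *\<^sub>R (p + h b) =
        (p + b) * (p + b) * (p + b) + 3 *\<^sub>R ((p + b) * (p + b) * (p - b))"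
      unfolding scaleR_add_right[of 4] h4
      by (simp add: scaleR_numeral_sum mult.assoc distrib_left distrib_right left_diff_distrib
          right_diff_distrib abs b Suc.prems(1))
    then have "4 * \<nu> (p + h b) \<le>
        \<nu> ((p + b) * (p + b) * (p + b)) + 3 * \<nu> ((p + b) * (p + b) * (p - b))"
      using seminorm_scaleR[OF \<nu>, of 4] seminorm_scaleR[OF \<nu>, of 3] seminorm_add[OF \<nu>]
      by (metis abs_numeral)
    also have "\<dots> \<le> 1 + 3 * 1"
      using m b by (intro add_mono mult_left_mono) auto
    finally show ?thesis by simp
  qed
  have b2: "\<nu> b \<le> 1 / 2"
    using unit_extreme_half Suc.prems by blast
  \<comment> \<open>As \<open>h\<close> is odd, the bound already shown, applied to
    \<open>- b\<close>, is the missing bound for \<open>p - h b\<close>.\<close>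
  have "h (- b) = - h b" by (simp add: h_def)
  then have "\<nu> (p - h b) \<le> 1"
    using h[of "- b"] Suc.prems by simp
  moreover have "\<nu> (p + h b) \<le> 1" using h[of b] Suc.prems by simp
  moreover have "p * h b = h b"
    using Suc.prems by (simp add: h_def right_diff_distrib flip: mult.assoc)
  moreover have "h b * p = h b"
    using Suc.prems by (simp add: h_def left_diff_distrib mult.assoc)
  ultimately have "\<nu> (h b) \<le> (8 / 11) ^ n / 2"
    using Suc.IH[of "h b"] Suc.prems(1) by simp
  \<comment> \<open>The factor is 3/2 - 1/2 * (1/2) * (1/2) = 11/8: the cubic term costs at most an
    eighth of \<nu> b because \<nu> b is at most 1/2.\<close>
  moreover have "11 / 8 * \<nu> b \<le> \<nu> (h b)"
  proof -
    have n: "0 \<le> \<nu> b" by (rule seminorm_nonneg[OF \<nu>])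
    have "(3 / 2) *\<^sub>R b = h b + (1 / 2) *\<^sub>R (b * b * b)" by (simp add: h_def)
    then have "3 / 2 * \<nu> b \<le> \<nu> (h b) + 1 / 2 * \<nu> (b * b * b)"
      using seminorm_add[OF \<nu>, of "h b" "(1 / 2) *\<^sub>R (b * b * b)"]
        seminorm_scaleR[OF \<nu>, of "3 / 2" b] seminorm_scaleR[OF \<nu>, of "1 / 2" "b * b * b"] by simp
    moreover have "\<nu> (b * b * b) \<le> \<nu> b * \<nu> b * \<nu> b"
      using seminorm_mult[OF \<nu>, of "b * b" b] seminorm_mult[OF \<nu>, of b b] n
      by (meson mult_right_mono order_trans)
    moreover have "\<nu> b * \<nu> b * \<nu> b \<le> 1 / 2 * (1 / 2) * \<nu> b"
      using b2 n by (intro mult_mono) auto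
    ultimately show ?thesis by simp
  qed
  ultimately show ?case by simp
qed

text \<open>The rescaled form in which extremality is applied: \<open>c\<close> will be the number
  of summands in a sum of compressions, each of seminorm at most 1.\<close>

lemma unit_extreme:
  assumes "p * p = p" "p * d = d" "d * p = d"
    and "\<nu> (real c *\<^sub>R p + d) \<le> c" "\<nu> (real c *\<^sub>R p - d) \<le> c"
  shows "\<nu> d = 0"
proof (cases "c = 0")
  case True
  then show ?thesis using assms seminorm_nonneg[OF \<nu>, of d] by simp
next
  case False
  define b where "b = (1 / real c) *\<^sub>R d"
  have "p + b = (1 / real c) *\<^sub>R (real c *\<^sub>R p + d)" "p - b = (1 / real c) *\<^sub>R (real c *\<^sub>R p - d)"
    using False by (simp_all add: b_def algebra_simps)
  then have "\<nu> (p + b) \<le> 1" "\<nu> (p - b) \<le> 1"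
    using assms False by (simp_all add: seminorm_scaleR[OF \<nu>])
  moreover have "p * b = b" "b * p = b" using assms by (simp_all add: b_def)
  ultimately have *: "\<nu> b \<le> (8 / 11) ^ n / 2" for n
    using assms(1) by (intro unit_extreme_aux)
  have "(\<lambda>n. (8 / 11) ^ n / 2 :: real) \<longlonglongrightarrow> 0 / 2"
    by (intro tendsto_divide LIMSEQ_power_zero) auto
  then have "\<nu> b \<le> 0"
    using * by (intro LIMSEQ_le_const[of "\<lambda>n. (8 / 11) ^ n / 2"]) auto
  then have "\<nu> b = 0" using seminorm_nonneg[OF \<nu>, of b] by simp
  then show ?thesis using False by (simp add: b_def seminorm_scaleR[OF \<nu>])
qed

end

lemma star_mult_eq_zero_imp:
  assumes "st x * x = 0" shows "x = 0"
proof (rule separating)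
  fix \<nu> assume \<nu>: "\<nu> \<in> N"
  show "\<nu> x = 0"
    using seminorm_star_mult[OF \<nu>, of x] seminorm_zero[OF \<nu>] assms by simp
qed

text \<open>In a C*-algebra this is the statement that a positive summand lies below the sum. Here
  let \<open>p = r j\<close>, let s be the sum, and let \<open>c\<close> be the number of other
  summands. Then d = \<open>p - p * s * p\<close> satisfies \<open>c p + d\<close> = the sum of the
  \<open>p - p * r i * p\<close> over the other \<open>i\<close>, and
  \<open>c p - d = (c - 1) p + p * s * p\<close>. Both have seminorm at most \<open>c\<close>, so
  extremality of \<open>p\<close> in its corner forces d = 0.\<close>

lemma projection_sum_absorbs:
  assumes I: "finite I" "\<And>i. i \<in> I \<Longrightarrow> projection (r i)" and P: "projection (sum r I)" and j: "j \<in> I"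
  shows "sum r I * r j = r j"
proof -
  define p where "p = r j"
  define s where "s = sum r I"
  define d where "d = p - p * s * p"
  have p: "projection p" using I j by (simp add: p_def)
  then have pp: "p * p = p" "st p = p" by (simp_all add: projection_def)
  have s: "projection s" "s * s = s" "st s = s" using P by (simp_all add: s_def projection_def)
  define c where "c = card (I - {j})"
  have "p * s * p = (\<Sum>i\<in>I. p * r i * p)"
    by (simp add: s_def sum_distrib_left sum_distrib_right)
  also have "\<dots> = p + (\<Sum>i\<in>I - {j}. p * r i * p)"
    using sum.remove[OF I(1) j, of "\<lambda>i. p * r i * p"] pp unfolding p_def[symmetric] by simp
  finally have *: "(\<Sum>i\<in>I - {j}. p - p * r i * p) = real c *\<^sub>R p + d"
    by (simp add: d_def c_def sum_subtractf sum_constant_scaleR)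
  have "d = 0"
  proof (rule separating)
    fix \<nu> assume \<nu>: "\<nu> \<in> N"
    have "\<nu> (\<Sum>i\<in>I - {j}. p - p * r i * p) \<le> c"
      unfolding c_def
      by (rule seminorm_sum_le[OF \<nu>]) (use seminorm_compression(1)[OF \<nu> p] I in simp)
    then have 1: "\<nu> (real c *\<^sub>R p + d) \<le> c" by (simp only: *)
    show "\<nu> d = 0"
    \<comment> \<open>For \<open>c = 0\<close> the coefficient \<open>c - 1\<close> is negative and
      the second bound below would fail; but then the first bound already says that \<nu> d is at
      most 0.\<close>
    proof (cases "c = 0")
      case True
      then show ?thesis using 1 seminorm_nonneg[OF \<nu>, of d] by simp
    next
      case False
      have "real c *\<^sub>R p - d = (real c - 1) *\<^sub>R p + p * s * p"
        by (simp add: d_def algebra_simps)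
      then have "\<nu> (real c *\<^sub>R p - d) \<le> \<bar>real c - 1\<bar> * \<nu> p + \<nu> (p * s * p)"
        using seminorm_add[OF \<nu>] seminorm_scaleR[OF \<nu>] by metis
      also have "\<dots> \<le> (real c - 1) * 1 + 1"
        using False seminorm_projection_le_1[OF \<nu> p] seminorm_compression(2)[OF \<nu> p s(1)]
        by (intro add_mono mult_mono) (auto simp: seminorm_nonneg[OF \<nu>])
      finally have "\<nu> (real c *\<^sub>R p - d) \<le> c" by simp
      moreover have "p * d = d" "d * p = d"
      proof -
        have "p * (p * x) = p * x" for x by (simp add: pp flip: mult.assoc)
        then show "p * d = d" "d * p = d"
          by (simp_all add: d_def pp left_diff_distrib right_diff_distrib mult.assoc)
      qed
      ultimately show ?thesis using unit_extreme[OF \<nu> pp(1)] 1 by blast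
    qed
  qed
  then have "p * s * p = p" by (simp add: d_def)
  \<comment> \<open>Since \<open>p\<close> and \<open>s\<close> are projections, this product equals
    \<open>p - p * s * p\<close>.\<close>
  then have "st (p - s * p) * (p - s * p) = 0"
    using pp s by (simp add: st_diff st_mult algebra_simps) (simp flip: mult.assoc)
  from star_mult_eq_zero_imp[OF this] show ?thesis by (simp add: p_def s_def)
qed

text \<open>Absorption gives \<open>p = p * s * p\<close> for \<open>p = r j\<close> and s the sum,
  so the compressions of the other projections to the corner of \<open>p\<close> add up to 0.
  Positivity would make each of them vanish; instead, with e = \<open>p * r i * p\<close> and
  \<open>c\<close> remaining summands, \<open>c p + e\<close> is a sum of \<open>c\<close> terms
  \<open>p - p * r l * p\<close> and \<open>c p - e = (c - 1) p + (p - e)\<close>, so extremality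
  gives e = 0. Finally e is \<open>st (r i * p) * (r i * p)\<close>.\<close>

lemma projection_sum_orthogonal:
  assumes I: "finite I" "\<And>i. i \<in> I \<Longrightarrow> projection (r i)" and P: "projection (sum r I)"
    and ij: "i \<in> I" "j \<in> I" "i \<noteq> j"
  shows "r i * r j = 0"
proof -
  define p where "p = r j"
  define e where "e = p * r i * p"
  have p: "projection p" using I ij by (simp add: p_def)
  then have pp: "p * p = p" "st p = p" by (simp_all add: projection_def)
  have ri: "projection (r i)" using I ij by simp
  define c where "c = card (I - {j} - {i})"
  have "p = p * (sum r I * p)"
    using projection_sum_absorbs[OF I P ij(2)] pp by (simp add: p_def)
  also have "\<dots> = (\<Sum>l\<in>I. p * r l * p)"
    by (simp add: sum_distrib_left sum_distrib_right mult.assoc)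
  also have "\<dots> = p + (e + (\<Sum>l\<in>I - {j} - {i}. p * r l * p))"
    using I ij pp by (subst sum.remove[of I j]) (simp_all add: p_def e_def sum.remove[of "I - {j}" i])
  finally have "e = - (\<Sum>l\<in>I - {j} - {i}. p * r l * p)"
    by (simp add: eq_neg_iff_add_eq_0)
  then have *: "(\<Sum>l\<in>I - {j} - {i}. p - p * r l * p) = real c *\<^sub>R p + e"
    by (simp add: c_def sum_subtractf sum_constant_scaleR)
  have "e = 0"
  proof (rule separating)
    fix \<nu> assume \<nu>: "\<nu> \<in> N"
    have "\<nu> (\<Sum>l\<in>I - {j} - {i}. p - p * r l * p) \<le> c"
      unfolding c_def
      by (rule seminorm_sum_le[OF \<nu>]) (use seminorm_compression(1)[OF \<nu> p] I in simp)
    then have 1: "\<nu> (real c *\<^sub>R p + e) \<le> c" by (simp only: *)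
    show "\<nu> e = 0"
    proof (cases "c = 0")
      case True
      then show ?thesis using 1 seminorm_nonneg[OF \<nu>, of e] by simp
    next
      case False
      have "real c *\<^sub>R p - e = (real c - 1) *\<^sub>R p + (p - e)"
        by (simp add: algebra_simps)
      then have "\<nu> (real c *\<^sub>R p - e) \<le> \<bar>real c - 1\<bar> * \<nu> p + \<nu> (p - e)"
        using seminorm_add[OF \<nu>] seminorm_scaleR[OF \<nu>] by metis
      also have "\<dots> \<le> (real c - 1) * 1 + 1"
        using False seminorm_projection_le_1[OF \<nu> p] seminorm_compression(1)[OF \<nu> p ri]
        by (intro add_mono mult_mono) (auto simp: seminorm_nonneg[OF \<nu>] e_def)
      finally have "\<nu> (real c *\<^sub>R p - e) \<le> c" by simp
      moreover have "p * e = e" "e * p = e"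
        using pp by (simp_all add: e_def mult.assoc) (simp flip: mult.assoc)
      ultimately show ?thesis using unit_extreme[OF \<nu> pp(1)] 1 by blast
    qed
  qed
  moreover have "st (r i * p) * (r i * p) = p * (r i * r i) * p"
  proof -
    have "st (r i) = r i" using ri by (simp add: projection_def)
    then show ?thesis by (simp only: st_mult pp mult.assoc)
  qed
  ultimately have "st (r i * p) * (r i * p) = 0"
    using ri by (simp add: projection_def e_def)
  from star_mult_eq_zero_imp[OF this] show ?thesis by (simp add: p_def)
qed

end

section \<open>Cuntz-Krieger families and their multiplication rules\<close>

definition (in star_ring) ck_family ::
  "('v, 'e) pre_digraph \<Rightarrow> ('v \<Rightarrow> 'a) \<Rightarrow> ('e \<Rightarrow> 'a) \<Rightarrow> bool" where
  "ck_family G P S \<longleftrightarrow>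
     (\<forall>v\<in>verts G. st (P v) = P v) \<and>
     (\<forall>v\<in>verts G. P v * P v = P v) \<and>
     (\<forall>v\<in>verts G. \<forall>w\<in>verts G. v \<noteq> w \<longrightarrow> P v * P w = 0) \<and>
     (\<forall>e\<in>arcs G. S e * st (S e) * S e = S e) \<and>
     (\<forall>e\<in>arcs G. st (S e) * S e = P (head G e)) \<and>
     (\<forall>v\<in>verts G. P v = (\<Sum>e\<in>out_arcs G v. S e * st (S e)))"

text \<open>
  The defining relations only fix the sum of the range projections at a vertex. That they are
  pairwise orthogonal is a consequence of the C*-identity, not of the relations alone.
\<close>

locale strong_ck_family = star_ring st for st :: "'a::ring \<Rightarrow> 'a" +
  fixes G :: "('v, 'e) pre_digraph" and P :: "'v \<Rightarrow> 'a" and S :: "'e \<Rightarrow> 'a"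
  assumes st_P [simp]: "v \<in> verts G \<Longrightarrow> st (P v) = P v"
    and P_P [simp]: "v \<in> verts G \<Longrightarrow> w \<in> verts G \<Longrightarrow> P v * P w = (if v = w then P v else 0)"
    and st_S_S [simp]: "e \<in> arcs G \<Longrightarrow> f \<in> arcs G \<Longrightarrow>
      st (S e) * S f = (if e = f then P (head G e) else 0)"
    and P_S [simp]: "v \<in> verts G \<Longrightarrow> e \<in> arcs G \<Longrightarrow> P v * S e = (if v = tail G e then S e else 0)"
    and S_P [simp]: "v \<in> verts G \<Longrightarrow> e \<in> arcs G \<Longrightarrow> S e * P v = (if v = head G e then S e else 0)"
    and wf: "e \<in> arcs G \<Longrightarrow> tail G e \<in> verts G" "e \<in> arcs G \<Longrightarrow> head G e \<in> verts G"
    and P_eq_sum: "v \<in> verts G \<Longrightarrow> P v = (\<Sum>e\<in>out_arcs G v. S e * st (S e))"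
begin

lemma P_st_S [simp]:
  "v \<in> verts G \<Longrightarrow> e \<in> arcs G \<Longrightarrow> P v * st (S e) = (if v = head G e then st (S e) else 0)"
  using st_mult[of "S e" "P v"] by auto

lemma st_S_P [simp]:
  "v \<in> verts G \<Longrightarrow> e \<in> arcs G \<Longrightarrow> st (S e) * P v = (if v = tail G e then st (S e) else 0)"
  using st_mult[of "P v" "S e"] by auto

text \<open>Companions of the product rules for right-associated words, so that two adjacent
  generators also cancel in the middle of a longer product.\<close>

lemma mult_assoc_simps [simp]:
  "v \<in> verts G \<Longrightarrow> w \<in> verts G \<Longrightarrow> P v * (P w * x) = (if v = w then P v * x else 0)"
  "e \<in> arcs G \<Longrightarrow> f \<in> arcs G \<Longrightarrow> st (S e) * (S f * x) = (if e = f then P (head G e) * x else 0)"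
  "v \<in> verts G \<Longrightarrow> e \<in> arcs G \<Longrightarrow> P v * (S e * x) = (if v = tail G e then S e * x else 0)"
  "v \<in> verts G \<Longrightarrow> e \<in> arcs G \<Longrightarrow> S e * (P v * x) = (if v = head G e then S e * x else 0)"
  "v \<in> verts G \<Longrightarrow> e \<in> arcs G \<Longrightarrow> P v * (st (S e) * x) = (if v = head G e then st (S e) * x else 0)"
  "v \<in> verts G \<Longrightarrow> e \<in> arcs G \<Longrightarrow> st (S e) * (P v * x) = (if v = tail G e then st (S e) * x else 0)"
  by (simp_all flip: mult.assoc)

lemma S_S:
  assumes "e \<in> arcs G" "f \<in> arcs G" "head G e \<noteq> tail G f"
  shows "S e * S f = 0"
proof -
  have "S e * P (head G e) = S e" "P (head G e) * S f = 0" using assms wf by simp_all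
  then show ?thesis by (metis mult.assoc mult_zero_right)
qed

lemma S_st_S:
  assumes "e \<in> arcs G" "f \<in> arcs G" "head G e \<noteq> head G f"
  shows "S e * st (S f) = 0"
proof -
  have "S e * P (head G e) = S e" "P (head G e) * st (S f) = 0" using assms wf by simp_all
  then show ?thesis by (metis mult.assoc mult_zero_right)
qed

text \<open>Words that do not follow a path vanish: the vertex projection that can be inserted
  between the two factors belongs to different vertices on its two sides. For concrete edges the
  side conditions are decided by evaluation.\<close>

lemma mult_zero_simps:
  assumes "e \<in> arcs G" "f \<in> arcs G"
  shows "head G e \<noteq> tail G f \<Longrightarrow> S e * S f = 0"
    and "head G e \<noteq> tail G f \<Longrightarrow> S e * (S f * x) = 0"
    and "head G f \<noteq> tail G e \<Longrightarrow> st (S e) * st (S f) = 0"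
    and "head G f \<noteq> tail G e \<Longrightarrow> st (S e) * (st (S f) * x) = 0"
    and "head G e \<noteq> head G f \<Longrightarrow> S e * st (S f) = 0"
    and "head G e \<noteq> head G f \<Longrightarrow> S e * (st (S f) * x) = 0"
  using assms st_mult[of "S f" "S e"]
  by (simp_all add: S_S S_st_S flip: mult.assoc)

end

text \<open>By \<open>S e * st (S e) * S e = S e\<close> the elements \<open>S e * st (S e)\<close>
  are projections, and their sum over the edges leaving \<open>v\<close> is the projection
  \<open>P v\<close>. Absorption then gives \<open>P (tail G e) * S e = S e\<close>, and
  orthogonality of the summands gives \<open>st (S e) * S f = 0\<close> for distinct edges with the
  same tail. Edges with different tails are separated by the vertex projections.\<close>

lemma (in cstar_seminormed) strong_ck_familyI:
  assumes ck: "ck_family G P S" and fin: "finite (arcs G)"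
    and wf: "\<And>e. e \<in> arcs G \<Longrightarrow> tail G e \<in> verts G" "\<And>e. e \<in> arcs G \<Longrightarrow> head G e \<in> verts G"
  shows "strong_ck_family st G P S"
proof -
  have PP: "P v * P w = (if v = w then P v else 0)" if "v \<in> verts G" "w \<in> verts G" for v w
    using ck that by (auto simp: ck_family_def)
  have stP: "st (P v) = P v" if "v \<in> verts G" for v
    using ck that by (auto simp: ck_family_def)
  have SSS: "S e * st (S e) * S e = S e" and SS: "st (S e) * S e = P (head G e)" if "e \<in> arcs G" for e
    using ck that by (auto simp: ck_family_def)
  have sum: "P v = (\<Sum>e\<in>out_arcs G v. S e * st (S e))" if "v \<in> verts G" for v
    using ck that by (auto simp: ck_family_def)
  have SSS': "S e * (st (S e) * (S e * x)) = S e * x" if "e \<in> arcs G" for e x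
    using SSS[OF that] by (metis mult.assoc)
  have proj: "projection (S e * st (S e))" if "e \<in> arcs G" for e
    using that by (simp add: projection_def st_mult mult.assoc SSS')
  have projP: "projection (P v)" if "v \<in> verts G" for v
    using that PP stP by (simp add: projection_def)
  have fin': "finite (out_arcs G v)" for v
    using fin by (simp add: out_arcs_def)
  have PSt: "P (tail G e) * S e = S e" if e: "e \<in> arcs G" for e
  proof -
    have "sum (\<lambda>e. S e * st (S e)) (out_arcs G (tail G e)) * (S e * st (S e)) = S e * st (S e)"
      using e by (intro projection_sum_absorbs fin' proj)
        (auto simp: projP wf simp flip: sum)
    then have "P (tail G e) * (S e * st (S e)) * S e = S e * st (S e) * S e"
      using sum wf e by simp
    then show ?thesis using SSS[OF e] by (simp add: mult.assoc)
  qed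
  have PS: "P v * S e = (if v = tail G e then S e else 0)" if "v \<in> verts G" "e \<in> arcs G" for v e
  proof -
    have "P v * S e = P v * P (tail G e) * S e" using PSt that by (simp add: mult.assoc)
    then show ?thesis using PP wf that PSt by auto
  qed
  have SP: "S e * P v = (if v = head G e then S e else 0)" if "v \<in> verts G" "e \<in> arcs G" for v e
  proof -
    have *: "S e * P (head G e) = S e" using SS SSS that by (simp flip: SS add: mult.assoc[symmetric])
    then have "S e * P v = S e * (P (head G e) * P v)" by (simp flip: mult.assoc)
    then show ?thesis using PP wf that * by auto
  qed
  have "st (S e) * S f = 0" if ef: "e \<in> arcs G" "f \<in> arcs G" "e \<noteq> f" for e f
  proof (cases "tail G e = tail G f")
    case True
    have "(S e * st (S e)) * (S f * st (S f)) = 0"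
      using ef True by (intro projection_sum_orthogonal[of "out_arcs G (tail G e)" "\<lambda>e. S e * st (S e)"] fin' proj)
        (auto simp: projP wf simp flip: sum)
    \<comment> \<open>Multiplying the orthogonality of the range projections by
      \<open>st (S e)\<close> on the left and \<open>S f\<close> on the right collapses both partial
      isometries and leaves \<open>st (S e) * S f\<close>.\<close>
    then have "st (S e) * ((S e * st (S e)) * (S f * st (S f))) * S f = 0" by simp
    moreover have "st (S e) * ((S e * st (S e)) * (S f * st (S f))) * S f = st (S e) * S e * st (S e) * (S f * st (S f) * S f)"
      by (simp add: mult.assoc)
    moreover have "st (S e) * S e * st (S e) = st (S e)"
      using arg_cong[OF SSS[OF ef(1)], of st] by (simp add: st_mult mult.assoc)
    ultimately show ?thesis using SSS[OF ef(2)] by simp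
  next
    case False
    have "st (S e) * S f = st (P (tail G e) * S e) * (P (tail G f) * S f)"
      using PSt ef by simp
    also have "\<dots> = st (S e) * (P (tail G e) * P (tail G f)) * S f"
      using ef wf stP by (simp add: st_mult mult.assoc)
    finally show ?thesis using PP[of "tail G e" "tail G f"] False ef wf by simp
  qed
  then show ?thesis
    using stP PP SS PS SP sum wf by unfold_locales auto
qed

section \<open>The isomorphism\<close>

lemma mat_digraph_simps [simp]:
  "tail (mat_digraph n B) = fst" "head (mat_digraph n B) = snd" "verts (mat_digraph n B) = {..<n}"
  by (simp_all add: mat_digraph_def)

lemma arcs_mat_A: "arcs (mat_digraph 4 mat_A) =
  {(0, 0), (0, 1), (0, 2), (0, 3), (1, 0), (1, 2), (1, 3), (2, 0), (2, 1), (2, 3), (3, 0), (3, 1), (3, 2)}"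
  by (auto simp: mat_digraph_def mat_A_def mat_of_rows_list_def numeral_eq_Suc less_Suc_eq)

lemma arcs_mat_B: "arcs (mat_digraph 4 mat_B) =
  {(0, 1), (0, 2), (0, 3), (1, 0), (1, 2), (1, 3), (2, 0), (2, 1), (2, 3), (3, 0), (3, 1)}"
  by (auto simp: mat_digraph_def mat_B_def mat_of_rows_list_def numeral_eq_Suc less_Suc_eq)

lemma out_arcs_mat_A:
  "out_arcs (mat_digraph 4 mat_A) 0 = {(0, 0), (0, 1), (0, 2), (0, 3)}"
  "out_arcs (mat_digraph 4 mat_A) 1 = {(1, 0), (1, 2), (1, 3)}"
  "out_arcs (mat_digraph 4 mat_A) 2 = {(2, 0), (2, 1), (2, 3)}"
  "out_arcs (mat_digraph 4 mat_A) 3 = {(3, 0), (3, 1), (3, 2)}"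
  by (auto simp: out_arcs_def arcs_mat_A)

lemma out_arcs_mat_B:
  "out_arcs (mat_digraph 4 mat_B) 0 = {(0, 1), (0, 2), (0, 3)}"
  "out_arcs (mat_digraph 4 mat_B) 1 = {(1, 0), (1, 2), (1, 3)}"
  "out_arcs (mat_digraph 4 mat_B) 2 = {(2, 0), (2, 1), (2, 3)}"
  "out_arcs (mat_digraph 4 mat_B) 3 = {(3, 0), (3, 1)}"
  by (auto simp: out_arcs_def arcs_mat_B)

text \<open>A family for \<open>mat_B\<close> built from a family \<open>P\<close>, \<open>S\<close>
  for \<open>mat_A\<close>. Vertex 1 of A is split into the range of the edge \<open>(1, 0)\<close>
  and the rest; the first piece is merged with \<open>P 0\<close> into vertex 2 of B and the rest
  becomes vertex 3. The involution is a parameter because the formulas are used for polynomials,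
  with \<open>sp_star\<close>, and for their classes, with \<open>ga_star\<close>.\<close>

definition B_vert :: "('a \<Rightarrow> 'a) \<Rightarrow> (nat \<Rightarrow> 'a) \<Rightarrow> (nat \<times> nat \<Rightarrow> 'a) \<Rightarrow> nat \<Rightarrow> 'a::ring" where
  "B_vert st P S v =
    (if v = 0 then P 3
     else if v = 1 then P 2
     else if v = 2 then P 0 + S (1, 0) * st (S (1, 0))
     else S (1, 2) * st (S (1, 2)) + S (1, 3) * st (S (1, 3)))"

definition B_edge :: "('a \<Rightarrow> 'a) \<Rightarrow> (nat \<Rightarrow> 'a) \<Rightarrow> (nat \<times> nat \<Rightarrow> 'a) \<Rightarrow> nat \<times> nat \<Rightarrow> 'a::ring" where
  "B_edge st P S e =
    (if e = (0, 1) then S (3, 2)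
     else if e = (0, 2) then (S (3, 0) + S (3, 1)) * B_vert st P S 2
     else if e = (0, 3) then S (3, 1) * B_vert st P S 3
     else if e = (1, 0) then S (2, 3)
     else if e = (1, 2) then (S (2, 0) + S (2, 1)) * B_vert st P S 2
     else if e = (1, 3) then S (2, 1) * B_vert st P S 3
     else if e = (2, 0) then
       S (1, 0) * (S (0, 0) * st (S (3, 0)) + S (0, 1) * st (S (3, 1)) + S (0, 2) * st (S (3, 2)))
     else if e = (2, 1) then
       S (0, 0) * st (S (2, 0)) + S (0, 1) * st (S (2, 1)) + S (0, 3) * st (S (2, 3))
     else if e = (2, 3) then S (1, 0) * S (0, 3) * st (S (1, 3)) + S (0, 2) * st (S (1, 2))
     else if e = (3, 0) then S (1, 3)
     else S (1, 2))"

text \<open>The inverse of the previous formulas. If the B-family comes from an A-family, then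
  \<open>S (2, 1)\<close> has as range the part of \<open>P 0\<close> over the edges (0,0), (0,1),
  (0,3), and the path \<open>S (2, 3) * S (3, 1)\<close> is the edge (0,2); together they recover
  \<open>P 0\<close>. The pieces left of vertices 2 and 3 of B add up to \<open>P 1\<close>.\<close>

definition A_vert :: "('a \<Rightarrow> 'a) \<Rightarrow> (nat \<Rightarrow> 'a) \<Rightarrow> (nat \<times> nat \<Rightarrow> 'a) \<Rightarrow> nat \<Rightarrow> 'a::ring" where
  "A_vert st P S v =
    (if v = 0 then S (2, 1) * st (S (2, 1)) + S (2, 3) * S (3, 1) * st (S (3, 1)) * st (S (2, 3))
     else if v = 1 then
       P 3 + S (2, 3) * S (3, 0) * st (S (3, 0)) * st (S (2, 3)) + S (2, 0) * st (S (2, 0))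
     else if v = 2 then P 1
     else P 0)"

text \<open>Only the edge \<open>(1, 0)\<close> is not read off from paths. In terms of the original
  A-family, its four summands are \<open>S (1, 0)\<close> multiplied by parts of \<open>P 0\<close>:
  the part over (0,1) followed by vertex 3 of B, the part over (0,2), the part over (0,3), and
  finally the part over (0,0) together with the path (0,1), (1,0). These parts add up to
  \<open>P 0\<close>.\<close>

definition A_edge :: "('a \<Rightarrow> 'a) \<Rightarrow> (nat \<Rightarrow> 'a) \<Rightarrow> (nat \<times> nat \<Rightarrow> 'a) \<Rightarrow> nat \<times> nat \<Rightarrow> 'a::ring" where
  "A_edge st P S e =
    (if e = (0, 0) then S (2, 1) * S (1, 2) * A_vert st P S 0
     else if e = (0, 1) then S (2, 1) * (S (1, 2) + S (1, 3)) * A_vert st P S 1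
     else if e = (0, 2) then S (2, 3) * S (3, 1)
     else if e = (0, 3) then S (2, 1) * S (1, 0)
     else if e = (1, 0) then
       S (2, 0) * S (0, 3) * st (S (1, 3)) * st (S (2, 1)) +
       S (2, 0) * S (0, 1) * st (S (3, 1)) * st (S (2, 3)) +
       S (2, 3) * S (3, 0) * st (S (1, 0)) * st (S (2, 1)) +
       S (2, 0) * S (0, 2) * st (S (1, 2)) * st (S (2, 1))
     else if e = (1, 2) then S (3, 1)
     else if e = (1, 3) then S (3, 0)
     else if e = (2, 0) then S (1, 2) * A_vert st P S 0
     else if e = (2, 1) then (S (1, 2) + S (1, 3)) * A_vert st P S 1
     else if e = (2, 3) then S (1, 0)
     else if e = (3, 0) then S (0, 2) * A_vert st P S 0
     else if e = (3, 1) then (S (0, 2) + S (0, 3)) * A_vert st P S 1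
     else S (0, 1))"

section \<open>The two substitutions yield Cuntz-Krieger families and are mutually inverse\<close>

locale strong_ck_A = strong_ck_family st "mat_digraph 4 mat_A" P S
  for st :: "'a::ring \<Rightarrow> 'a" and P S
begin

text \<open>
  Together with the rules for products, eliminating \<open>S e * st (S e)\<close> for one edge at every
  vertex gives normal forms.
\<close>

lemma range_simps:
  "S (0, 0) * st (S (0, 0)) =
    P 0 - S (0, 1) * st (S (0, 1)) - S (0, 2) * st (S (0, 2)) - S (0, 3) * st (S (0, 3))"
  "S (1, 0) * st (S (1, 0)) = P 1 - S (1, 2) * st (S (1, 2)) - S (1, 3) * st (S (1, 3))"
  "S (2, 0) * st (S (2, 0)) = P 2 - S (2, 1) * st (S (2, 1)) - S (2, 3) * st (S (2, 3))"
  "S (3, 0) * st (S (3, 0)) = P 3 - S (3, 1) * st (S (3, 1)) - S (3, 2) * st (S (3, 2))"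
  using P_eq_sum[of 0] P_eq_sum[of 1] P_eq_sum[of 2] P_eq_sum[of 3]
  by (simp_all add: out_arcs_mat_A algebra_simps del: One_nat_def)

lemma range_simps_assoc:
  "S (0, 0) * (st (S (0, 0)) * x) = P 0 * x - S (0, 1) * (st (S (0, 1)) * x)
    - S (0, 2) * (st (S (0, 2)) * x) - S (0, 3) * (st (S (0, 3)) * x)"
  "S (1, 0) * (st (S (1, 0)) * x) =
    P 1 * x - S (1, 2) * (st (S (1, 2)) * x) - S (1, 3) * (st (S (1, 3)) * x)"
  "S (2, 0) * (st (S (2, 0)) * x) =
    P 2 * x - S (2, 1) * (st (S (2, 1)) * x) - S (2, 3) * (st (S (2, 3)) * x)"
  "S (3, 0) * (st (S (3, 0)) * x) =
    P 3 * x - S (3, 1) * (st (S (3, 1)) * x) - S (3, 2) * (st (S (3, 2)) * x)"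
  by (simp_all add: range_simps left_diff_distrib del: One_nat_def flip: mult.assoc)

lemmas normal_simps = mult_zero_simps range_simps range_simps_assoc distrib_left distrib_right
  left_diff_distrib right_diff_distrib mult.assoc st_add st_mult st_diff arcs_mat_A

lemma ck_family_B: "ck_family (mat_digraph 4 mat_B) (B_vert st P S) (B_edge st P S)"
  unfolding ck_family_def mat_digraph_simps lessThan_4 arcs_mat_B
  by (intro conjI)
    (simp_all add: out_arcs_mat_B B_edge_def B_vert_def normal_simps del: One_nat_def)

lemma A_vert_B: "v < 4 \<Longrightarrow> A_vert st (B_vert st P S) (B_edge st P S) v = P v"
  unfolding less_4_cases
  by (elim disjE) (simp_all add: A_vert_def B_edge_def B_vert_def normal_simps del: One_nat_def)

lemma A_edge_B: "e \<in> arcs (mat_digraph 4 mat_A) \<Longrightarrow>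
    A_edge st (B_vert st P S) (B_edge st P S) e = S e"
  unfolding arcs_mat_A insert_iff empty_iff
  by (elim disjE) (simp_all add: A_edge_def A_vert_def B_edge_def B_vert_def normal_simps del: One_nat_def)

end

locale strong_ck_B = strong_ck_family st "mat_digraph 4 mat_B" P S
  for st :: "'a::ring \<Rightarrow> 'a" and P S
begin

text \<open>The normal forms are chosen as for A. At vertex 0 the eliminated edge is
  \<open>(0, 1)\<close>, because B has no loop there.\<close>

lemma range_simps:
  "S (0, 1) * st (S (0, 1)) = P 0 - S (0, 2) * st (S (0, 2)) - S (0, 3) * st (S (0, 3))"
  "S (1, 0) * st (S (1, 0)) = P 1 - S (1, 2) * st (S (1, 2)) - S (1, 3) * st (S (1, 3))"
  "S (2, 0) * st (S (2, 0)) = P 2 - S (2, 1) * st (S (2, 1)) - S (2, 3) * st (S (2, 3))"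
  "S (3, 0) * st (S (3, 0)) = P 3 - S (3, 1) * st (S (3, 1))"
  using P_eq_sum[of 0] P_eq_sum[of 1] P_eq_sum[of 2] P_eq_sum[of 3]
  by (simp_all add: out_arcs_mat_B algebra_simps del: One_nat_def)

lemma range_simps_assoc:
  "S (0, 1) * (st (S (0, 1)) * x) =
    P 0 * x - S (0, 2) * (st (S (0, 2)) * x) - S (0, 3) * (st (S (0, 3)) * x)"
  "S (1, 0) * (st (S (1, 0)) * x) =
    P 1 * x - S (1, 2) * (st (S (1, 2)) * x) - S (1, 3) * (st (S (1, 3)) * x)"
  "S (2, 0) * (st (S (2, 0)) * x) =
    P 2 * x - S (2, 1) * (st (S (2, 1)) * x) - S (2, 3) * (st (S (2, 3)) * x)"
  "S (3, 0) * (st (S (3, 0)) * x) = P 3 * x - S (3, 1) * (st (S (3, 1)) * x)"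
  by (simp_all add: range_simps left_diff_distrib del: One_nat_def flip: mult.assoc)

lemmas normal_simps = mult_zero_simps range_simps range_simps_assoc distrib_left distrib_right
  left_diff_distrib right_diff_distrib mult.assoc st_add st_mult st_diff arcs_mat_B

lemma ck_family_A: "ck_family (mat_digraph 4 mat_A) (A_vert st P S) (A_edge st P S)"
  unfolding ck_family_def mat_digraph_simps lessThan_4 arcs_mat_A
  by (intro conjI)
    (simp_all add: out_arcs_mat_A A_edge_def A_vert_def normal_simps del: One_nat_def)

lemma B_vert_A: "v < 4 \<Longrightarrow> B_vert st (A_vert st P S) (A_edge st P S) v = P v"
  unfolding less_4_cases
  by (elim disjE) (simp_all add: A_vert_def A_edge_def B_vert_def normal_simps del: One_nat_def)

lemma B_edge_A: "e \<in> arcs (mat_digraph 4 mat_B) \<Longrightarrow>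
    B_edge st (A_vert st P S) (A_edge st P S) e = S e"
  unfolding arcs_mat_B insert_iff empty_iff
  by (elim disjE) (simp_all add: B_edge_def A_vert_def A_edge_def B_vert_def normal_simps del: One_nat_def)

text \<open>This is preservation of the unit, which is the sum of all vertex projections; an element
  of \<open>ring_iso\<close> has to respect it.\<close>

lemma sum_A_vert: "(\<Sum>v<4. A_vert st P S v) = (\<Sum>v<4. P v)"
  unfolding lessThan_4 by (simp add: A_vert_def normal_simps del: One_nat_def)

end

section \<open>Free *-algebras modulo C*-seminorms\<close>

context
  fixes G :: "('v, 'e) pre_digraph" and q :: "('v, 'e) gen star_poly \<Rightarrow> real"
  assumes q: "cstar_seminorm_on (free_star_alg G) q"
begin

lemma poly_seminorm_nonneg: "f \<in> free_star_alg G \<Longrightarrow> 0 \<le> q f"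
  and poly_seminorm_add: "f \<in> free_star_alg G \<Longrightarrow> g \<in> free_star_alg G \<Longrightarrow> q (f + g) \<le> q f + q g"
  and poly_seminorm_scale: "f \<in> free_star_alg G \<Longrightarrow> q (sp_scale c f) = cmod c * q f"
  and poly_seminorm_mult: "f \<in> free_star_alg G \<Longrightarrow> g \<in> free_star_alg G \<Longrightarrow> q (f * g) \<le> q f * q g"
  and poly_seminorm_star_mult: "f \<in> free_star_alg G \<Longrightarrow> q (sp_star f * f) = (q f)\<^sup>2"
  using q by (simp_all add: cstar_seminorm_on_def)

lemma poly_seminorm_zero: "q 0 = 0"
  using poly_seminorm_scale[of 0 0] by simp

lemma poly_seminorm_minus: "f \<in> free_star_alg G \<Longrightarrow> q (- f) = q f"
  using poly_seminorm_scale[of f "- 1"] by (simp add: sp_scale_minus_one)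

lemma poly_seminorm_commute:
  "f \<in> free_star_alg G \<Longrightarrow> g \<in> free_star_alg G \<Longrightarrow> q (f - g) = q (g - f)"
  using poly_seminorm_minus[of "f - g"] by (simp add: free_star_alg_diff)

lemma poly_seminorm_triangle:
  assumes "f \<in> free_star_alg G" "g \<in> free_star_alg G" "h \<in> free_star_alg G"
  shows "q (f - h) \<le> q (f - g) + q (g - h)"
  using poly_seminorm_add[of "f - g" "g - h"] assms by (simp add: free_star_alg_diff)

lemma poly_seminorm_eqI:
  assumes "f \<in> free_star_alg G" "g \<in> free_star_alg G" "q (f - g) = 0"
  shows "q f = q g"
  using poly_seminorm_triangle[of f g 0] poly_seminorm_triangle[of g f 0] assms
    poly_seminorm_commute[of f g] by simp

lemma poly_seminorm_star:
  assumes f: "f \<in> free_star_alg G" shows "q (sp_star f) = q f"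
proof -
  have le: "q f \<le> q (sp_star f)" if f: "f \<in> free_star_alg G" for f
  proof (cases "q f = 0")
    case False
    have "q f * q f \<le> q (sp_star f) * q f"
      using poly_seminorm_star_mult[OF f] poly_seminorm_mult[OF free_star_alg_star[OF f] f]
      by (simp add: power2_eq_square)
    then show ?thesis using False poly_seminorm_nonneg[OF f] by simp
  qed (simp add: poly_seminorm_nonneg free_star_alg_star f)
  show ?thesis
    using le[OF f] le[OF free_star_alg_star[OF f]] by simp
qed

end

section \<open>The common kernel of the admissible seminorms and the quotient ring\<close>

definition ck_seminorm :: "('v, 'e) pre_digraph \<Rightarrow> (('v, 'e) gen star_poly \<Rightarrow> real) \<Rightarrow> bool" where
  "ck_seminorm G q \<longleftrightarrow> cstar_seminorm_on (free_star_alg G) q \<and> (\<forall>r\<in>graph_relators G. q r = 0)"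

text \<open>For a finite graph this is the kernel of the universal seminorm. It is described without
  the supremum, since computations in the quotient precede the proof that the supremum is
  finite.\<close>

definition null_polys :: "('v, 'e) pre_digraph \<Rightarrow> ('v, 'e) gen star_poly set" where
  "null_polys G = {f \<in> free_star_alg G. \<forall>q. ck_seminorm G q \<longrightarrow> q f = 0}"

lemma null_polysI:
  "f \<in> free_star_alg G \<Longrightarrow>
   (\<And>q. cstar_seminorm_on (free_star_alg G) q \<Longrightarrow> ck_seminorm G q \<Longrightarrow> q f \<le> 0) \<Longrightarrow> f \<in> null_polys G"
  unfolding null_polys_def ck_seminorm_def using poly_seminorm_nonneg by fastforce

lemma null_polysD: "f \<in> null_polys G \<Longrightarrow> ck_seminorm G q \<Longrightarrow> q f = 0"
  by (simp add: null_polys_def)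

lemma null_polys_free: "f \<in> null_polys G \<Longrightarrow> f \<in> free_star_alg G"
  by (simp add: null_polys_def)

lemma null_polys_zero [simp]: "0 \<in> null_polys G"
  by (rule null_polysI) (simp_all add: poly_seminorm_zero)

lemma null_polys_add:
  assumes asms: "f \<in> null_polys G" "g \<in> null_polys G"
  shows "f + g \<in> null_polys G"
proof (rule null_polysI)
  fix q assume q: "cstar_seminorm_on (free_star_alg G) q" "ck_seminorm G q"
  show "q (f + g) \<le> 0"
    using poly_seminorm_add[OF q(1), of f g] q(2) asms by (simp add: null_polys_free null_polysD)
qed (use asms in \<open>simp add: null_polys_free free_star_alg_add\<close>)

lemma null_polys_scale: "f \<in> null_polys G \<Longrightarrow> sp_scale c f \<in> null_polys G"
  by (rule null_polysI) (auto simp: null_polys_free null_polysD free_star_alg_scale poly_seminorm_scale)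

lemma null_polys_minus: "f \<in> null_polys G \<Longrightarrow> - f \<in> null_polys G"
  using null_polys_scale[of f G "- 1"] by (simp add: sp_scale_minus_one)

lemma null_polys_mult_left:
  assumes asms: "f \<in> free_star_alg G" "g \<in> null_polys G"
  shows "f * g \<in> null_polys G"
proof (rule null_polysI)
  fix q assume q: "cstar_seminorm_on (free_star_alg G) q" "ck_seminorm G q"
  show "q (f * g) \<le> 0"
    using poly_seminorm_mult[OF q(1), of f g] q(2) asms by (simp add: null_polys_free null_polysD)
qed (use asms in \<open>simp add: null_polys_free free_star_alg_mult\<close>)

lemma null_polys_mult_right:
  assumes asms: "f \<in> null_polys G" "g \<in> free_star_alg G"
  shows "f * g \<in> null_polys G"
proof (rule null_polysI)
  fix q assume q: "cstar_seminorm_on (free_star_alg G) q" "ck_seminorm G q"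
  show "q (f * g) \<le> 0"
    using poly_seminorm_mult[OF q(1), of f g] q(2) asms by (simp add: null_polys_free null_polysD)
qed (use asms in \<open>simp add: null_polys_free free_star_alg_mult\<close>)

lemma null_polys_star: "f \<in> null_polys G \<Longrightarrow> sp_star f \<in> null_polys G"
  by (rule null_polysI) (auto simp: null_polys_free null_polysD free_star_alg_star poly_seminorm_star)

text \<open>
  Polynomial identities modulo all seminorms are computed in a quotient ring. A quotient type
  cannot depend on a graph, hence it is formed for all graphs at once, as a product.
\<close>

definition ck_rel ::
  "(('v, 'e) pre_digraph \<Rightarrow> ('v, 'e) gen star_poly) \<Rightarrow> (('v, 'e) pre_digraph \<Rightarrow> ('v, 'e) gen star_poly) \<Rightarrow> bool"
  where "ck_rel F F' \<longleftrightarrow>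
    (\<forall>G. F G \<in> free_star_alg G \<and> F' G \<in> free_star_alg G \<and> F G - F' G \<in> null_polys G)"

quotient_type ('v, 'e) graph_alg =
  "('v, 'e) pre_digraph \<Rightarrow> ('v, 'e) gen star_poly" / partial: ck_rel
proof (rule part_equivpI)
  let ?R = "ck_rel :: (('v, 'e) pre_digraph \<Rightarrow> ('v, 'e) gen star_poly) \<Rightarrow> _"
  show "\<exists>F. ?R F F" by (rule exI[of _ "\<lambda>G. 0"]) (simp add: ck_rel_def)
  show "symp ?R"
  proof (rule sympI)
    fix F F' :: "('v, 'e) pre_digraph \<Rightarrow> ('v, 'e) gen star_poly" assume a: "ck_rel F F'"
    then have "- (F G - F' G) \<in> null_polys G" for G
      by (intro null_polys_minus) (simp add: ck_rel_def)
    then show "ck_rel F' F" using a by (simp add: ck_rel_def)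
  qed
  show "transp ?R"
  proof (rule transpI)
    fix F F' F'' :: "('v, 'e) pre_digraph \<Rightarrow> ('v, 'e) gen star_poly"
    assume a: "ck_rel F F'" "ck_rel F' F''"
    then have "(F G - F' G) + (F' G - F'' G) \<in> null_polys G" for G
      by (intro null_polys_add) (simp_all add: ck_rel_def)
    then show "ck_rel F F''" using a by (simp add: ck_rel_def)
  qed
qed

instantiation graph_alg :: (type, type) real_algebra
begin

lift_definition zero_graph_alg :: "('a, 'b) graph_alg" is "\<lambda>G. 0"
  by (simp add: ck_rel_def)

lift_definition plus_graph_alg :: "('a, 'b) graph_alg \<Rightarrow> ('a, 'b) graph_alg \<Rightarrow> ('a, 'b) graph_alg"
  is "\<lambda>F F' G. F G + F' G"
proof -
  fix F1 F2 F3 F4 :: "('a, 'b) pre_digraph \<Rightarrow> ('a, 'b) gen star_poly"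
  assume a: "ck_rel F1 F2" "ck_rel F3 F4"
  then have "(F1 G - F2 G) + (F3 G - F4 G) \<in> null_polys G" for G
    by (intro null_polys_add) (simp_all add: ck_rel_def)
  then show "ck_rel (\<lambda>G. F1 G + F3 G) (\<lambda>G. F2 G + F4 G)"
    using a by (simp add: ck_rel_def free_star_alg_add add_diff_add)
qed

lift_definition uminus_graph_alg :: "('a, 'b) graph_alg \<Rightarrow> ('a, 'b) graph_alg" is "\<lambda>F G. - F G"
proof -
  fix F1 F2 :: "('a, 'b) pre_digraph \<Rightarrow> ('a, 'b) gen star_poly"
  assume a: "ck_rel F1 F2"
  then have "- (F1 G - F2 G) \<in> null_polys G" for G
    by (intro null_polys_minus) (simp_all add: ck_rel_def)
  then show "ck_rel (\<lambda>G. - F1 G) (\<lambda>G. - F2 G)"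
    using a by (simp add: ck_rel_def free_star_alg_minus)
qed

definition minus_graph_alg :: "('a, 'b) graph_alg \<Rightarrow> ('a, 'b) graph_alg \<Rightarrow> ('a, 'b) graph_alg" where
  "minus_graph_alg x y = x + - y"

lift_definition times_graph_alg :: "('a, 'b) graph_alg \<Rightarrow> ('a, 'b) graph_alg \<Rightarrow> ('a, 'b) graph_alg"
  is "\<lambda>F F' G. F G * F' G"
proof -
  fix F1 F2 F3 F4 :: "('a, 'b) pre_digraph \<Rightarrow> ('a, 'b) gen star_poly"
  assume a: "ck_rel F1 F2" "ck_rel F3 F4"
  then have "(F1 G - F2 G) * F3 G + F2 G * (F3 G - F4 G) \<in> null_polys G" for G
    by (intro null_polys_add null_polys_mult_left null_polys_mult_right) (simp_all add: ck_rel_def)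
  then show "ck_rel (\<lambda>G. F1 G * F3 G) (\<lambda>G. F2 G * F4 G)"
    using a by (simp add: ck_rel_def free_star_alg_mult left_diff_distrib right_diff_distrib)
qed

lift_definition scaleR_graph_alg :: "real \<Rightarrow> ('a, 'b) graph_alg \<Rightarrow> ('a, 'b) graph_alg"
  is "\<lambda>c F G. sp_scale (complex_of_real c) (F G)"
proof -
  fix c and F1 F2 :: "('a, 'b) pre_digraph \<Rightarrow> ('a, 'b) gen star_poly"
  assume a: "ck_rel F1 F2"
  then have "sp_scale (complex_of_real c) (F1 G - F2 G) \<in> null_polys G" for G
    by (intro null_polys_scale) (simp_all add: ck_rel_def)
  then show "ck_rel (\<lambda>G. sp_scale (complex_of_real c) (F1 G)) (\<lambda>G. sp_scale (complex_of_real c) (F2 G))"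
    using a by (simp add: ck_rel_def free_star_alg_scale sp_scale_diff_right)
qed

instance
proof
  fix x y z :: "('a, 'b) graph_alg" and c d :: real
  have I: "ck_rel F F'" if "\<And>G. F G \<in> free_star_alg G" "F = F'"
    for F F' :: "('a, 'b) pre_digraph \<Rightarrow> ('a, 'b) gen star_poly"
    using that by (simp add: ck_rel_def)
  note cl = free_star_alg_add free_star_alg_minus free_star_alg_mult free_star_alg_scale
  show "x + y + z = x + (y + z)"
    by transfer (rule I; simp add: ck_rel_def cl add.assoc)
  show "x + y = y + x"
    by transfer (rule I; simp add: ck_rel_def cl add.commute)
  show "0 + x = x"
    by transfer (rule I; simp add: ck_rel_def cl)
  show "- x + x = 0"
    by transfer (rule I; simp add: ck_rel_def cl)
  show "x - y = x + - y" by (rule minus_graph_alg_def)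
  show "x * y * z = x * (y * z)"
    by transfer (rule I; simp add: ck_rel_def cl mult.assoc)
  show "(x + y) * z = x * z + y * z"
    by transfer (rule I; simp add: ck_rel_def cl distrib_right)
  show "x * (y + z) = x * y + x * z"
    by transfer (rule I; simp add: ck_rel_def cl distrib_left)
  show "c *\<^sub>R (x + y) = c *\<^sub>R x + c *\<^sub>R y"
    by transfer (rule I; simp add: ck_rel_def cl sp_scale_add_right)
  show "(c + d) *\<^sub>R x = c *\<^sub>R x + d *\<^sub>R x"
    by transfer (rule I; simp add: ck_rel_def cl sp_scale_add_left)
  show "c *\<^sub>R d *\<^sub>R x = (c * d) *\<^sub>R x"
    by transfer (rule I; simp add: ck_rel_def cl)
  show "1 *\<^sub>R x = x"
    by transfer (rule I; simp add: ck_rel_def cl)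
  show "c *\<^sub>R x * y = c *\<^sub>R (x * y)"
    by transfer (rule I; simp add: ck_rel_def cl sp_scale_mult_left)
  show "x * c *\<^sub>R y = c *\<^sub>R (x * y)"
    by transfer (rule I; simp add: ck_rel_def cl sp_scale_mult_right)
qed

end

section \<open>Involution, seminorms and polynomial classes in the quotient ring\<close>

lift_definition ga_star :: "('v, 'e) graph_alg \<Rightarrow> ('v, 'e) graph_alg" is "\<lambda>F G. sp_star (F G)"
proof -
  fix F1 F2 :: "('v, 'e) pre_digraph \<Rightarrow> ('v, 'e) gen star_poly"
  assume a: "ck_rel F1 F2"
  then have "sp_star (F1 G - F2 G) \<in> null_polys G" for G
    by (intro null_polys_star) (simp_all add: ck_rel_def)
  then show "ck_rel (\<lambda>G. sp_star (F1 G)) (\<lambda>G. sp_star (F2 G))"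
    using a by (simp add: ck_rel_def free_star_alg_star sp_star_diff)
qed

text \<open>The default 0 for inadmissible \<open>q\<close> makes the map independent of
  representatives for every \<open>q\<close>; an arbitrary function need not vanish on
  \<open>null_polys\<close>.\<close>

lift_definition ga_seminorm ::
  "('v, 'e) pre_digraph \<Rightarrow> (('v, 'e) gen star_poly \<Rightarrow> real) \<Rightarrow> ('v, 'e) graph_alg \<Rightarrow> real"
  is "\<lambda>G q F. if ck_seminorm G q then q (F G) else 0"
proof -
  fix G q and F1 F2 :: "('v, 'e) pre_digraph \<Rightarrow> ('v, 'e) gen star_poly"
  assume a: "ck_rel F1 F2"
  have "q (F1 G) = q (F2 G)" if q: "ck_seminorm G q"
    using q a by (intro poly_seminorm_eqI[of G q]) (auto simp: ck_rel_def ck_seminorm_def null_polys_def)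
  then show "(if ck_seminorm G q then q (F1 G) else 0) = (if ck_seminorm G q then q (F2 G) else 0)"
    by simp
qed

text \<open>The embedding of one factor into the product, extended by 0 to the other coordinates.
  The default 0 for polynomials outside the free *-algebra keeps the representative in the domain of
  \<open>ck_rel\<close>.\<close>

lift_definition poly_class :: "('v, 'e) pre_digraph \<Rightarrow> ('v, 'e) gen star_poly \<Rightarrow> ('v, 'e) graph_alg"
  is "\<lambda>G f H. if H = G \<and> f \<in> free_star_alg G then f else 0"
  by (simp add: ck_rel_def)

definition ga_seminorms :: "(('v, 'e) graph_alg \<Rightarrow> real) set" where
  "ga_seminorms = {ga_seminorm G q | G q. ck_seminorm G q}"

text \<open>Separation is what the quotient is made for: if all admissible seminorms of all graphs
  vanish on a class, each coordinate lies in \<open>null_polys\<close>. This makes the results on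
  sums of projections available for polynomial identities.\<close>

interpretation ga: cstar_seminormed ga_star "ga_seminorms :: (('v, 'e) graph_alg \<Rightarrow> real) set"
proof
  fix x y :: "('v, 'e) graph_alg" and c :: real
  have I: "ck_rel F F'" if "\<And>G. F G \<in> free_star_alg G" "F = F'"
    for F F' :: "('v, 'e) pre_digraph \<Rightarrow> ('v, 'e) gen star_poly"
    using that by (simp add: ck_rel_def)
  note cl = free_star_alg_add free_star_alg_minus free_star_alg_mult free_star_alg_scale free_star_alg_star
  show "ga_star (x + y) = ga_star x + ga_star y"
    by transfer (rule I; simp add: ck_rel_def cl sp_star_add)
  show "ga_star (x * y) = ga_star y * ga_star x"
    by transfer (rule I; simp add: ck_rel_def cl sp_star_mult)
  show "ga_star (ga_star x) = x"
    by transfer (rule I; simp add: ck_rel_def cl)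
  {
    fix \<nu> :: "('v, 'e) graph_alg \<Rightarrow> real" assume "\<nu> \<in> ga_seminorms"
    then obtain G q where \<nu>: "\<nu> = ga_seminorm G q" and q: "ck_seminorm G q"
      by (auto simp: ga_seminorms_def)
    have q': "cstar_seminorm_on (free_star_alg G) q" using q by (simp add: ck_seminorm_def)
    show "0 \<le> \<nu> x"
      unfolding \<nu> by (transfer fixing: G q) (simp add: q ck_rel_def poly_seminorm_nonneg[OF q'])
    show "\<nu> (x + y) \<le> \<nu> x + \<nu> y"
      unfolding \<nu> by (transfer fixing: G q) (simp add: q ck_rel_def poly_seminorm_add[OF q'])
    show "\<nu> (c *\<^sub>R x) = \<bar>c\<bar> * \<nu> x"
      unfolding \<nu> by (transfer fixing: G q) (simp add: q ck_rel_def poly_seminorm_scale[OF q'])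
    show "\<nu> (x * y) \<le> \<nu> x * \<nu> y"
      unfolding \<nu> by (transfer fixing: G q) (simp add: q ck_rel_def poly_seminorm_mult[OF q'])
    show "\<nu> (ga_star x * x) = (\<nu> x)\<^sup>2"
      unfolding \<nu> by (transfer fixing: G q) (simp add: q ck_rel_def poly_seminorm_star_mult[OF q'])
  }
  have "x = 0" if "\<forall>G q. ck_seminorm G q \<longrightarrow> ga_seminorm G q x = 0"
    using that by transfer (simp add: ck_rel_def null_polys_def)
  then show "x = 0" if "\<And>\<nu>. \<nu> \<in> ga_seminorms \<Longrightarrow> \<nu> x = 0"
    using that by (auto simp: ga_seminorms_def)
qed

lemma ck_rel_eqI: "(\<And>G. F G \<in> free_star_alg G) \<Longrightarrow> F = F' \<Longrightarrow> ck_rel F F'"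
  by (simp add: ck_rel_def)

lemma poly_class_zero [simp]: "poly_class G 0 = 0"
  by transfer (simp add: ck_rel_def)

lemma poly_class_add:
  "f \<in> free_star_alg G \<Longrightarrow> g \<in> free_star_alg G \<Longrightarrow> poly_class G (f + g) = poly_class G f + poly_class G g"
  by transfer (rule ck_rel_eqI; auto simp: free_star_alg_add)

lemma poly_class_minus:
  "f \<in> free_star_alg G \<Longrightarrow> poly_class G (- f) = - poly_class G f"
  by transfer (rule ck_rel_eqI; auto simp: free_star_alg_minus)

lemma poly_class_diff:
  "f \<in> free_star_alg G \<Longrightarrow> g \<in> free_star_alg G \<Longrightarrow> poly_class G (f - g) = poly_class G f - poly_class G g"
  using poly_class_add[of f G "- g"] by (simp add: poly_class_minus free_star_alg_minus)

lemma poly_class_mult: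
  "f \<in> free_star_alg G \<Longrightarrow> g \<in> free_star_alg G \<Longrightarrow> poly_class G (f * g) = poly_class G f * poly_class G g"
  by transfer (rule ck_rel_eqI; auto simp: free_star_alg_mult)

lemma poly_class_star:
  "f \<in> free_star_alg G \<Longrightarrow> poly_class G (sp_star f) = ga_star (poly_class G f)"
  by transfer (rule ck_rel_eqI; auto simp: free_star_alg_star)

lemma poly_class_sum:
  "(\<And>i. i \<in> I \<Longrightarrow> f i \<in> free_star_alg G) \<Longrightarrow> poly_class G (\<Sum>i\<in>I. f i) = (\<Sum>i\<in>I. poly_class G (f i))"
  by (induction I rule: infinite_finite_induct) (simp_all add: poly_class_add sum_in_free_star_alg)

lemma poly_class_eq_0_iff: "f \<in> free_star_alg G \<Longrightarrow> poly_class G f = 0 \<longleftrightarrow> f \<in> null_polys G"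
  by transfer (simp add: ck_rel_def)

lemma poly_class_eq_iff:
  "f \<in> free_star_alg G \<Longrightarrow> g \<in> free_star_alg G \<Longrightarrow> poly_class G f = poly_class G g \<longleftrightarrow> f - g \<in> null_polys G"
  using poly_class_eq_0_iff[of "f - g" G] by (simp add: poly_class_diff free_star_alg_diff)

lemma ga_seminorm_poly_class:
  "f \<in> free_star_alg G \<Longrightarrow> ck_seminorm G q \<Longrightarrow> ga_seminorm G q (poly_class G f) = q f"
  by transfer simp

section \<open>The universal seminorm\<close>

lemma star_hom_sp_gen: "star_hom sp_gen f = f"
proof (induction f rule: star_poly_induct)
  case (single w c)
  have *: "prod_list (map (eval_letter sp_gen) ls) = Poly_Mapping.single (Word ls) 1" for ls :: "'a letter list"
  proof (induction ls)
    case (Cons l ls)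
    have "eval_letter sp_gen l = Poly_Mapping.single (Word [l]) 1"
      by (cases l) (simp_all add: sp_gen_def star_word_def)
    then show ?case using Cons by (simp add: mult_single plus_gen_word_def)
  qed (simp flip: zero_gen_word_def)
  show ?case by (cases w) (simp add: star_hom_single eval_word_def *)
qed (simp_all add: star_hom_add)

lemma ball_setcompr: "(\<forall>r\<in>{f x |x. x \<in> A}. Q r) \<longleftrightarrow> (\<forall>x\<in>A. Q (f x))"
  by auto

lemma ball_setcompr_distinct_pairs:
  "(\<forall>r\<in>{f x y |x y. x \<in> A \<and> y \<in> A \<and> x \<noteq> y}. Q r) \<longleftrightarrow>
    (\<forall>x\<in>A. \<forall>y\<in>A. x \<noteq> y \<longrightarrow> Q (f x y))"
  by auto

text \<open>Bridge between relators and families, used in both directions: with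
  \<open>\<sigma> = sp_gen\<close> it makes the generators a Cuntz-Krieger family, and for an
  explicit family it shows that the substitution kills the relators.\<close>

lemma ck_family_poly_class_iff:
  assumes wf: "\<And>e. e \<in> arcs G \<Longrightarrow> head G e \<in> verts G"
    and \<sigma>: "\<And>x. x \<in> graph_gens G \<Longrightarrow> \<sigma> x \<in> free_star_alg H"
  shows "(\<forall>r\<in>graph_relators G. star_hom \<sigma> r \<in> null_polys H) \<longleftrightarrow>
    ga.ck_family G (\<lambda>v. poly_class H (\<sigma> (Vert v))) (\<lambda>e. poly_class H (\<sigma> (Edge e)))"
proof -
  let ?F = "free_star_alg H"
  let ?P = "\<lambda>v. poly_class H (\<sigma> (Vert v))" and ?S = "\<lambda>e. poly_class H (\<sigma> (Edge e))"
  have V: "\<sigma> (Vert v) \<in> ?F" if "v \<in> verts G" for v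
    using that by (intro \<sigma>) (simp add: graph_gens_def)
  have E: "\<sigma> (Edge e) \<in> ?F" if "e \<in> arcs G" for e
    using that by (intro \<sigma>) (simp add: graph_gens_def)
  note cl = free_star_alg_star free_star_alg_mult
  have D: "f - g \<in> null_polys H \<longleftrightarrow> poly_class H f = poly_class H g" if "f \<in> ?F" "g \<in> ?F" for f g
    using poly_class_eq_iff that by blast
  note [simp] = star_hom_diff star_hom_star star_hom_mult star_hom_sum
  have 1: "star_hom \<sigma> (sp_star (sp_P v) - sp_P v) \<in> null_polys H \<longleftrightarrow> ga_star (?P v) = ?P v"
    "star_hom \<sigma> (sp_P v * sp_P v - sp_P v) \<in> null_polys H \<longleftrightarrow> ?P v * ?P v = ?P v"
    if "v \<in> verts G" for v
    using V[OF that] by (simp_all add: D cl poly_class_star poly_class_mult)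
  have 2: "star_hom \<sigma> (sp_P v * sp_P w) \<in> null_polys H \<longleftrightarrow> ?P v * ?P w = 0"
    if "v \<in> verts G" "w \<in> verts G" for v w
    using V that by (simp add: cl poly_class_mult flip: poly_class_eq_0_iff)
  have 3: "star_hom \<sigma> (sp_S e * sp_star (sp_S e) * sp_S e - sp_S e) \<in> null_polys H \<longleftrightarrow>
      ?S e * ga_star (?S e) * ?S e = ?S e"
    "star_hom \<sigma> (sp_star (sp_S e) * sp_S e - sp_P (head G e)) \<in> null_polys H \<longleftrightarrow>
      ga_star (?S e) * ?S e = ?P (head G e)"
    if "e \<in> arcs G" for e
    using E[OF that] V[OF wf[OF that]] by (simp_all add: D cl poly_class_star poly_class_mult)
  have 4: "star_hom \<sigma> (sp_P v - (\<Sum>e\<in>out_arcs G v. sp_S e * sp_star (sp_S e))) \<in> null_polys H \<longleftrightarrow>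
      ?P v = (\<Sum>e\<in>out_arcs G v. ?S e * ga_star (?S e))" if "v \<in> verts G" for v
  proof -
    have S: "\<sigma> (Edge e) * sp_star (\<sigma> (Edge e)) \<in> ?F" if "e \<in> out_arcs G v" for e
      using that by (intro cl E) (simp_all add: out_arcs_def)
    have "poly_class H (\<Sum>e\<in>out_arcs G v. \<sigma> (Edge e) * sp_star (\<sigma> (Edge e))) =
        (\<Sum>e\<in>out_arcs G v. poly_class H (\<sigma> (Edge e) * sp_star (\<sigma> (Edge e))))"
      by (intro poly_class_sum S)
    also have "\<dots> = (\<Sum>e\<in>out_arcs G v. ?S e * ga_star (?S e))"
      by (intro sum.cong refl) (simp add: out_arcs_def E poly_class_mult poly_class_star free_star_alg_star)
    finally have *: "poly_class H (\<Sum>e\<in>out_arcs G v. \<sigma> (Edge e) * sp_star (\<sigma> (Edge e))) =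
        (\<Sum>e\<in>out_arcs G v. ?S e * ga_star (?S e))" .
    have "(\<Sum>e\<in>out_arcs G v. \<sigma> (Edge e) * sp_star (\<sigma> (Edge e))) \<in> ?F"
      by (intro sum_in_free_star_alg S)
    from D[OF V[OF that] this] show ?thesis by (simp add: *)
  qed
  have R: "(\<forall>r\<in>graph_relators G. Q r) \<longleftrightarrow>
      (\<forall>v\<in>verts G. Q (sp_star (sp_P v) - sp_P v)) \<and>
      (\<forall>v\<in>verts G. Q (sp_P v * sp_P v - sp_P v)) \<and>
      (\<forall>v\<in>verts G. \<forall>w\<in>verts G. v \<noteq> w \<longrightarrow> Q (sp_P v * sp_P w)) \<and>
      (\<forall>e\<in>arcs G. Q (sp_S e * sp_star (sp_S e) * sp_S e - sp_S e)) \<and>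
      (\<forall>e\<in>arcs G. Q (sp_star (sp_S e) * sp_S e - sp_P (head G e))) \<and>
      (\<forall>v\<in>verts G. Q (sp_P v - (\<Sum>e\<in>out_arcs G v. sp_S e * sp_star (sp_S e))))" for Q
    unfolding graph_relators_def ball_Un ball_setcompr ball_setcompr_distinct_pairs conj_assoc ..
  show ?thesis
    unfolding R ga.ck_family_def
    by (simp only: 1 2 3 4 cong: ball_cong)
qed

section \<open>The universal seminorm of a finite graph is an admissible seminorm\<close>

locale finite_graph =
  fixes G :: "('v, 'e) pre_digraph"
  assumes finite_arcs: "finite (arcs G)"
    and tail_in_verts: "e \<in> arcs G \<Longrightarrow> tail G e \<in> verts G"
    and head_in_verts: "e \<in> arcs G \<Longrightarrow> head G e \<in> verts G"
begin

lemma sp_P_free: "v \<in> verts G \<Longrightarrow> sp_P v \<in> free_star_alg G"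
  and sp_S_free: "e \<in> arcs G \<Longrightarrow> sp_S e \<in> free_star_alg G"
  by (simp_all add: sp_gen_in_free_star_alg graph_gens_def)

text \<open>The relators lie in \<open>null_polys\<close> because every admissible seminorm vanishes
  on them; substituting \<open>sp_gen\<close> for the generators is the identity.\<close>

lemma ck_family_gens: "ga.ck_family G (\<lambda>v. poly_class G (sp_P v)) (\<lambda>e. poly_class G (sp_S e))"
proof -
  have relators: "r \<in> free_star_alg G" if "r \<in> graph_relators G" for r
    using that unfolding graph_relators_def
    by (auto simp: out_arcs_def intro!: free_star_alg_diff free_star_alg_mult free_star_alg_star
        sum_in_free_star_alg sp_P_free sp_S_free head_in_verts)
  then have "r \<in> null_polys G" if "r \<in> graph_relators G" for r
    using that by (simp add: null_polys_def ck_seminorm_def)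
  then show ?thesis
    using ck_family_poly_class_iff[of G sp_gen G, OF head_in_verts sp_gen_in_free_star_alg]
    by (simp add: star_hom_sp_gen)
qed

lemma strong_ck_family_gens:
  "strong_ck_family ga_star G (\<lambda>v. poly_class G (sp_P v)) (\<lambda>e. poly_class G (sp_S e))"
  by (intro ga.strong_ck_familyI ck_family_gens finite_arcs tail_in_verts head_in_verts)

lemma ck_seminorm_gen_le_1:
  assumes q: "ck_seminorm G q" and x: "x \<in> graph_gens G"
  shows "q (sp_gen x) \<le> 1"
proof -
  interpret strong_ck_family ga_star G "\<lambda>v. poly_class G (sp_P v)" "\<lambda>e. poly_class G (sp_S e)"
    by (rule strong_ck_family_gens)
  have q': "cstar_seminorm_on (free_star_alg G) q" using q by (simp add: ck_seminorm_def)
  have \<nu>: "ga_seminorm G q \<in> ga_seminorms" using q by (auto simp: ga_seminorms_def)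
  have V: "q (sp_P v) \<le> 1" if v: "v \<in> verts G" for v
  proof -
    have "ga.projection (poly_class G (sp_P v))"
      using st_P[OF v] P_P[OF v v] by (simp add: ga.projection_def)
    from ga.seminorm_projection_le_1[OF \<nu> this] show ?thesis
      by (simp only: ga_seminorm_poly_class[OF sp_P_free[OF v] q])
  qed
  have E: "q (sp_S e) \<le> 1" if e: "e \<in> arcs G" for e
  proof -
    have "(q (sp_S e))\<^sup>2 = ga_seminorm G q (poly_class G (sp_P (head G e)))"
      using ga.seminorm_star_mult[OF \<nu>, of "poly_class G (sp_S e)"] st_S_S[OF e e]
      by (simp only: ga_seminorm_poly_class[OF sp_S_free[OF e] q] if_True simp_thms)
    then have "(q (sp_S e))\<^sup>2 \<le> 1\<^sup>2"
      using V[OF head_in_verts[OF e]]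
      by (simp only: ga_seminorm_poly_class[OF sp_P_free[OF head_in_verts[OF e]] q] one_power2)
    then show ?thesis by (rule power2_le_imp_le) simp
  qed
  from x consider v where "v \<in> verts G" "x = Vert v" | e where "e \<in> arcs G" "x = Edge e"
    unfolding graph_gens_def by blast
  then show ?thesis using V E by cases blast+
qed

text \<open>A supremum of reals carries information only if the set is bounded. The bound, uniform
  in \<open>q\<close>, starts from the value 1 on generators and their adjoints and is propagated
  through products, multiples and sums.\<close>

lemma ck_seminorms_bounded:
  assumes "f \<in> free_star_alg G"
  shows "\<exists>C\<ge>0. \<forall>q. ck_seminorm G q \<longrightarrow> q f \<le> C"
  using assms
proof (induction rule: free_star_alg_induct)
  case zero
  have "q 0 \<le> 0" if "ck_seminorm G q" for q
    using that poly_seminorm_zero[of G q] by (simp add: ck_seminorm_def)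
  then show ?case by blast
next
  case (gen x)
  then show ?case using ck_seminorm_gen_le_1 by (intro exI[of _ 1]) auto
next
  case (star x)
  have "q (sp_star (sp_gen x)) \<le> 1" if q: "ck_seminorm G q" for q
    using ck_seminorm_gen_le_1[OF q star(1)] q sp_gen_in_free_star_alg[OF star(1)]
      poly_seminorm_star[of G q "sp_gen x"] by (simp add: ck_seminorm_def)
  then show ?case by (intro exI[of _ 1]) simp
next
  case (mult f g)
  then obtain C D where C: "C \<ge> 0" "\<And>q. ck_seminorm G q \<Longrightarrow> q f \<le> C"
    and D: "D \<ge> 0" "\<And>q. ck_seminorm G q \<Longrightarrow> q g \<le> D" by blast
  have "q (f * g) \<le> C * D" if q: "ck_seminorm G q" for q
  proof -
    have q': "cstar_seminorm_on (free_star_alg G) q" using q by (simp add: ck_seminorm_def)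
    show ?thesis
      using poly_seminorm_mult[OF q' mult(1,2)] mult_mono[OF C(2)[OF q] D(2)[OF q] C(1)]
        poly_seminorm_nonneg[OF q' mult(2)] by linarith
  qed
  then show ?case using C(1) D(1) by (intro exI[of _ "C * D"] conjI allI impI mult_nonneg_nonneg)
next
  case (scale c f)
  then obtain C where C: "C \<ge> 0" "\<And>q. ck_seminorm G q \<Longrightarrow> q f \<le> C" by blast
  have "q (sp_scale c f) \<le> cmod c * C" if q: "ck_seminorm G q" for q
    using q C(2)[OF q] poly_seminorm_scale[of G q f c] scale(1)
    by (simp add: ck_seminorm_def mult_left_mono)
  then show ?case using C(1) by (intro exI[of _ "cmod c * C"] conjI allI impI mult_nonneg_nonneg norm_ge_zero)
next
  case (add f g)
  then obtain C D where C: "C \<ge> 0" "\<And>q. ck_seminorm G q \<Longrightarrow> q f \<le> C"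
    and D: "D \<ge> 0" "\<And>q. ck_seminorm G q \<Longrightarrow> q g \<le> D" by blast
  have "q (f + g) \<le> C + D" if q: "ck_seminorm G q" for q
  proof -
    have q': "cstar_seminorm_on (free_star_alg G) q" using q by (simp add: ck_seminorm_def)
    show ?thesis
      using poly_seminorm_add[OF q' add(1,2)] C(2)[OF q] D(2)[OF q] by linarith
  qed
  then show ?case using C(1) D(1) by (intro exI[of _ "C + D"] conjI allI impI add_nonneg_nonneg)
qed

lemma univ_seminorm_eq: "univ_seminorm G f = (SUP q\<in>Collect (ck_seminorm G). q f)"
proof -
  have "Collect (ck_seminorm G) =
      {q. cstar_seminorm_on (free_star_alg G) q \<and> (\<forall>r\<in>graph_relators G. q r = 0)}"
    by (auto simp: ck_seminorm_def)
  then show ?thesis by (simp only: univ_seminorm_def)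
qed

text \<open>Shows that the supremum is taken over a nonempty set, and gives its
  nonnegativity.\<close>

lemma ck_seminorm_zero: "ck_seminorm G (\<lambda>_. 0)"
  by (simp add: ck_seminorm_def cstar_seminorm_on_def)

lemma ck_seminorm_le_univ:
  assumes "ck_seminorm G q" "f \<in> free_star_alg G" shows "q f \<le> univ_seminorm G f"
proof -
  obtain C where "\<And>q. ck_seminorm G q \<Longrightarrow> q f \<le> C"
    using ck_seminorms_bounded[OF assms(2)] by blast
  then show ?thesis
    unfolding univ_seminorm_eq using assms(1)
    by (intro cSUP_upper bdd_aboveI[of _ C]) auto
qed

lemma univ_seminorm_le:
  assumes "\<And>q. ck_seminorm G q \<Longrightarrow> q f \<le> c"
  shows "univ_seminorm G f \<le> c"
  unfolding univ_seminorm_eq by (rule cSUP_least) (use assms ck_seminorm_zero in auto)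

text \<open>A pointwise finite supremum of C*-seminorms inherits the inequalities directly. The two
  equalities, homogeneity and the C*-identity, each need a separate argument for the reverse
  inequality.\<close>

lemma ck_seminorm_univ: "ck_seminorm G (univ_seminorm G)"
proof -
  let ?F = "free_star_alg G" and ?U = "univ_seminorm G"
  have c: "cstar_seminorm_on ?F q" if "ck_seminorm G q" for q
    using that by (simp add: ck_seminorm_def)
  have nonneg: "0 \<le> ?U f" if "f \<in> ?F" for f
    using ck_seminorm_le_univ[OF ck_seminorm_zero that] .
  have add: "?U (f + g) \<le> ?U f + ?U g" if "f \<in> ?F" "g \<in> ?F" for f g
  proof (rule univ_seminorm_le)
    fix q assume q: "ck_seminorm G q"
    show "q (f + g) \<le> ?U f + ?U g"
      using poly_seminorm_add[OF c[OF q] that] ck_seminorm_le_univ[OF q] that by (meson add_mono order_trans)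
  qed
  have scale_le: "?U (sp_scale a f) \<le> cmod a * ?U f" if "f \<in> ?F" for a f
  proof (rule univ_seminorm_le)
    fix q assume q: "ck_seminorm G q"
    show "q (sp_scale a f) \<le> cmod a * ?U f"
      using poly_seminorm_scale[OF c[OF q] that] ck_seminorm_le_univ[OF q that] by (simp add: mult_left_mono)
  qed
  have scale: "?U (sp_scale a f) = cmod a * ?U f" if f: "f \<in> ?F" for a f
  proof (cases "a = 0")
    case True
    then show ?thesis using scale_le[OF f, of a] nonneg[OF free_star_alg_scale[OF f, of a]] by simp
  next
    case False
    \<comment> \<open>The reverse inequality is the one already shown, applied to the inverse
      scalar.\<close>
    have "?U (sp_scale (inverse a) (sp_scale a f)) \<le> cmod (inverse a) * ?U (sp_scale a f)"
      by (intro scale_le free_star_alg_scale f)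
    then have "?U f \<le> inverse (cmod a) * ?U (sp_scale a f)"
    proof -
      have "inverse a * a = 1" using False by simp
      then show ?thesis using \<open>?U (sp_scale (inverse a) _) \<le> _\<close>
        by (simp only: sp_scale_scale sp_scale_one norm_inverse)
    qed
    then have "cmod a * ?U f \<le> ?U (sp_scale a f)"
      using False by (simp add: field_simps)
    then show ?thesis using scale_le[OF f, of a] by simp
  qed
  have mult: "?U (f * g) \<le> ?U f * ?U g" if "f \<in> ?F" "g \<in> ?F" for f g
  proof (rule univ_seminorm_le)
    fix q assume q: "ck_seminorm G q"
    have "q f * q g \<le> ?U f * ?U g"
      using that by (intro mult_mono ck_seminorm_le_univ[OF q] nonneg poly_seminorm_nonneg[OF c[OF q]])
    then show "q (f * g) \<le> ?U f * ?U g"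
      using poly_seminorm_mult[OF c[OF q] that] by linarith
  qed
  have star: "?U (sp_star f * f) = (?U f)\<^sup>2" if f: "f \<in> ?F" for f
  proof (rule antisym)
    have ff: "sp_star f * f \<in> ?F" by (intro free_star_alg_mult free_star_alg_star f)
    show "?U (sp_star f * f) \<le> (?U f)\<^sup>2"
    proof (rule univ_seminorm_le)
      fix q assume q: "ck_seminorm G q"
      show "q (sp_star f * f) \<le> (?U f)\<^sup>2"
        using poly_seminorm_star_mult[OF c[OF q] f] ck_seminorm_le_univ[OF q f]
          poly_seminorm_nonneg[OF c[OF q] f] by (simp add: power_mono)
    qed
    \<comment> \<open>Taking the root first gives an upper bound for each single \<open>q f\<close>,
      hence for their supremum; squaring comes afterwards.\<close>
    have "?U f \<le> sqrt (?U (sp_star f * f))"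
    proof (rule univ_seminorm_le)
      fix q assume q: "ck_seminorm G q"
      have "(q f)\<^sup>2 \<le> ?U (sp_star f * f)"
        using poly_seminorm_star_mult[OF c[OF q] f] ck_seminorm_le_univ[OF q ff] by simp
      then show "q f \<le> sqrt (?U (sp_star f * f))" by (rule real_le_rsqrt)
    qed
    from power_mono[OF this nonneg[OF f], of 2] show "(?U f)\<^sup>2 \<le> ?U (sp_star f * f)"
      using nonneg[OF ff] by simp
  qed
  have relators: "?U r = 0" if r: "r \<in> graph_relators G" for r
  proof (rule antisym)
    show "?U r \<le> 0" by (rule univ_seminorm_le) (use r in \<open>simp add: ck_seminorm_def\<close>)
    have "(0::real) \<in> (\<lambda>q. q r) ` Collect (ck_seminorm G)" using ck_seminorm_zero by force
    moreover have "(\<lambda>q. q r) ` Collect (ck_seminorm G) \<subseteq> {0}" using r by (auto simp: ck_seminorm_def)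
    ultimately have "(\<lambda>q. q r) ` Collect (ck_seminorm G) = {0}" by blast
    then show "0 \<le> ?U r" by (simp add: univ_seminorm_eq)
  qed
  show ?thesis
    using nonneg add scale mult star relators by (simp add: ck_seminorm_def cstar_seminorm_on_def)
qed

lemma cstar_seminorm_univ: "cstar_seminorm_on (free_star_alg G) (univ_seminorm G)"
  using ck_seminorm_univ by (simp add: ck_seminorm_def)

end

section \<open>Completions\<close>

context finite_graph
begin

abbreviation (input) "U \<equiv> univ_seminorm G"
abbreviation (input) "F \<equiv> free_star_alg G"

lemmas U_nonneg = poly_seminorm_nonneg[OF cstar_seminorm_univ]
  and U_add = poly_seminorm_add[OF cstar_seminorm_univ]
  and U_scale = poly_seminorm_scale[OF cstar_seminorm_univ]
  and U_mult = poly_seminorm_mult[OF cstar_seminorm_univ]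
  and U_zero = poly_seminorm_zero[OF cstar_seminorm_univ]
  and U_triangle = poly_seminorm_triangle[OF cstar_seminorm_univ]
  and U_commute = poly_seminorm_commute[OF cstar_seminorm_univ]
  and U_star = poly_seminorm_star[OF cstar_seminorm_univ]

lemma U_add_diff:
  assumes "f \<in> F" "f' \<in> F" "g \<in> F" "g' \<in> F"
  shows "U ((f + g) - (f' + g')) \<le> U (f - f') + U (g - g')"
proof -
  have e: "(f + g) - (f' + g') = (f - f') + (g - g')" by (rule add_diff_add)
  show ?thesis unfolding e by (intro U_add free_star_alg_diff assms)
qed

lemma U_mult_diff:
  assumes "f \<in> F" "f' \<in> F" "g \<in> F" "g' \<in> F"
  shows "U (f * g - f' * g') \<le> U f * U (g - g') + U (f - f') * U g'"
proof -
  have e: "f * g - f' * g' = f * (g - g') + (f - f') * g'" by (simp add: algebra_simps)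
  have "U (f * (g - g') + (f - f') * g') \<le> U (f * (g - g')) + U ((f - f') * g')"
    using assms by (intro U_add free_star_alg_mult free_star_alg_diff)
  then show ?thesis
    unfolding e using U_mult[of f "g - g'"] U_mult[of "f - f'" g'] assms
    by (simp add: free_star_alg_diff)
qed

lemma U_scale_diff:
  assumes "f \<in> F" "f' \<in> F"
  shows "U (sp_scale c f - sp_scale c f') = cmod c * U (f - f')"
  using U_scale[of "f - f'" c] assms by (simp add: sp_scale_diff_right free_star_alg_diff)

lemma U_star_diff:
  assumes "f \<in> F" "f' \<in> F"
  shows "U (sp_star f - sp_star f') = U (f - f')"
  using U_star[of "f - f'"] assms by (simp add: sp_star_diff free_star_alg_diff)

lemma cauchy_seqs_free: "x \<in> cauchy_seqs G \<Longrightarrow> x n \<in> F"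
  by (simp add: cauchy_seqs_def)

lemma cauchy_seqsD:
  "x \<in> cauchy_seqs G \<Longrightarrow> \<epsilon> > 0 \<Longrightarrow> \<exists>N. \<forall>m\<ge>N. \<forall>n\<ge>N. U (x m - x n) < \<epsilon>"
  by (simp add: cauchy_seqs_def)

lemma cauchy_seqsI:
  "(\<And>n. x n \<in> F) \<Longrightarrow> (\<And>\<epsilon>. \<epsilon> > 0 \<Longrightarrow> \<exists>N. \<forall>m\<ge>N. \<forall>n\<ge>N. U (x m - x n) < \<epsilon>) \<Longrightarrow> x \<in> cauchy_seqs G"
  by (simp add: cauchy_seqs_def)

lemma cauchy_seqs_bounded:
  assumes x: "x \<in> cauchy_seqs G"
  obtains B where "B > 0" "\<And>n. U (x n) \<le> B"
proof -
  obtain N where N: "\<And>m n. m \<ge> N \<Longrightarrow> n \<ge> N \<Longrightarrow> U (x m - x n) < 1"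
    using cauchy_seqsD[OF x, of 1] by auto
  define B where "B = (\<Sum>n\<le>N. U (x n)) + 1"
  have s: "U (x n) \<le> (\<Sum>n\<le>N. U (x n))" if "n \<le> N" for n
    using that by (intro member_le_sum) (auto intro: U_nonneg cauchy_seqs_free[OF x])
  have "U (x n) \<le> B" for n
  proof (cases "n \<le> N")
    case True
    then show ?thesis using s[OF True] by (simp add: B_def)
  next
    case False
    have "U (x n - 0) \<le> U (x n - x N) + U (x N - 0)"
      by (intro U_triangle cauchy_seqs_free[OF x] zero_in_free_star_alg)
    then show ?thesis using N[of n N] False s[of N] by (simp add: B_def)
  qed
  moreover have "B > 0"
    unfolding B_def by (intro add_nonneg_pos sum_nonneg U_nonneg cauchy_seqs_free[OF x]) simp
  ultimately show ?thesis using that by blast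
qed

lemma cauchy_seqs_const: "f \<in> F \<Longrightarrow> (\<lambda>n. f) \<in> cauchy_seqs G"
  by (rule cauchy_seqsI) (simp_all add: U_zero)

lemma cauchy_seqs_add:
  assumes x: "x \<in> cauchy_seqs G" and y: "y \<in> cauchy_seqs G"
  shows "(\<lambda>n. x n + y n) \<in> cauchy_seqs G"
proof (rule cauchy_seqsI)
  note m = cauchy_seqs_free[OF x] cauchy_seqs_free[OF y]
  show "x n + y n \<in> F" for n by (intro free_star_alg_add m)
  fix \<epsilon> :: real assume "\<epsilon> > 0"
  then obtain N M where N: "\<And>m n. m \<ge> N \<Longrightarrow> n \<ge> N \<Longrightarrow> U (x m - x n) < \<epsilon> / 2"
    and M: "\<And>m n. m \<ge> M \<Longrightarrow> n \<ge> M \<Longrightarrow> U (y m - y n) < \<epsilon> / 2"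
    using cauchy_seqsD[OF x, of "\<epsilon> / 2"] cauchy_seqsD[OF y, of "\<epsilon> / 2"] half_gt_zero by metis
  have "U ((x m + y m) - (x n + y n)) < \<epsilon>" if "m \<ge> max N M" "n \<ge> max N M" for m n
  proof -
    have "m \<ge> N" "m \<ge> M" "n \<ge> N" "n \<ge> M" using that by auto
    then show ?thesis
      using U_add_diff[OF m(1)[of m] m(1)[of n] m(2)[of m] m(2)[of n]] N[of m n] M[of m n] by linarith
  qed
  then show "\<exists>N. \<forall>m\<ge>N. \<forall>n\<ge>N. U ((x m + y m) - (x n + y n)) < \<epsilon>" by blast
qed

lemma cauchy_seqs_mult:
  assumes x: "x \<in> cauchy_seqs G" and y: "y \<in> cauchy_seqs G"
  shows "(\<lambda>n. x n * y n) \<in> cauchy_seqs G"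
proof (rule cauchy_seqsI)
  note m = cauchy_seqs_free[OF x] cauchy_seqs_free[OF y]
  show "x n * y n \<in> F" for n by (intro free_star_alg_mult m)
  fix \<epsilon> :: real assume "\<epsilon> > 0"
  obtain B where B: "B > 0" "\<And>n. U (x n) \<le> B" using cauchy_seqs_bounded[OF x] by blast
  obtain C where C: "C > 0" "\<And>n. U (y n) \<le> C" using cauchy_seqs_bounded[OF y] by blast
  have "\<epsilon> / (2 * B) > 0" "\<epsilon> / (2 * C) > 0" using B C \<open>\<epsilon> > 0\<close> by simp_all
  then obtain N M where N: "\<And>m n. m \<ge> N \<Longrightarrow> n \<ge> N \<Longrightarrow> U (x m - x n) < \<epsilon> / (2 * C)"
    and M: "\<And>m n. m \<ge> M \<Longrightarrow> n \<ge> M \<Longrightarrow> U (y m - y n) < \<epsilon> / (2 * B)"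
    using cauchy_seqsD[OF x, of "\<epsilon> / (2 * C)"] cauchy_seqsD[OF y, of "\<epsilon> / (2 * B)"] by metis
  have "U (x m * y m - x n * y n) < \<epsilon>" if "m \<ge> max N M" "n \<ge> max N M" for m n
  proof -
    have g: "m \<ge> N" "m \<ge> M" "n \<ge> N" "n \<ge> M" using that by auto
    have "U (x m) * U (y m - y n) \<le> B * U (y m - y n)"
      by (intro mult_right_mono B U_nonneg free_star_alg_diff m)
    also have "\<dots> < B * (\<epsilon> / (2 * B))"
      using M[of m n] g B by (intro mult_strict_left_mono) auto
    finally have 1: "U (x m) * U (y m - y n) < \<epsilon> / 2" using B by simp
    have "U (x m - x n) * U (y n) \<le> U (x m - x n) * C"
      by (intro mult_left_mono C U_nonneg free_star_alg_diff m)
    also have "\<dots> < \<epsilon> / (2 * C) * C"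
      using N[of m n] g C by (intro mult_strict_right_mono) auto
    finally have 2: "U (x m - x n) * U (y n) < \<epsilon> / 2" using C by simp
    show ?thesis
      using U_mult_diff[OF m(1)[of m] m(1)[of n] m(2)[of m] m(2)[of n]] 1 2 by linarith
  qed
  then show "\<exists>N. \<forall>m\<ge>N. \<forall>n\<ge>N. U (x m * y m - x n * y n) < \<epsilon>" by blast
qed

lemma cauchy_seqs_star:
  assumes x: "x \<in> cauchy_seqs G" shows "(\<lambda>n. sp_star (x n)) \<in> cauchy_seqs G"
proof (rule cauchy_seqsI)
  show "sp_star (x n) \<in> F" for n by (intro free_star_alg_star cauchy_seqs_free[OF x])
  fix \<epsilon> :: real assume "\<epsilon> > 0"
  then show "\<exists>N. \<forall>m\<ge>N. \<forall>n\<ge>N. U (sp_star (x m) - sp_star (x n)) < \<epsilon>"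
    using cauchy_seqsD[OF x] by (simp add: U_star_diff cauchy_seqs_free[OF x])
qed

lemma cauchy_seqs_scale:
  assumes x: "x \<in> cauchy_seqs G" shows "(\<lambda>n. sp_scale c (x n)) \<in> cauchy_seqs G"
proof -
  have "(\<lambda>n. sp_scale c (x n)) \<in> cauchy_seqs G" if c: "c \<noteq> 0"
  proof (rule cauchy_seqsI)
    show "sp_scale c (x n) \<in> F" for n by (intro free_star_alg_scale cauchy_seqs_free[OF x])
    fix \<epsilon> :: real assume "\<epsilon> > 0"
    then have "\<epsilon> / cmod c > 0" using c by simp
    then show "\<exists>N. \<forall>m\<ge>N. \<forall>n\<ge>N. U (sp_scale c (x m) - sp_scale c (x n)) < \<epsilon>"
      using cauchy_seqsD[OF x, of "\<epsilon> / cmod c"] c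
      by (simp add: U_scale_diff cauchy_seqs_free[OF x] field_simps)
  qed
  then show ?thesis using cauchy_seqs_const[of 0] by (cases "c = 0") auto
qed

section \<open>Null sequences and the operations on classes of Cauchy sequences\<close>

lemma null_rel_iff:
  "(x, y) \<in> null_rel G \<longleftrightarrow>
    x \<in> cauchy_seqs G \<and> y \<in> cauchy_seqs G \<and> (\<lambda>n. U (x n - y n)) \<longlonglongrightarrow> 0"
  by (simp add: null_rel_def)

lemma tendsto_0_le:
  assumes "\<And>n. 0 \<le> f n" "\<And>n. f n \<le> g n" "g \<longlonglongrightarrow> (0::real)"
  shows "f \<longlonglongrightarrow> 0"
  by (rule tendsto_sandwich[OF _ _ tendsto_const assms(3)]) (use assms in auto)

lemma equiv_null_rel: "equiv (cauchy_seqs G) (null_rel G)"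
proof (rule equivI)
  show "null_rel G \<subseteq> cauchy_seqs G \<times> cauchy_seqs G" by (auto simp: null_rel_def)
  show "refl_on (cauchy_seqs G) (null_rel G)"
    by (rule refl_onI) (auto simp: null_rel_def U_zero)
  show "sym (null_rel G)"
    by (rule symI) (auto simp: null_rel_def U_commute[OF cauchy_seqs_free cauchy_seqs_free])
  show "trans (null_rel G)"
  proof (rule transI)
    fix x y z assume a: "(x, y) \<in> null_rel G" "(y, z) \<in> null_rel G"
    then have c: "x \<in> cauchy_seqs G" "y \<in> cauchy_seqs G" "z \<in> cauchy_seqs G"
      by (simp_all add: null_rel_iff)
    have "(\<lambda>n. U (x n - y n) + U (y n - z n)) \<longlonglongrightarrow> 0 + 0"
      using a by (intro tendsto_add) (simp_all add: null_rel_iff)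
    then have lim: "(\<lambda>n. U (x n - y n) + U (y n - z n)) \<longlonglongrightarrow> 0" by simp
    note m = c[THEN cauchy_seqs_free]
    have "(\<lambda>n. U (x n - z n)) \<longlonglongrightarrow> 0"
      by (rule tendsto_0_le[OF _ _ lim]) (intro U_nonneg U_triangle free_star_alg_diff m)+
    then show "(x, z) \<in> null_rel G" using c by (simp add: null_rel_iff)
  qed
qed

abbreviation cls where "cls x \<equiv> null_rel G `` {x}"

lemma cls_eq_iff:
  "x \<in> cauchy_seqs G \<Longrightarrow> y \<in> cauchy_seqs G \<Longrightarrow> cls x = cls y \<longleftrightarrow> (\<lambda>n. U (x n - y n)) \<longlonglongrightarrow> 0"
  using eq_equiv_class_iff[OF equiv_null_rel, of x y] by (simp add: null_rel_iff)

lemma null_rel_add: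
  assumes "(x, x') \<in> null_rel G" "(y, y') \<in> null_rel G"
  shows "((\<lambda>n. x n + y n), (\<lambda>n. x' n + y' n)) \<in> null_rel G"
proof -
  have c: "x \<in> cauchy_seqs G" "x' \<in> cauchy_seqs G" "y \<in> cauchy_seqs G" "y' \<in> cauchy_seqs G"
    using assms by (simp_all add: null_rel_iff)
  note m = c[THEN cauchy_seqs_free]
  have "(\<lambda>n. U (x n - x' n) + U (y n - y' n)) \<longlonglongrightarrow> 0 + 0"
    using assms by (intro tendsto_add) (simp_all add: null_rel_iff)
  then have lim: "(\<lambda>n. U (x n - x' n) + U (y n - y' n)) \<longlonglongrightarrow> 0" by simp
  have "(\<lambda>n. U ((x n + y n) - (x' n + y' n))) \<longlonglongrightarrow> 0"
    by (rule tendsto_0_le[OF _ _ lim])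
      (intro U_nonneg U_add_diff free_star_alg_diff free_star_alg_add m)+
  then show ?thesis using c by (simp add: null_rel_iff cauchy_seqs_add)
qed

lemma null_rel_mult:
  assumes "(x, x') \<in> null_rel G" "(y, y') \<in> null_rel G"
  shows "((\<lambda>n. x n * y n), (\<lambda>n. x' n * y' n)) \<in> null_rel G"
proof -
  have c: "x \<in> cauchy_seqs G" "x' \<in> cauchy_seqs G" "y \<in> cauchy_seqs G" "y' \<in> cauchy_seqs G"
    using assms by (simp_all add: null_rel_iff)
  note m = c[THEN cauchy_seqs_free]
  obtain B where B: "\<And>n. U (x n) \<le> B" using cauchy_seqs_bounded[OF c(1)] by blast
  obtain C where C: "\<And>n. U (y' n) \<le> C" using cauchy_seqs_bounded[OF c(4)] by blast
  have "(\<lambda>n. B * U (y n - y' n) + U (x n - x' n) * C) \<longlonglongrightarrow> B * 0 + 0 * C"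
    using assms by (intro tendsto_add tendsto_mult_left tendsto_mult_right) (simp_all add: null_rel_iff)
  then have lim: "(\<lambda>n. B * U (y n - y' n) + U (x n - x' n) * C) \<longlonglongrightarrow> 0" by simp
  have le: "U (x n * y n - x' n * y' n) \<le> B * U (y n - y' n) + U (x n - x' n) * C" for n
  proof -
    have "U (x n) * U (y n - y' n) \<le> B * U (y n - y' n)" "U (x n - x' n) * U (y' n) \<le> U (x n - x' n) * C"
      by (intro mult_right_mono mult_left_mono B C U_nonneg free_star_alg_diff m)+
    then show ?thesis
      using U_mult_diff[OF m(1)[of n] m(2)[of n] m(3)[of n] m(4)[of n]] by linarith
  qed
  have "(\<lambda>n. U (x n * y n - x' n * y' n)) \<longlonglongrightarrow> 0"
    by (rule tendsto_0_le[OF _ le lim]) (intro U_nonneg free_star_alg_diff free_star_alg_mult m)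
  then show ?thesis using c by (simp add: null_rel_iff cauchy_seqs_mult)
qed

lemma null_rel_scale:
  assumes "(x, x') \<in> null_rel G"
  shows "((\<lambda>n. sp_scale c (x n)), (\<lambda>n. sp_scale c (x' n))) \<in> null_rel G"
proof -
  have "(\<lambda>n. cmod c * U (x n - x' n)) \<longlonglongrightarrow> cmod c * 0"
    using assms by (intro tendsto_mult_left) (simp add: null_rel_iff)
  then show ?thesis
    using assms by (simp add: null_rel_iff cauchy_seqs_scale U_scale_diff cauchy_seqs_free)
qed

lemma null_rel_star:
  assumes "(x, x') \<in> null_rel G"
  shows "((\<lambda>n. sp_star (x n)), (\<lambda>n. sp_star (x' n))) \<in> null_rel G"
  using assms by (simp add: null_rel_iff cauchy_seqs_star U_star_diff cauchy_seqs_free)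

lemma cls_cong: "(x, x') \<in> null_rel G \<Longrightarrow> cls x = cls x'"
  by (rule equiv_class_eq[OF equiv_null_rel])

lemma carrier_eq: "carrier (graph_cstar_algebra G) = cls ` cauchy_seqs G"
  by (auto simp: graph_cstar_algebra_def quotient_def)

lemma one_eq: "\<one>\<^bsub>graph_cstar_algebra G\<^esub> = cls (\<lambda>n. \<Sum>v\<in>verts G. sp_P v)"
  by (simp add: graph_cstar_algebra_def)

text \<open>The operations are defined as unions over all representatives. Since any two
  representatives give the same class, the union collapses to that class; the same holds for the
  operations that follow.\<close>

lemma add_cls:
  assumes "x \<in> cauchy_seqs G" "y \<in> cauchy_seqs G"
  shows "cls x \<oplus>\<^bsub>graph_cstar_algebra G\<^esub> cls y = cls (\<lambda>n. x n + y n)"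
proof -
  have "(\<lambda>x y. cls (\<lambda>n. x n + y n)) respects2 null_rel G"
    by (auto simp: congruent2_def intro!: cls_cong null_rel_add)
  from UN_equiv_class2[OF equiv_null_rel equiv_null_rel this assms]
  show ?thesis by (simp add: graph_cstar_algebra_def)
qed

lemma mult_cls:
  assumes "x \<in> cauchy_seqs G" "y \<in> cauchy_seqs G"
  shows "cls x \<otimes>\<^bsub>graph_cstar_algebra G\<^esub> cls y = cls (\<lambda>n. x n * y n)"
proof -
  have "(\<lambda>x y. cls (\<lambda>n. x n * y n)) respects2 null_rel G"
    by (auto simp: congruent2_def intro!: cls_cong null_rel_mult)
  from UN_equiv_class2[OF equiv_null_rel equiv_null_rel this assms]
  show ?thesis by (simp add: graph_cstar_algebra_def)
qed

lemma smult_cls: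
  assumes "x \<in> cauchy_seqs G"
  shows "c \<odot>\<^bsub>graph_cstar_algebra G\<^esub> cls x = cls (\<lambda>n. sp_scale c (x n))"
proof -
  have "(\<lambda>x. cls (\<lambda>n. sp_scale c (x n))) respects null_rel G"
    by (auto simp: congruent_def intro!: cls_cong null_rel_scale)
  from UN_equiv_class[OF equiv_null_rel this assms]
  show ?thesis by (simp add: graph_cstar_algebra_def)
qed

lemma star_cls:
  assumes "x \<in> cauchy_seqs G"
  shows "star (graph_cstar_algebra G) (cls x) = cls (\<lambda>n. sp_star (x n))"
proof -
  have "(\<lambda>x. cls (\<lambda>n. sp_star (x n))) respects null_rel G"
    by (auto simp: congruent_def intro!: cls_cong null_rel_star)
  from UN_equiv_class[OF equiv_null_rel this assms]
  show ?thesis by (simp add: graph_cstar_algebra_def)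
qed

end

text \<open>Termwise application of an isometry preserves and reflects Cauchy sequences and null
  differences, which gives a well-defined injective map of completions. Here \<open>dense\<close>
  asks for preimages up to seminorm 0, so a Cauchy sequence can be lifted term by term.\<close>

lemma star_isomorphic_graph_cstar_algebraI:
  fixes \<sigma> :: "('v, 'e) gen \<Rightarrow> ('w, 'f) gen star_poly"
  assumes G: "finite_graph G" and H: "finite_graph H"
    and free: "\<And>x. x \<in> graph_gens G \<Longrightarrow> \<sigma> x \<in> free_star_alg H"
    and isometric: "\<And>f. f \<in> free_star_alg G \<Longrightarrow> univ_seminorm H (star_hom \<sigma> f) = univ_seminorm G f"
    and dense: "\<And>g. g \<in> free_star_alg H \<Longrightarrow>
      \<exists>f\<in>free_star_alg G. univ_seminorm H (star_hom \<sigma> f - g) = 0"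
    and unit: "univ_seminorm H (star_hom \<sigma> (\<Sum>v\<in>verts G. sp_P v) - (\<Sum>v\<in>verts H. sp_P v)) = 0"
  shows "star_isomorphic (graph_cstar_algebra G) (graph_cstar_algebra H)"
proof -
  interpret G: finite_graph G by (rule G)
  interpret H: finite_graph H by (rule H)
  let ?h = "star_hom \<sigma>"
  have h: "?h f \<in> free_star_alg H" if "f \<in> free_star_alg G" for f
    using star_hom_in_free_star_alg[OF that] free by blast
  have iso: "univ_seminorm H (?h f - ?h g) = univ_seminorm G (f - g)"
    if "f \<in> free_star_alg G" "g \<in> free_star_alg G" for f g
    using isometric[OF free_star_alg_diff[OF that]] by (simp add: star_hom_diff)
  have hc: "(\<lambda>n. ?h (x n)) \<in> cauchy_seqs H" if x: "x \<in> cauchy_seqs G" for x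
    using G.cauchy_seqsD[OF x] G.cauchy_seqs_free[OF x]
    by (intro H.cauchy_seqsI) (simp_all add: h iso)
  have hr: "((\<lambda>n. ?h (x n)), (\<lambda>n. ?h (y n))) \<in> null_rel H" if "(x, y) \<in> null_rel G" for x y
    using that by (simp add: G.null_rel_iff H.null_rel_iff hc iso G.cauchy_seqs_free)
  define \<phi> where "\<phi> X = (\<Union>x\<in>X. H.cls (\<lambda>n. ?h (x n)))" for X
  have \<phi>: "\<phi> (G.cls x) = H.cls (\<lambda>n. ?h (x n))" if "x \<in> cauchy_seqs G" for x
  proof -
    have "(\<lambda>x. H.cls (\<lambda>n. ?h (x n))) respects null_rel G"
      by (auto simp: congruent_def intro!: H.cls_cong hr)
    from UN_equiv_class[OF G.equiv_null_rel this that] show ?thesis by (simp only: \<phi>_def)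
  qed
  have inj: "inj_on \<phi> (G.cls ` cauchy_seqs G)"
  proof (rule inj_onI)
    fix X Y assume "X \<in> G.cls ` cauchy_seqs G" "Y \<in> G.cls ` cauchy_seqs G" and e: "\<phi> X = \<phi> Y"
    then obtain x y where x: "x \<in> cauchy_seqs G" "X = G.cls x" and y: "y \<in> cauchy_seqs G" "Y = G.cls y"
      by blast
    have "(\<lambda>n. univ_seminorm H (?h (x n) - ?h (y n))) \<longlonglongrightarrow> 0"
      using e H.cls_eq_iff[OF hc[OF x(1)] hc[OF y(1)]] by (simp add: x \<phi> y)
    then show "X = Y"
      using x y by (simp add: iso G.cauchy_seqs_free G.cls_eq_iff)
  qed
  have surj: "H.cls y \<in> \<phi> ` G.cls ` cauchy_seqs G" if y: "y \<in> cauchy_seqs H" for y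
  proof -
    \<comment> \<open>Preimages are chosen independently for each \<open>n\<close>; that they form a
      Cauchy sequence then follows from the isometry and two triangle inequalities.\<close>
    have "\<forall>n. \<exists>f. f \<in> free_star_alg G \<and> univ_seminorm H (?h f - y n) = 0"
      using dense H.cauchy_seqs_free[OF y] by blast
    then obtain x where x: "\<And>n. x n \<in> free_star_alg G" "\<And>n. univ_seminorm H (?h (x n) - y n) = 0"
      by metis
    have le: "univ_seminorm G (x m - x n) \<le> univ_seminorm H (y m - y n)" for m n
    proof -
      have "univ_seminorm H (?h (x m) - ?h (x n)) \<le>
          univ_seminorm H (?h (x m) - y m) + univ_seminorm H (y m - ?h (x n))"
        by (intro H.U_triangle h x H.cauchy_seqs_free[OF y])
      also have "univ_seminorm H (y m - ?h (x n)) \<le>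
          univ_seminorm H (y m - y n) + univ_seminorm H (y n - ?h (x n))"
        by (intro H.U_triangle h x H.cauchy_seqs_free[OF y])
      finally show ?thesis
        using x(2)[of m] x(2)[of n] H.U_commute[OF h[OF x(1)[of n]] H.cauchy_seqs_free[OF y]]
        by (simp add: iso x(1))
    qed
    have xc: "x \<in> cauchy_seqs G"
    proof (rule G.cauchy_seqsI)
      fix \<epsilon> :: real assume "\<epsilon> > 0"
      then obtain N where "\<forall>m\<ge>N. \<forall>n\<ge>N. univ_seminorm H (y m - y n) < \<epsilon>"
        using H.cauchy_seqsD[OF y] by blast
      then show "\<exists>N. \<forall>m\<ge>N. \<forall>n\<ge>N. univ_seminorm G (x m - x n) < \<epsilon>"
        using le by (meson le_less_trans)
    qed (rule x)
    have "\<phi> (G.cls x) = H.cls y"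
      using H.cls_eq_iff[OF hc[OF xc] y] by (simp add: \<phi> xc x(2))
    then show ?thesis using xc by blast
  qed
  have sum: "(\<Sum>v\<in>verts G. sp_P v) \<in> free_star_alg G" "(\<Sum>v\<in>verts H. sp_P v) \<in> free_star_alg H"
    by (auto intro: sum_in_free_star_alg G.sp_P_free H.sp_P_free)
  note cs = G.cauchy_seqs_add G.cauchy_seqs_mult G.cauchy_seqs_scale G.cauchy_seqs_star
    G.cauchy_seqs_const H.cauchy_seqs_const hc
  have "\<phi> \<in> Ring.ring_hom (graph_cstar_algebra G) (graph_cstar_algebra H)"
  proof (rule ring_hom_memI)
    fix X Y
    assume X: "X \<in> carrier (graph_cstar_algebra G)" and Y: "Y \<in> carrier (graph_cstar_algebra G)"
    obtain x where x: "x \<in> cauchy_seqs G" "X = G.cls x" using X unfolding G.carrier_eq by blast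
    obtain y where y: "y \<in> cauchy_seqs G" "Y = G.cls y" using Y unfolding G.carrier_eq by blast
    show "\<phi> (X \<otimes>\<^bsub>graph_cstar_algebra G\<^esub> Y) = \<phi> X \<otimes>\<^bsub>graph_cstar_algebra H\<^esub> \<phi> Y"
      using x(1) y(1) by (simp add: x(2) y(2) G.mult_cls H.mult_cls \<phi> cs star_hom_mult)
    show "\<phi> (X \<oplus>\<^bsub>graph_cstar_algebra G\<^esub> Y) = \<phi> X \<oplus>\<^bsub>graph_cstar_algebra H\<^esub> \<phi> Y"
      using x(1) y(1) by (simp add: x(2) y(2) G.add_cls H.add_cls \<phi> cs star_hom_add)
  next
    fix X assume "X \<in> carrier (graph_cstar_algebra G)"
    then obtain x where "x \<in> cauchy_seqs G" "X = G.cls x" unfolding G.carrier_eq by blast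
    then show "\<phi> X \<in> carrier (graph_cstar_algebra H)"
      unfolding H.carrier_eq using hc by (simp add: \<phi>)
  next
    show "\<phi> \<one>\<^bsub>graph_cstar_algebra G\<^esub> = \<one>\<^bsub>graph_cstar_algebra H\<^esub>"
      unfolding G.one_eq H.one_eq
      using H.cls_eq_iff[of "\<lambda>n. ?h (\<Sum>v\<in>verts G. sp_P v)" "\<lambda>n. \<Sum>v\<in>verts H. sp_P v"] sum
      by (simp add: \<phi> cs h unit)
  qed
  moreover have "bij_betw \<phi> (carrier (graph_cstar_algebra G)) (carrier (graph_cstar_algebra H))"
    unfolding bij_betw_def G.carrier_eq H.carrier_eq
  proof (intro conjI equalityI subsetI)
    fix Y assume "Y \<in> \<phi> ` G.cls ` cauchy_seqs G"
    then obtain x where "x \<in> cauchy_seqs G" "Y = \<phi> (G.cls x)" by blast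
    then show "Y \<in> H.cls ` cauchy_seqs H" using hc by (simp add: \<phi>)
  next
    fix Y assume "Y \<in> H.cls ` cauchy_seqs H"
    then show "Y \<in> \<phi> ` G.cls ` cauchy_seqs G" using surj by blast
  qed (rule inj)
  ultimately have "\<phi> \<in> ring_iso (graph_cstar_algebra G) (graph_cstar_algebra H)"
    by (simp add: ring_iso_def)
  moreover have "\<phi> (c \<odot>\<^bsub>graph_cstar_algebra G\<^esub> X) = c \<odot>\<^bsub>graph_cstar_algebra H\<^esub> \<phi> X"
    if X: "X \<in> carrier (graph_cstar_algebra G)" for c X
  proof -
    obtain x where "x \<in> cauchy_seqs G" "X = G.cls x" using X unfolding G.carrier_eq by blast
    then show ?thesis by (simp add: G.smult_cls H.smult_cls \<phi> cs star_hom_scale)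
  qed
  moreover have "\<phi> (star (graph_cstar_algebra G) X) = star (graph_cstar_algebra H) (\<phi> X)"
    if X: "X \<in> carrier (graph_cstar_algebra G)" for X
  proof -
    obtain x where "x \<in> cauchy_seqs G" "X = G.cls x" using X unfolding G.carrier_eq by blast
    then show ?thesis by (simp add: G.star_cls H.star_cls \<phi> cs star_hom_star)
  qed
  ultimately show ?thesis unfolding star_isomorphic_def by blast
qed

text \<open>
  Mutually inverse homomorphisms of the free *-algebras modulo the relations are isometric,
  because composing a seminorm with one of them gives an admissible seminorm.
\<close>

lemma star_isomorphic_graph_cstar_algebra_by_inverse:
  fixes \<sigma> :: "('v, 'e) gen \<Rightarrow> ('v, 'e) gen star_poly"
  assumes G: "finite_graph G" and H: "finite_graph H"
    and \<sigma>: "\<And>x. x \<in> graph_gens G \<Longrightarrow> \<sigma> x \<in> free_star_alg H"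
    and \<tau>: "\<And>x. x \<in> graph_gens H \<Longrightarrow> \<tau> x \<in> free_star_alg G"
    and ck_\<sigma>: "ga.ck_family G (\<lambda>v. poly_class H (\<sigma> (Vert v))) (\<lambda>e. poly_class H (\<sigma> (Edge e)))"
    and ck_\<tau>: "ga.ck_family H (\<lambda>v. poly_class G (\<tau> (Vert v))) (\<lambda>e. poly_class G (\<tau> (Edge e)))"
    and \<tau>\<sigma>: "\<And>x. x \<in> graph_gens G \<Longrightarrow> poly_class G (star_hom \<tau> (\<sigma> x)) = poly_class G (sp_gen x)"
    and \<sigma>\<tau>: "\<And>x. x \<in> graph_gens H \<Longrightarrow> poly_class H (star_hom \<sigma> (\<tau> x)) = poly_class H (sp_gen x)"
    and unit: "(\<Sum>v\<in>verts G. poly_class H (\<sigma> (Vert v))) = (\<Sum>v\<in>verts H. poly_class H (sp_P v))"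
  shows "star_isomorphic (graph_cstar_algebra G) (graph_cstar_algebra H)"
proof -
  interpret G: finite_graph G by (rule G)
  interpret H: finite_graph H by (rule H)
  have le: "univ_seminorm K (star_hom \<rho> f) \<le> univ_seminorm L f"
    if K: "finite_graph K" and L: "finite_graph L" and \<rho>: "\<And>x. x \<in> graph_gens L \<Longrightarrow> \<rho> x \<in> free_star_alg K"
      and ck: "ga.ck_family L (\<lambda>v. poly_class K (\<rho> (Vert v))) (\<lambda>e. poly_class K (\<rho> (Edge e)))"
      and f: "f \<in> free_star_alg L"
    for K L :: "('v, 'e) pre_digraph" and \<rho> f
  proof -
    interpret K: finite_graph K by (rule K)
    interpret L: finite_graph L by (rule L)
    have m: "star_hom \<rho> f \<in> free_star_alg K" if "f \<in> free_star_alg L" for f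
      using star_hom_in_free_star_alg[OF that] \<rho> by blast
    have "star_hom \<rho> r \<in> null_polys K" if "r \<in> graph_relators L" for r
      using ck_family_poly_class_iff[of L \<rho> K, OF L.head_in_verts \<rho>] ck that by blast
    then have "univ_seminorm K (star_hom \<rho> r) = 0" if "r \<in> graph_relators L" for r
      using that null_polysD K.ck_seminorm_univ by blast
    then have "ck_seminorm L (\<lambda>f. univ_seminorm K (star_hom \<rho> f))"
      unfolding ck_seminorm_def cstar_seminorm_on_def
      by (simp add: star_hom_add star_hom_scale star_hom_mult star_hom_star m K.U_nonneg K.U_add
          K.U_scale K.U_mult poly_seminorm_star_mult[OF K.cstar_seminorm_univ])
    from L.ck_seminorm_le_univ[OF this f] show ?thesis .
  qed
  \<comment> \<open>The composite agrees with the identity on generators modulo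
    \<open>null_polys\<close>, and this set is an ideal closed under the involution, so the
    agreement spreads to all polynomials.\<close>
  have inv: "star_hom \<rho>' (star_hom \<rho> f) - f \<in> null_polys L"
    if \<rho>: "\<And>x. x \<in> graph_gens L \<Longrightarrow> \<rho> x \<in> free_star_alg K"
      and \<rho>': "\<And>x. x \<in> graph_gens K \<Longrightarrow> \<rho>' x \<in> free_star_alg L"
      and i: "\<And>x. x \<in> graph_gens L \<Longrightarrow> poly_class L (star_hom \<rho>' (\<rho> x)) = poly_class L (sp_gen x)"
      and f: "f \<in> free_star_alg L"
    for K L :: "('v, 'e) pre_digraph" and \<rho> \<rho>' f
  proof -
    define k where "k f = star_hom \<rho>' (star_hom \<rho> f)" for f
    have k: "k f \<in> free_star_alg L" if "f \<in> free_star_alg L" for f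
      unfolding k_def by (intro star_hom_in_free_star_alg[of _ K] star_hom_in_free_star_alg[of _ L] \<rho> \<rho>' that)
    have g: "k (sp_gen x) - sp_gen x \<in> null_polys L" if "x \<in> graph_gens L" for x
      using i[OF that] poly_class_eq_iff[OF k[OF sp_gen_in_free_star_alg[OF that]] sp_gen_in_free_star_alg[OF that]]
      by (simp add: k_def)
    have "k f - f \<in> null_polys L"
      using f
    proof (induction rule: free_star_alg_induct)
      case zero
      show ?case by (simp add: k_def)
    next
      case (gen x)
      then show ?case by (rule g)
    next
      case (star x)
      then show ?case
        using null_polys_star[OF g[OF star(1)]] by (simp add: k_def star_hom_star sp_star_diff)
    next
      case (mult f g)
      \<comment> \<open>Changing one factor at a time leaves in each summand a factor that is null
        by the induction hypothesis.\<close>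
      have "k (f * g) - f * g = k f * (k g - g) + (k f - f) * g"
        by (simp add: k_def star_hom_mult algebra_simps)
      then show ?case
        using mult by (simp add: null_polys_add null_polys_mult_left null_polys_mult_right k)
    next
      case (scale c f)
      have "k (sp_scale c f) - sp_scale c f = sp_scale c (k f - f)"
        by (simp add: k_def star_hom_scale sp_scale_diff_right)
      then show ?case using scale by (simp add: null_polys_scale)
    next
      case (add f g)
      have "k (f + g) - (f + g) = (k f - f) + (k g - g)"
        by (simp add: k_def star_hom_add)
      then show ?case using null_polys_add[OF add(3,4)] by (simp only:)
    qed
    then show ?thesis by (simp add: k_def)
  qed
  show ?thesis
  proof (rule star_isomorphic_graph_cstar_algebraI[OF G H \<sigma>])
    fix f assume f: "f \<in> free_star_alg G"
    have hf: "star_hom \<sigma> f \<in> free_star_alg H" by (intro star_hom_in_free_star_alg[OF f] \<sigma>)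
    have "star_hom \<tau> (star_hom \<sigma> f) \<in> free_star_alg G" by (intro star_hom_in_free_star_alg[OF hf] \<tau>)
    then have "univ_seminorm G (star_hom \<tau> (star_hom \<sigma> f)) = univ_seminorm G f"
      using inv[OF \<sigma> \<tau> \<tau>\<sigma> f] null_polysD[OF _ G.ck_seminorm_univ] f
      by (intro poly_seminorm_eqI[OF G.cstar_seminorm_univ]) auto
    \<comment> \<open>Both substitutions are contractive, and the composite keeps the seminorm of
      \<open>f\<close>; so \<open>f\<close> cannot lose seminorm under the first of them.\<close>
    then show "univ_seminorm H (star_hom \<sigma> f) = univ_seminorm G f"
      using le[OF G H \<tau> ck_\<tau> hf] le[OF H G \<sigma> ck_\<sigma> f] by linarith
  next
    fix g assume g: "g \<in> free_star_alg H"
    have "univ_seminorm H (star_hom \<sigma> (star_hom \<tau> g) - g) = 0"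
      using inv[OF \<tau> \<sigma> \<sigma>\<tau> g] null_polysD[OF _ H.ck_seminorm_univ] by blast
    moreover have "star_hom \<tau> g \<in> free_star_alg G" by (intro star_hom_in_free_star_alg[OF g] \<tau>)
    ultimately show "\<exists>f\<in>free_star_alg G. univ_seminorm H (star_hom \<sigma> f - g) = 0" by blast
  next
    have V: "\<sigma> (Vert v) \<in> free_star_alg H" if "v \<in> verts G" for v
      using that by (intro \<sigma>) (simp add: graph_gens_def)
    have "poly_class H (star_hom \<sigma> (\<Sum>v\<in>verts G. sp_P v)) = poly_class H (\<Sum>v\<in>verts H. sp_P v)"
      using unit by (simp add: star_hom_sum poly_class_sum V H.sp_P_free)
    then have "star_hom \<sigma> (\<Sum>v\<in>verts G. sp_P v) - (\<Sum>v\<in>verts H. sp_P v) \<in> null_polys H"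
      by (subst (asm) poly_class_eq_iff)
        (auto simp: star_hom_sum intro!: sum_in_free_star_alg V H.sp_P_free)
    then show "univ_seminorm H (star_hom \<sigma> (\<Sum>v\<in>verts G. sp_P v) - (\<Sum>v\<in>verts H. sp_P v)) = 0"
      using null_polysD H.ck_seminorm_univ by blast
  qed
qed

section \<open>Conclusion\<close>

lemma finite_graph_mat_A: "finite_graph (mat_digraph 4 mat_A)"
  by standard (auto simp: arcs_mat_A)

lemma finite_graph_mat_B: "finite_graph (mat_digraph 4 mat_B)"
  by standard (auto simp: arcs_mat_B)

section \<open>The explicit formulas under passage to classes and under substitution\<close>

context
  fixes K :: "('v, 'e) pre_digraph" and p :: "nat \<Rightarrow> ('v, 'e) gen star_poly"
    and s :: "nat \<times> nat \<Rightarrow> ('v, 'e) gen star_poly"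
  assumes p: "\<forall>v<4. p v \<in> free_star_alg K"
begin

text \<open>Stated for arbitrary \<open>p\<close> and \<open>s\<close>, because it is applied to the
  generators of B and also to the polynomials that a first substitution puts in their place.\<close>

lemma poly_class_A:
  assumes s: "\<forall>e\<in>arcs (mat_digraph 4 mat_B). s e \<in> free_star_alg K"
  shows A_vert_free: "A_vert sp_star p s v \<in> free_star_alg K"
    and A_edge_free: "A_edge sp_star p s e \<in> free_star_alg K"
    and poly_class_A_vert: "poly_class K (A_vert sp_star p s v) =
      A_vert ga_star (\<lambda>v. poly_class K (p v)) (\<lambda>e. poly_class K (s e)) v"
    and poly_class_A_edge: "poly_class K (A_edge sp_star p s e) =
      A_edge ga_star (\<lambda>v. poly_class K (p v)) (\<lambda>e. poly_class K (s e)) e"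
proof -
  note cl = free_star_alg_add free_star_alg_mult free_star_alg_star
  note hom = poly_class_add poly_class_mult poly_class_star
  note s' = s[unfolded arcs_mat_B, simplified, folded One_nat_def]
  show v: "A_vert sp_star p s v \<in> free_star_alg K" for v
    by (simp add: A_vert_def p s' cl del: One_nat_def)
  show "A_edge sp_star p s e \<in> free_star_alg K"
    by (simp add: A_edge_def v p s' cl del: One_nat_def)
  show V: "poly_class K (A_vert sp_star p s v) =
      A_vert ga_star (\<lambda>v. poly_class K (p v)) (\<lambda>e. poly_class K (s e)) v" for v
    by (simp add: A_vert_def p s' cl hom del: One_nat_def)
  show "poly_class K (A_edge sp_star p s e) =
      A_edge ga_star (\<lambda>v. poly_class K (p v)) (\<lambda>e. poly_class K (s e)) e"
    by (simp add: A_edge_def v V p s' cl hom del: One_nat_def)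
qed

lemma poly_class_B:
  assumes s: "\<forall>e\<in>arcs (mat_digraph 4 mat_A). s e \<in> free_star_alg K"
  shows B_vert_free: "B_vert sp_star p s v \<in> free_star_alg K"
    and B_edge_free: "B_edge sp_star p s e \<in> free_star_alg K"
    and poly_class_B_vert: "poly_class K (B_vert sp_star p s v) =
      B_vert ga_star (\<lambda>v. poly_class K (p v)) (\<lambda>e. poly_class K (s e)) v"
    and poly_class_B_edge: "poly_class K (B_edge sp_star p s e) =
      B_edge ga_star (\<lambda>v. poly_class K (p v)) (\<lambda>e. poly_class K (s e)) e"
proof -
  note cl = free_star_alg_add free_star_alg_mult free_star_alg_star
  note hom = poly_class_add poly_class_mult poly_class_star
  note s' = s[unfolded arcs_mat_A, simplified, folded One_nat_def]
  show v: "B_vert sp_star p s v \<in> free_star_alg K" for v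
    by (simp add: B_vert_def p s' cl del: One_nat_def)
  show "B_edge sp_star p s e \<in> free_star_alg K"
    by (simp add: B_edge_def v p s' cl del: One_nat_def)
  show V: "poly_class K (B_vert sp_star p s v) =
      B_vert ga_star (\<lambda>v. poly_class K (p v)) (\<lambda>e. poly_class K (s e)) v" for v
    by (simp add: B_vert_def p s' cl hom del: One_nat_def)
  show "poly_class K (B_edge sp_star p s e) =
      B_edge ga_star (\<lambda>v. poly_class K (p v)) (\<lambda>e. poly_class K (s e)) e"
    by (simp add: B_edge_def v V p s' cl hom del: One_nat_def)
qed

end

lemma star_hom_A_vert: "star_hom \<tau> (A_vert sp_star p s v) =
    A_vert sp_star (\<lambda>v. star_hom \<tau> (p v)) (\<lambda>e. star_hom \<tau> (s e)) v"
  and star_hom_B_vert: "star_hom \<tau> (B_vert sp_star p s v) =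
    B_vert sp_star (\<lambda>v. star_hom \<tau> (p v)) (\<lambda>e. star_hom \<tau> (s e)) v"
  by (simp_all add: A_vert_def B_vert_def star_hom_add star_hom_mult star_hom_star)

lemma star_hom_A_edge: "star_hom \<tau> (A_edge sp_star p s e) =
    A_edge sp_star (\<lambda>v. star_hom \<tau> (p v)) (\<lambda>e. star_hom \<tau> (s e)) e"
  and star_hom_B_edge: "star_hom \<tau> (B_edge sp_star p s e) =
    B_edge sp_star (\<lambda>v. star_hom \<tau> (p v)) (\<lambda>e. star_hom \<tau> (s e)) e"
  by (simp_all add: A_edge_def B_edge_def star_hom_add star_hom_mult star_hom_star
      star_hom_A_vert star_hom_B_vert)

lemma star_isomorphic_A_B:
  "star_isomorphic (cuntz_krieger_algebra 4 mat_A) (cuntz_krieger_algebra 4 mat_B)"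
proof -
  let ?A = "mat_digraph 4 mat_A" and ?B = "mat_digraph 4 mat_B"
  interpret A: finite_graph ?A by (rule finite_graph_mat_A)
  interpret B: finite_graph ?B by (rule finite_graph_mat_B)
  interpret CA: strong_ck_A ga_star "\<lambda>v. poly_class ?A (sp_P v)" "\<lambda>e. poly_class ?A (sp_S e)"
    unfolding strong_ck_A_def by (rule A.strong_ck_family_gens)
  interpret CB: strong_ck_B ga_star "\<lambda>v. poly_class ?B (sp_P v)" "\<lambda>e. poly_class ?B (sp_S e)"
    unfolding strong_ck_B_def by (rule B.strong_ck_family_gens)
  \<comment> \<open>\<open>A_vert\<close> and \<open>A_edge\<close> express a family for A through
    generators of B, so \<open>\<sigma>\<close> leads from polynomials over A to polynomials over B,
    and \<open>\<tau>\<close> leads back.\<close>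
  define \<sigma> :: "(nat, nat \<times> nat) gen \<Rightarrow> (nat, nat \<times> nat) gen star_poly"
    where "\<sigma> = case_gen (A_vert sp_star sp_P sp_S) (A_edge sp_star sp_P sp_S)"
  define \<tau> :: "(nat, nat \<times> nat) gen \<Rightarrow> (nat, nat \<times> nat) gen star_poly"
    where "\<tau> = case_gen (B_vert sp_star sp_P sp_S) (B_edge sp_star sp_P sp_S)"
  have \<sigma> [simp]: "\<sigma> (Vert v) = A_vert sp_star sp_P sp_S v" "\<sigma> (Edge e) = A_edge sp_star sp_P sp_S e" for v e
    by (simp_all add: \<sigma>_def)
  have \<tau> [simp]: "\<tau> (Vert v) = B_vert sp_star sp_P sp_S v" "\<tau> (Edge e) = B_edge sp_star sp_P sp_S e" for v e
    by (simp_all add: \<tau>_def)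
  have fA: "\<forall>v<4. sp_P v \<in> free_star_alg ?A" "\<forall>e\<in>arcs ?A. sp_S e \<in> free_star_alg ?A"
    by (simp_all add: A.sp_P_free A.sp_S_free)
  have fB: "\<forall>v<4. sp_P v \<in> free_star_alg ?B" "\<forall>e\<in>arcs ?B. sp_S e \<in> free_star_alg ?B"
    by (simp_all add: B.sp_P_free B.sp_S_free)
  note A_simps = poly_class_A_vert[OF fB] poly_class_A_edge[OF fB]
  note B_simps = poly_class_B_vert[OF fA] poly_class_B_edge[OF fA]
  have \<sigma>_free: "\<forall>v<4. A_vert sp_star sp_P sp_S v \<in> free_star_alg ?B"
      "\<forall>e\<in>arcs ?A. A_edge sp_star sp_P sp_S e \<in> free_star_alg ?B"
    by (simp_all add: A_vert_free[OF fB] A_edge_free[OF fB])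
  have \<tau>_free: "\<forall>v<4. B_vert sp_star sp_P sp_S v \<in> free_star_alg ?A"
      "\<forall>e\<in>arcs ?B. B_edge sp_star sp_P sp_S e \<in> free_star_alg ?A"
    by (simp_all add: B_vert_free[OF fA] B_edge_free[OF fA])
  have "star_isomorphic (graph_cstar_algebra ?A) (graph_cstar_algebra ?B)"
  proof (rule star_isomorphic_graph_cstar_algebra_by_inverse[OF A.finite_graph_axioms B.finite_graph_axioms])
    show "\<sigma> x \<in> free_star_alg ?B" for x by (cases x) (simp_all add: A_vert_free[OF fB] A_edge_free[OF fB])
    show "\<tau> x \<in> free_star_alg ?A" for x by (cases x) (simp_all add: B_vert_free[OF fA] B_edge_free[OF fA])
    show "ga.ck_family ?A (\<lambda>v. poly_class ?B (\<sigma> (Vert v))) (\<lambda>e. poly_class ?B (\<sigma> (Edge e)))"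
      using CB.ck_family_A by (simp add: A_simps)
    show "ga.ck_family ?B (\<lambda>v. poly_class ?A (\<tau> (Vert v))) (\<lambda>e. poly_class ?A (\<tau> (Edge e)))"
      using CA.ck_family_B by (simp add: B_simps)
    show "poly_class ?A (star_hom \<tau> (\<sigma> x)) = poly_class ?A (sp_gen x)" if "x \<in> graph_gens ?A" for x
    proof (cases x)
      case (Vert v)
      then have "v < 4" using that by (auto simp: graph_gens_def)
      then show ?thesis
        by (simp add: Vert star_hom_A_vert poly_class_A_vert[OF \<tau>_free] B_simps CA.A_vert_B)
    next
      case (Edge e)
      then have "e \<in> arcs ?A" using that by (auto simp: graph_gens_def)
      then show ?thesis
        by (simp add: Edge star_hom_A_edge poly_class_A_edge[OF \<tau>_free] B_simps CA.A_edge_B)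
    qed
    show "poly_class ?B (star_hom \<sigma> (\<tau> x)) = poly_class ?B (sp_gen x)" if "x \<in> graph_gens ?B" for x
    proof (cases x)
      case (Vert v)
      then have "v < 4" using that by (auto simp: graph_gens_def)
      then show ?thesis
        by (simp add: Vert star_hom_B_vert poly_class_B_vert[OF \<sigma>_free] A_simps CB.B_vert_A)
    next
      case (Edge e)
      then have "e \<in> arcs ?B" using that by (auto simp: graph_gens_def)
      then show ?thesis
        by (simp add: Edge star_hom_B_edge poly_class_B_edge[OF \<sigma>_free] A_simps CB.B_edge_A)
    qed
    show "(\<Sum>v\<in>verts ?A. poly_class ?B (\<sigma> (Vert v))) = (\<Sum>v\<in>verts ?B. poly_class ?B (sp_P v))"
      using CB.sum_A_vert by (simp add: A_simps)
  qed
  then show ?thesis by (simp add: cuntz_krieger_algebra_def)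
qed

theorem mainTheorem4:
  shows "\<not> (\<forall>A B. zero_one_mat 4 A \<and> irreducible_mat 4 A \<and> \<not> permutation_mat 4 A \<and>
              zero_one_mat 4 B \<and> irreducible_mat 4 B \<and> \<not> permutation_mat 4 B \<and>
              star_isomorphic (cuntz_krieger_algebra 4 A) (cuntz_krieger_algebra 4 B) \<longrightarrow>
              primitively_equivalent 4 A B) \<and>
         zero_one_mat 4 mat_A \<and> irreducible_mat 4 mat_A \<and> \<not> permutation_mat 4 mat_A \<and>
         zero_one_mat 4 mat_B \<and> irreducible_mat 4 mat_B \<and> \<not> permutation_mat 4 mat_B \<and>
         star_isomorphic (cuntz_krieger_algebra 4 mat_A) (cuntz_krieger_algebra 4 mat_B) \<and>
         \<not> primitively_equivalent 4 mat_A mat_B"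
  using zero_one_mat_A zero_one_mat_B irreducible_mat_A irreducible_mat_B
    not_permutation_mat_A not_permutation_mat_B star_isomorphic_A_B not_primitively_equivalent_A_B
  by blast

end
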